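(* For a spherical/plane curve $P$ define $$\lambda^{(3)}(P)=y_1(P)-3y_2(P)+3y_3(P),$$ $$\lambda^{(4)}(P)=2y_3(P)+8y_4(P)+5y_5(P)+y_6(P)-4y_7(P)+2y_8(P)-2y_9(P),$$ where $y_1,\dots,y_9$ are the chord diagrams $$y_1=[abab],\quad y_2=[abcabc],\quad y_3=[abacbc],\quad y_4=[abcdbadc],\quad y_5=[dabcdcba],$$ $$y_6=[abdcdabc],\quad y_7=[abcdabcd],\quad y_8=[abacbdcd],\quad y_9=[abcdbacd].$$ Then $\lambda^{(4)}$, as a function on the set of ambient isotopy classes of spherical/plane curves, is invariant under RI and strong RIII. Moreover, there exist spherical curves $P$ and $P'$ such that $\lambda^{(3)}(P)=\lambda^{(3)}(P')$ and $\lambda^{(4)}(P)\neq\lambda^{(4)}(P')$.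
   Context: A spherical (plane) curve is the image of a generic immersion of a circle into $S^2$ ($\mathbb{R}^2$), considered up to ambient isotopy. The moves RI and RIII are the usual Reidemeister moves with over/under information ignored: RI adds or removes a monogon (kink), RIII moves a strand across a double point (replacing a triangle by the opposite triangle). An RIII is called strong if, for an orientation of the curve, the induced orientations on the edges of the triangle are coherent (form a directed cycle). A Gauss word is a word in which each occurring letter appears exactly twice. Two Gauss words are isomorphic if they agree up to a bijective renaming of letters, cyclic rotation, and reversal; $[v]$ denotes the isomorphism class of $v$. Isomorphism classes of Gauss words are identified with chord diagrams (configurations of $n$ pairs of points on a circle, up to ambient isotopy and reflection of the circle; each pair is joined by a chord). For a curve $P=g(S^1)$ its chord diagram $CD_P$ is given by the pairs $g^{-1}(\text{double point})$ on $S^1$. For a chord diagram $x$, $x(P)$ is the number of subsets of the chords of $CD_P$ that form a sub-chord diagram isomorphic to $x$. (The intersection graphs of $y_1,\dots,y_9$, with chords as vertices and crossing pairs as edges, are: a single edge; triangle; path on 3 vertices; 4-cycle; star $K_{1,3}$; triangle with a pendant edge; $K_4$; path on 4 vertices; $K_4$ minus an edge.) *)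

theory Defs
  imports "HOL-Analysis.Analysis"
begin

section \<open>Gauss words\<close>

definition gauss_word :: "'a list \<Rightarrow> bool" where
  "gauss_word w \<longleftrightarrow> (\<forall>x\<in>set w. count_list w x = 2)"

definition word_iso :: "'a list \<Rightarrow> 'b list \<Rightarrow> bool" where
  "word_iso v w \<longleftrightarrow>
     (\<exists>f n. inj_on f (set v) \<and> (w = rotate n (map f v) \<or> w = rotate n (rev (map f v))))"

definition y1 :: string where "y1 = ''abab''"
definition y2 :: string where "y2 = ''abcabc''"
definition y3 :: string where "y3 = ''abacbc''"
definition y4 :: string where "y4 = ''abcdbadc''"
definition y5 :: string where "y5 = ''dabcdcba''"
definition y6 :: string where "y6 = ''abdcdabc''"
definition y7 :: string where "y7 = ''abcdabcd''"
definition y8 :: string where "y8 = ''abacbdcd''"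
definition y9 :: string where "y9 = ''abcdbacd''"

lemma gauss_word_y:
  "gauss_word y1" "gauss_word y2" "gauss_word y3" "gauss_word y4" "gauss_word y5"
  "gauss_word y6" "gauss_word y7" "gauss_word y8" "gauss_word y9"
  by (simp_all add: gauss_word_def y1_def y2_def y3_def y4_def y5_def y6_def y7_def y8_def y9_def)


section \<open>Generic immersions of the circle\<close>

text \<open>The circle is the quotient of the real line by the integers: a map defined on it is a
  function of period 1 on the reals, \<open>{0..<1}\<close> is a fundamental domain, and the image of the
  circle is the range of the function. The ambient surface \<open>X\<close> is either the plane
  \<open>UNIV :: (real^2) set\<close> or the sphere \<open>sphere (0 :: real^3) 1\<close>. In both cases the tangent spaces
  of \<open>X\<close> are two-dimensional, so two branches are transverse iff their velocities are linearly
  independent.\<close>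

definition smooth :: "(real \<Rightarrow> 'a::real_normed_vector) \<Rightarrow> bool" where
  "smooth g \<longleftrightarrow>
     (\<exists>D :: nat \<Rightarrow> real \<Rightarrow> 'a. D 0 = g \<and>
        (\<forall>n t. (D n has_vector_derivative D (Suc n) t) (at t)))"

definition double_points :: "(real \<Rightarrow> 'a) \<Rightarrow> 'a set" where
  "double_points g = {p. \<exists>s\<in>{0..<1}. \<exists>t\<in>{0..<1}. s \<noteq> t \<and> g s = p \<and> g t = p}"

definition generic_immersion :: "'a::euclidean_space set \<Rightarrow> (real \<Rightarrow> 'a) \<Rightarrow> bool" where
  "generic_immersion X g \<longleftrightarrow>
     range g \<subseteq> X \<and> (\<forall>t. g (t + 1) = g t) \<and>
     smooth g \<and> (\<forall>t. vector_derivative g (at t) \<noteq> 0) \<and>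
     finite (double_points g) \<and>
     (\<forall>p\<in>double_points g. card {t\<in>{0..<1}. g t = p} = 2) \<and>
     (\<forall>s\<in>{0..<1}. \<forall>t\<in>{0..<1}. s \<noteq> t \<and> g s = g t \<longrightarrow>
        \<not> collinear {0, vector_derivative g (at s), vector_derivative g (at t)})"


section \<open>Chord diagrams\<close>

text \<open>A chord is the pair of parameters in \<open>{0..<1}\<close> of a double point. A set of chords is
  turned into a Gauss word by reading its endpoints along the circle; the letters are the
  chords themselves.\<close>

definition chord_diagram :: "(real \<Rightarrow> 'a) \<Rightarrow> real set set" where
  "chord_diagram g = (\<lambda>p. {t\<in>{0..<1}. g t = p}) ` double_points g"

definition chord_word :: "real set set \<Rightarrow> real set list" where
  "chord_word C = map (\<lambda>t. THE c. c \<in> C \<and> t \<in> c) (sorted_list_of_set (\<Union>C))"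

definition subdiagram_count :: "'b list \<Rightarrow> (real \<Rightarrow> 'a) \<Rightarrow> int" where
  "subdiagram_count x g = int (card {C. C \<subseteq> chord_diagram g \<and> word_iso (chord_word C) x})"

definition lambda3 :: "(real \<Rightarrow> 'a) \<Rightarrow> int" where
  "lambda3 g = subdiagram_count y1 g - 3 * subdiagram_count y2 g + 3 * subdiagram_count y3 g"

definition lambda4 :: "(real \<Rightarrow> 'a) \<Rightarrow> int" where
  "lambda4 g = 2 * subdiagram_count y3 g + 8 * subdiagram_count y4 g + 5 * subdiagram_count y5 g
     + subdiagram_count y6 g - 4 * subdiagram_count y7 g + 2 * subdiagram_count y8 g
     - 2 * subdiagram_count y9 g"


section \<open>Ambient isotopy and Reidemeister moves\<close>

text \<open>The following relations are between curves, regarded as subsets of \<open>X\<close>.\<close>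

definition ambient_isotopic :: "'a::euclidean_space set \<Rightarrow> 'a set \<Rightarrow> 'a set \<Rightarrow> bool" where
  "ambient_isotopic X P P' \<longleftrightarrow>
     (\<exists>h. homotopic_with_canon (\<lambda>f. \<exists>f'. homeomorphism X X f f') X X id h \<and> h ` P = P')"

definition disc_in :: "'a::euclidean_space set \<Rightarrow> (complex \<Rightarrow> 'a) \<Rightarrow> bool" where
  "disc_in X \<psi> \<longleftrightarrow>
     continuous_on (cball 0 1) \<psi> \<and> inj_on \<psi> (cball 0 1) \<and> \<psi> ` cball 0 1 \<subseteq> X"

definition strand :: "(complex \<Rightarrow> 'a) \<Rightarrow> (real \<Rightarrow> 'a) \<Rightarrow> real \<Rightarrow> real \<Rightarrow> bool" where
  "strand \<psi> g a b \<longleftrightarrow>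
     g a \<in> \<psi> ` sphere 0 1 \<and> g b \<in> \<psi> ` sphere 0 1 \<and> g ` {a<..<b} \<subseteq> \<psi> ` ball 0 1"

text \<open>RI: the two curves agree outside a disc; one of them meets the disc in an embedded arc, the
  other one in an arc with the same ends and one self-crossing (at the parameters \<open>s < t\<close>),
  whose loop is the monogon.\<close>

definition adds_kink ::
    "'a::euclidean_space set \<Rightarrow> (real \<Rightarrow> 'a) \<Rightarrow> (real \<Rightarrow> 'a) \<Rightarrow> bool" where
  "adds_kink X g g' \<longleftrightarrow>
     (\<exists>\<psi> a b. disc_in X \<psi> \<and> a < b \<and> b < a + 1 \<and>
        (\<forall>t\<in>{b..a + 1}. g' t = g t) \<and>
        (\<forall>t\<in>{b<..<a + 1}. g t \<notin> \<psi> ` cball 0 1) \<and>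
        strand \<psi> g a b \<and> strand \<psi> g' a b \<and>
        inj_on g {a..b} \<and>
        (\<exists>s t. {(u, v). u \<in> {a..b} \<and> v \<in> {a..b} \<and> u < v \<and> g' u = g' v} = {(s, t)}))"

definition RI :: "'a::euclidean_space set \<Rightarrow> 'a set \<Rightarrow> 'a set \<Rightarrow> bool" where
  "RI X P P' \<longleftrightarrow>
     (\<exists>g g'. generic_immersion X g \<and> generic_immersion X g' \<and> range g = P \<and> range g' = P' \<and>
        (adds_kink X g g' \<or> adds_kink X g' g))"

text \<open>RIII: the two curves agree outside a disc, which each of them meets in three embedded arcs
  (numbered 0, 1, 2) that pairwise cross exactly once. The crossing of the arcs \<open>i\<close> and \<open>j\<close>
  lies at the parameter \<open>\<sigma> i j\<close> on arc \<open>i\<close> and \<open>\<sigma> j i\<close> on arc \<open>j\<close> (for \<open>g'\<close>: \<open>\<tau> i j\<close> and \<open>\<tau> j i\<close>).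
  Relative to the boundary of the disc there are exactly two such configurations, namely a
  triangle and the opposite triangle; passing from one to the other reverses the order of the
  two crossings on each arc.\<close>

definition triangle_in :: "(complex \<Rightarrow> 'a) \<Rightarrow> (real \<Rightarrow> 'a) \<Rightarrow> (nat \<Rightarrow> real) \<Rightarrow> (nat \<Rightarrow> real) \<Rightarrow>
    (nat \<Rightarrow> nat \<Rightarrow> real) \<Rightarrow> bool" where
  "triangle_in \<psi> g a b \<sigma> \<longleftrightarrow>
     (\<forall>i<3. strand \<psi> g (a i) (b i) \<and> inj_on g {a i..b i}) \<and>
     (\<forall>i<3. \<forall>j<3. i \<noteq> j \<longrightarrow> \<sigma> i j \<in> {a i<..<b i} \<and>
        {(u, v). u \<in> {a i..b i} \<and> v \<in> {a j..b j} \<and> g u = g v} = {(\<sigma> i j, \<sigma> j i)})"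

definition coherent :: "(nat \<Rightarrow> nat \<Rightarrow> real) \<Rightarrow> bool" where
  "coherent \<sigma> \<longleftrightarrow>
     (\<sigma> 0 2 < \<sigma> 0 1 \<and> \<sigma> 1 0 < \<sigma> 1 2 \<and> \<sigma> 2 1 < \<sigma> 2 0) \<or>
     (\<sigma> 0 1 < \<sigma> 0 2 \<and> \<sigma> 1 2 < \<sigma> 1 0 \<and> \<sigma> 2 0 < \<sigma> 2 1)"

definition strong_RIII :: "'a::euclidean_space set \<Rightarrow> 'a set \<Rightarrow> 'a set \<Rightarrow> bool" where
  "strong_RIII X P P' \<longleftrightarrow>
     (\<exists>g g' \<psi> a b \<sigma> \<tau>.
        generic_immersion X g \<and> generic_immersion X g' \<and> range g = P \<and> range g' = P' \<and>
        disc_in X \<psi> \<and>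
        a 0 < b 0 \<and> b 0 < a 1 \<and> a 1 < b 1 \<and> b 1 < a 2 \<and> a 2 < b 2 \<and> b 2 < a 0 + 1 \<and>
        (\<forall>t\<in>{a 0..a 0 + 1} - (\<Union>i<3. {a i<..<b i}). g' t = g t) \<and>
        (\<forall>t\<in>{a 0..<a 0 + 1} - (\<Union>i<3. {a i..b i}). g t \<notin> \<psi> ` cball 0 1) \<and>
        triangle_in \<psi> g a b \<sigma> \<and> triangle_in \<psi> g' a b \<tau> \<and>
        (\<forall>i<3. \<forall>j<3. \<forall>k<3. i \<noteq> j \<and> j \<noteq> k \<and> i \<noteq> k \<longrightarrow> (\<sigma> i j < \<sigma> i k \<longleftrightarrow> \<tau> i k < \<tau> i j)) \<and>
        coherent \<sigma>)"

text \<open>A function of the parametrised curve descends to curves as subsets of \<open>X\<close>, and then to their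
  ambient isotopy classes, iff it is invariant under \<open>ambient_isotopic X\<close> in this sense:
  curves with equal images are ambient isotopic.\<close>

definition invariant_under ::
    "'a::euclidean_space set \<Rightarrow> ('a set \<Rightarrow> 'a set \<Rightarrow> bool) \<Rightarrow> ((real \<Rightarrow> 'a) \<Rightarrow> int) \<Rightarrow> bool" where
  "invariant_under X R F \<longleftrightarrow>
     (\<forall>g g'. generic_immersion X g \<and> generic_immersion X g' \<and> R (range g) (range g') \<longrightarrow>
        F g = F g')"

abbreviation plane :: "(real^2) set" where "plane \<equiv> UNIV"
abbreviation S2 :: "(real^3) set" where "S2 \<equiv> sphere 0 1"

end

(*
  Each of the diagrams y_1, ..., y_9 is determined among all chord diagrams by the multiset of degrees
  of its intersection graph, so lambda3 and lambda4 of a curve are weighted counts of the induced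
  subgraphs of the interlacement graph of its double points.

  The chord of a double point p crosses the chord of q if and only if one of the two loops of the curve
  at p contains neither both nor none of the branches through q. Near q the image of this loop is then
  neither everything nor nothing of the image of the curve, which is a property of the image alone.
  Hence lambda4 is invariant under homeomorphisms of the surface and under reparametrization.

  RI adds an isolated vertex to the interlacement graph, and isolated vertices have weight zero. A strong
  RIII exchanges three pairwise nonadjacent vertices for a triangle, each other vertex being
  adjacent to none or two of the three and keeping its neighbours elsewhere; the weights in lambda4 are
  such that the changes cancel.

  The two example curves are a closed 2-braid with interlacement graph K_5 and a closed 3-braid with
  eight double points, for which a latitude function is chosen whose difference under a third of a
  full turn factors explicitly.
*)
theory Submission
  imports Defs
begin

section \<open>Gauss words\<close>

text \<open>The obstacle is that the three relations speak of images, whereas \<open>lambda4\<close>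
  is read off a parametrization, and an ambient isotopy yields no more than a homeomorphism of the
  surface. After such a map the image of a loop might a priori be run through by a curve that turns
  from one branch into the other at a crossing. What excludes this is planar: if the loop contains
  exactly one branch at q, it cuts a small disc around q into two sides, and the curve reaches q
  from both. Four arms allow this only if the two arms in the loop are opposite, and a
  parametrization with nonzero velocity continues into the opposite arm. Two-sidedness is expressed
  by open sets alone, so it survives every homeomorphism. Independence of the parametrization is the
  case of the identity map. It allows a move to be studied with the base point at the start of its
  disc. The degree sequences are matched with the nine diagrams by enumerating the Gauss words with
  two, three or four letters, and the coefficients of \<open>lambda4\<close> solve the few linear
  equations that the triangle move imposes.\<close>

definition wcross :: "'a list \<Rightarrow> 'a \<Rightarrow> 'a \<Rightarrow> bool" where
  "wcross w x y \<longleftrightarrow> filter (\<lambda>z. z = x \<or> z = y) w \<in> {[x, y, x, y], [y, x, y, x]}"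

text \<open>The degree sequence of the subgraph induced on \<open>V\<close>. As a multiset it
  forgets the names of the vertices, so it is an isomorphism invariant.\<close>

definition profile :: "('a \<Rightarrow> 'a \<Rightarrow> bool) \<Rightarrow> 'a set \<Rightarrow> nat multiset" where
  "profile E V = image_mset (\<lambda>v. card {u\<in>V. E v u}) (mset_set V)"

lemma profile_bij:
  assumes "bij_betw f V V'" "\<And>x y. x \<in> V \<Longrightarrow> y \<in> V \<Longrightarrow> E' (f x) (f y) = E x y"
  shows "profile E' V' = profile E V"
proof -
  have inj: "inj_on f V" and img: "V' = f ` V" using assms(1) by (auto simp: bij_betw_def)
  have "card {u\<in>V'. E' (f v) u} = card {u\<in>V. E v u}" if "v \<in> V" for v
  proof -
    have "{u\<in>V'. E' (f v) u} = f ` {u\<in>V. E v u}" using assms(2) that img by auto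
    then show ?thesis using inj by (simp add: card_image inj_on_subset)
  qed
  then have "image_mset (\<lambda>v. card {u\<in>V'. E' (f v) u}) (mset_set V) = image_mset (\<lambda>v. card {u\<in>V. E v u}) (mset_set V)"
    by (cases "finite V") (auto intro!: image_mset_cong)
  then show ?thesis
    unfolding profile_def img by (simp add: image_mset_mset_set[OF inj, symmetric] multiset.map_comp comp_def)
qed

lemma profile_cong:
  assumes "\<And>x y. x \<in> V \<Longrightarrow> y \<in> V \<Longrightarrow> E' x y = E x y"
  shows "profile E' V = profile E V"
  using profile_bij[of id V V E' E] assms by simp

lemma size_profile: "size (profile E V) = card V"
  by (simp add: profile_def)

lemma wcross_map:
  assumes "inj_on f (set w)" "x \<in> set w" "y \<in> set w"
  shows "wcross (map f w) (f x) (f y) = wcross w x y"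
proof -
  let ?l = "filter (\<lambda>z. z = x \<or> z = y) w"
  have "filter (\<lambda>z. z = f x \<or> z = f y) (map f w) = map f ?l"
    unfolding filter_map using assms by (auto simp: inj_on_eq_iff intro!: arg_cong[where f="map f"] filter_cong)
  moreover have "map f ?l = map f l \<longleftrightarrow> ?l = l" if "set l \<subseteq> set w" for l
    using assms(1) that by (intro inj_on_map_eq_map) (auto intro: inj_on_subset)
  from this[of "[x,y,x,y]"] this[of "[y,x,y,x]"]
  have "map f ?l = [f x, f y, f x, f y] \<longleftrightarrow> ?l = [x,y,x,y]" "map f ?l = [f y, f x, f y, f x] \<longleftrightarrow> ?l = [y,x,y,x]"
    using assms by simp_all
  ultimately show ?thesis by (simp add: wcross_def)
qed

definition wprofile :: "'a list \<Rightarrow> nat multiset" where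
  "wprofile w = profile (wcross w) (set w)"

lemma wprofile_map:
  assumes "inj_on f (set w)"
  shows "wprofile (map f w) = wprofile w"
  unfolding wprofile_def
  by (rule profile_bij[where f=f]) (use assms in \<open>auto simp: wcross_map bij_betw_def\<close>)

section \<open>Normal forms of words under renaming of letters\<close>

definition first_index :: "'a list \<Rightarrow> 'a \<Rightarrow> nat" where
  "first_index w x = length (takeWhile (\<lambda>z. z \<noteq> x) w)"

text \<open>A normal form for renaming: two words differ by an injective renaming exactly when their
  lists of first positions agree. The existential over renamings in \<open>word_iso\<close> thereby
  becomes an equality of lists of numbers.\<close>

definition canon :: "'a list \<Rightarrow> nat list" where
  "canon w = map (first_index w) w"

lemma first_index_nth: "x \<in> set w \<Longrightarrow> w ! first_index w x = x"
  by (induction w) (auto simp: first_index_def)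

lemma inj_first_index: "inj_on (first_index w) (set w)"
  by (rule inj_on_inverseI) (rule first_index_nth)

lemma canon_map:
  assumes "inj_on f (set w)"
  shows "canon (map f w) = canon w"
proof -
  have "first_index (map f w) (f x) = first_index w x" if "x \<in> set w" for x
  proof -
    have "takeWhile ((\<lambda>z. z \<noteq> f x) \<circ> f) w = takeWhile (\<lambda>z. z \<noteq> x) w"
      using assms that by (auto simp: inj_on_eq_iff intro!: takeWhile_cong)
    then show ?thesis by (simp add: first_index_def takeWhile_map)
  qed
  then show ?thesis by (simp add: canon_def)
qed

text \<open>The renaming sends a letter of \<open>v\<close> to the letter of \<open>w\<close> at the
  place where it first occurs in \<open>v\<close>. Equality of the canonical forms makes this
  consistent at every later occurrence, and injective.\<close>

lemma canon_eqE:
  assumes "canon v = canon w"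
  obtains f where "inj_on f (set v)" "w = map f v"
proof
  let ?f = "\<lambda>x. w ! first_index v x"
  have len: "length v = length w" using assms unfolding canon_def by (metis length_map)
  have eq: "first_index v (v ! i) = first_index w (w ! i)" if "i < length v" for i
    using assms that len unfolding canon_def by (metis nth_map)
  have f: "?f (v ! i) = w ! i" if "i < length v" for i
    using eq[OF that] that len by (simp add: first_index_nth)
  show "w = map ?f v"
    by (rule nth_equalityI) (use len f in auto)
  show "inj_on ?f (set v)"
  proof (rule inj_onI)
    fix x y assume "x \<in> set v" "y \<in> set v" "?f x = ?f y"
    then obtain i j where "i < length v" "x = v ! i" "j < length v" "y = v ! j"
      by (auto simp: in_set_conv_nth)
    with \<open>?f x = ?f y\<close> f eq have "first_index v x = first_index v y" by metis
    then show "x = y" using \<open>x \<in> set v\<close> \<open>y \<in> set v\<close> inj_first_index[of v] by (auto dest: inj_onD)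
  qed
qed

definition orbit_canons :: "'a list \<Rightarrow> nat list list" where
  "orbit_canons w = concat (map (\<lambda>n. [canon (rotate n w), canon (rotate n (rev w))]) [0..<length w])"

text \<open>The inverse amount is reduced below the length because \<open>orbit_canons\<close> lists
  only such rotations; for the empty word no amount is below the length.\<close>

lemma rotate_inverse:
  assumes "w = rotate n v"
  obtains m where "m < length w \<or> w = []" "v = rotate m w"
proof (cases "w = []")
  case True
  then show ?thesis using assms that[of 0] by simp
next
  case False
  let ?l = "length w" and ?n = "n mod length w"
  have l: "length v = ?l" using assms by simp
  have lt: "?n < ?l" using False by simp
  have "rotate (?l - ?n) w = rotate (?l - ?n + n) v" using assms by (simp add: rotate_rotate)
  also have "\<dots> = rotate ((?l - ?n + n) mod ?l) v" using l by (metis rotate_conv_mod)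
  also have "(?l - ?n + n) mod ?l = 0"
    using lt by (metis add.commute le_add_diff_inverse less_imp_le_nat mod_add_left_eq mod_self)
  finally have "v = rotate (?l - ?n) w" by simp
  then have "v = rotate ((?l - ?n) mod ?l) w" by (metis rotate_conv_mod)
  then show ?thesis using that[of "(?l - ?n) mod ?l"] False by simp
qed

text \<open>Renaming commutes with rotation and reversal, so it suffices to search the finite orbit
  of \<open>w\<close> under the dihedral group. The empty word has an empty list of rotations and is
  excluded.\<close>

lemma word_iso_iff_canon:
  assumes "w \<noteq> []"
  shows "word_iso v w \<longleftrightarrow> canon v \<in> set (orbit_canons w)"
proof
  assume "word_iso v w"
  then obtain f n where f: "inj_on f (set v)" and w: "w = rotate n (map f v) \<or> w = rotate n (rev (map f v))"
    unfolding word_iso_def by blast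
  from w show "canon v \<in> set (orbit_canons w)"
  proof
    assume "w = rotate n (map f v)"
    then obtain m where "m < length w" "map f v = rotate m w" using rotate_inverse assms by metis
    then have "canon v = canon (rotate m w)" using canon_map[OF f] by metis
    then show ?thesis using \<open>m < length w\<close> by (auto simp: orbit_canons_def)
  next
    assume "w = rotate n (rev (map f v))"
    \<comment> \<open>The reversal of a rotation is the rotation of the reversal by the
      complementary amount, which reduces this case to the previous one for
      \<open>rev w\<close>.\<close>
    then have "rev w = rotate (length w - n mod length w) (map f v)"
      by (metis length_rev length_rotate rev_rev_ident rotate_rev)
    then obtain m where "m < length w" "map f v = rotate m (rev w)"
      using rotate_inverse[of "rev w"] assms by (metis length_rev rev_is_Nil_conv)
    then have "canon v = canon (rotate m (rev w))" using canon_map[OF f] by metis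
    then show ?thesis using \<open>m < length w\<close> by (auto simp: orbit_canons_def)
  qed
next
  assume "canon v \<in> set (orbit_canons w)"
  then obtain n where "n < length w" "canon v = canon (rotate n w) \<or> canon v = canon (rotate n (rev w))"
    by (auto simp: orbit_canons_def)
  then show "word_iso v w"
  proof (elim disjE)
    assume "canon v = canon (rotate n w)"
    then obtain f where f: "inj_on f (set v)" "rotate n w = map f v" by (rule canon_eqE)
    then obtain m where "w = rotate m (map f v)" using rotate_inverse[of "map f v" n w] by metis
    then show ?thesis using f unfolding word_iso_def by blast
  next
    assume "canon v = canon (rotate n (rev w))"
    then obtain f where f: "inj_on f (set v)" "rotate n (rev w) = map f v" by (rule canon_eqE)
    then obtain m where "rev w = rotate m (map f v)" using rotate_inverse[of "map f v" n "rev w"] by metis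
    then have "w = rotate (length w - m mod length w) (rev (map f v))"
      by (metis length_rev length_rotate rev_rev_ident rotate_rev)
    then show ?thesis using f unfolding word_iso_def by blast
  qed
qed

section \<open>Enumeration of Gauss words up to renaming\<close>

fun gauss_words :: "nat \<Rightarrow> nat list list" where
  "gauss_words 0 = [[]]"
| "gauss_words (Suc n) =
     concat (map (\<lambda>u. map (\<lambda>k. n # take k u @ n # drop k u) [0..<Suc (2 * n)]) (gauss_words n))"

lemma in_gauss_words_Suc:
  "u \<in> set (gauss_words (Suc n)) \<longleftrightarrow>
     (\<exists>v\<in>set (gauss_words n). \<exists>k\<le>2 * n. u = n # take k v @ n # drop k v)"
proof -
  have "{0..<Suc (2 * n)} = {..2 * n}" by auto
  then show ?thesis by (auto simp del: upt_Suc)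
qed

lemma set_gauss_words: "u \<in> set (gauss_words n) \<Longrightarrow> set u = {..<n} \<and> length u = 2 * n"
proof (induction n arbitrary: u)
  case (Suc n)
  then obtain v k where v: "v \<in> set (gauss_words n)" "k \<le> 2 * n" "u = n # take k v @ n # drop k v"
    by (auto simp: in_gauss_words_Suc simp del: gauss_words.simps)
  have "set u = insert n (set v)" unfolding v(3) using set_append[of "take k v" "drop k v"] by simp
  then show ?case using Suc.IH[OF v(1)] v by (auto simp: lessThan_Suc)
qed simp

text \<open>Deleting both copies of the first letter leaves a Gauss word with one letter fewer. Read
  backwards, a fresh first letter is added whose second copy may stand at any of
  \<open>2 * n + 1\<close> places, which gives (2n-1)!! words with n letters, 105 for n = 4.\<close>

lemma gauss_word_normal_form:
  assumes "gauss_word w"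
  shows "\<exists>u\<in>set (gauss_words (card (set w))). \<exists>f. inj_on f (set u) \<and> w = map f u"
  using assms
proof (induction "card (set w)" arbitrary: w)
  case 0
  then show ?case by simp
next
  case (Suc n)
  then obtain x v where w: "w = x # v" by (cases w) auto
  have cx: "count_list v x = 1" using Suc.prems by (auto simp: gauss_word_def w)
  then have "x \<in> set v" by (metis count_notin zero_neq_one)
  then obtain v1 v2 where v: "v = v1 @ x # v2" "x \<notin> set v1" by (meson split_list_first)
  have v2: "x \<notin> set v2" using cx v by (auto simp: count_list_0_iff)
  define v' where "v' = v1 @ v2"
  have set': "set w = insert x (set v')" "x \<notin> set v'" using v v2 by (auto simp: w v'_def)
  have g: "gauss_word v'"
    unfolding gauss_word_def
  proof
    fix y assume y: "y \<in> set v'"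
    then have "y \<noteq> x" "y \<in> set w" using set' by auto
    then have "count_list w y = 2" using Suc.prems by (auto simp: gauss_word_def)
    then show "count_list v' y = 2" using \<open>y \<noteq> x\<close> by (simp add: w v v'_def)
  qed
  have n: "n = card (set v')" using Suc.hyps(2) set' by simp
  from Suc.hyps(1)[OF n g] obtain u f where u: "u \<in> set (gauss_words n)" "inj_on f (set u)" "v' = map f u"
    using n by auto
  have su: "set u = {..<n}" "length u = 2 * n" using set_gauss_words[OF u(1)] by auto
  define k where "k = length v1"
  \<comment> \<open>The words in \<open>gauss_words n\<close> use only the letters below
    \<open>n\<close>, so \<open>n\<close> is free to stand for \<open>x\<close>.\<close>
  define f' where "f' = f(n := x)"
  have k: "k \<le> 2 * n" using u(3) su by (simp add: k_def v'_def) (metis le_add1 length_append length_map su(2))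
  have tk: "v1 = map f (take k u)" "v2 = map f (drop k u)"
    using u(3) unfolding v'_def k_def by (metis append_eq_conv_conj drop_map take_map)+
  have ff: "f' y = f y" if "y \<in> set u" for y using that su by (auto simp: f'_def)
  have "w = map f' (n # take k u @ n # drop k u)"
    using ff su(1) by (auto simp: w v tk f'_def dest: in_set_takeD in_set_dropD intro!: map_cong)
  moreover have "n # take k u @ n # drop k u \<in> set (gauss_words (Suc n))"
    using u(1) k by (auto simp: in_gauss_words_Suc simp del: gauss_words.simps)
  moreover have "inj_on f' (set (n # take k u @ n # drop k u))"
  proof -
    have "set (n # take k u @ n # drop k u) = insert n (set u)"
      using set_append[of "take k u" "drop k u"] by simp
    moreover have "inj_on f' (insert n (set u))"
      using u(2,3) set'(2) su by (auto simp: inj_on_def f'_def)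
    ultimately show ?thesis by simp
  qed
  ultimately show ?case using Suc.hyps(2) by metis
qed

lemma word_iso_map:
  assumes "inj_on f (set u)" "y \<noteq> []"
  shows "word_iso (map f u) y = word_iso u y"
  using assms by (simp add: word_iso_iff_canon canon_map)

text \<open>Links the multiset of degrees to the list computation that \<open>profile_test\<close>
  evaluates.\<close>

lemma wprofile_code:
  "wprofile w = mset (let vs = remdups w in map (\<lambda>v. length (filter (wcross w v) vs)) vs)"
proof -
  have "card {u \<in> set w. wcross w v u} = length (filter (wcross w v) (remdups w))" for v
    by (metis distinct_card distinct_filter distinct_remdups set_filter set_remdups)
  moreover have "mset_set (set w) = mset (remdups w)"
    by (metis distinct_remdups mset_set_set set_remdups)
  ultimately show ?thesis by (simp add: wprofile_def profile_def Let_def)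
qed

text \<open>An exhaustive check, over all Gauss words with \<open>n\<close> letters in normal form, that the words
  isomorphic to \<open>y\<close> are exactly those whose intersection graph has degree sequence \<open>ds\<close>.\<close>

definition profile_test :: "nat \<Rightarrow> nat list \<Rightarrow> 'a list \<Rightarrow> bool" where
  "profile_test n ds y \<longleftrightarrow> (let L = orbit_canons y in
     list_all (\<lambda>w. (canon w \<in> set L) =
       (sort (let vs = remdups w in map (\<lambda>v. length (filter (wcross w v) vs)) vs) = ds)) (gauss_words n))"

text \<open>That the degree sequence singles out \<open>y\<close> among words with \<open>n\<close>
  letters is the content of the test; the normal form carries this to words over any alphabet. A
  word with another number of letters fails on both sides, by its length and by the size of its
  degree sequence.\<close>

lemma word_iso_iff_profile:
  assumes "profile_test n ds y" and "sorted ds" "length ds = n" "y \<noteq> []" "length y = 2 * n" and "gauss_word w"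
  shows "word_iso w y \<longleftrightarrow> wprofile w = mset ds"
proof -
  obtain u f where u: "u \<in> set (gauss_words (card (set w)))" "inj_on f (set u)" "w = map f u"
    using gauss_word_normal_form[OF assms(6)] by auto
  have lw: "length w = 2 * card (set w)" using set_gauss_words[OF u(1)] u(3) by simp
  show ?thesis
  proof (cases "card (set w) = n")
    case True
    let ?l = "let vs = remdups u in map (\<lambda>v. length (filter (wcross u v) vs)) vs"
    have "sort ?l = ds \<longleftrightarrow> mset ?l = mset ds"
      using assms(2) by (metis mset_sort properties_for_sort sort_key_id_if_sorted sorted_sort)
    moreover have "canon u \<in> set (orbit_canons y) \<longleftrightarrow> sort ?l = ds"
      using assms(1) u(1) True unfolding profile_test_def by (auto simp: Let_def list_all_iff)
    ultimately have "word_iso u y \<longleftrightarrow> wprofile u = mset ds"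
      using word_iso_iff_canon[OF assms(4), of u] wprofile_code[of u] by simp
    then show ?thesis
      using wprofile_map[OF u(2)] word_iso_map[OF u(2) assms(4)] u(3) by simp
  next
    case False
    have "\<not> word_iso w y"
    proof
      assume "word_iso w y"
      then have "length y = length w" unfolding word_iso_def by auto
      then show False using False lw assms(5) by simp
    qed
    moreover have "wprofile w \<noteq> mset ds"
    proof
      assume "wprofile w = mset ds"
      then have "size (wprofile w) = n" using assms(3) by simp
      then show False using False by (simp add: wprofile_def size_profile)
    qed
    ultimately show ?thesis by simp
  qed
qed

section \<open>Weighted counts of small subgraphs\<close>

definition weight3 :: "nat multiset \<Rightarrow> int" where
  "weight3 M = (if M = {#1, 1#} then 1 else if M = {#2, 2, 2#} then -3
     else if M = {#1, 1, 2#} then 3 else 0)"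

text \<open>The cases are the degree sequences of \<open>y3\<close> to \<open>y9\<close> in this
  order: path on three vertices, 4-cycle, star, triangle with a pendant edge, K4, path on four
  vertices, K4 minus an edge. The values are the coefficients in \<open>lambda4\<close>.\<close>

definition weight4 :: "nat multiset \<Rightarrow> int" where
  "weight4 M = (if M = {#1, 1, 2#} then 2 else if M = {#2, 2, 2, 2#} then 8
     else if M = {#1, 1, 1, 3#} then 5 else if M = {#1, 2, 2, 3#} then 1
     else if M = {#3, 3, 3, 3#} then -4 else if M = {#1, 1, 2, 2#} then 2
     else if M = {#2, 2, 3, 3#} then -2 else 0)"

definition graph_sum :: "(nat multiset \<Rightarrow> int) \<Rightarrow> ('a \<Rightarrow> 'a \<Rightarrow> bool) \<Rightarrow> 'a set \<Rightarrow> int" where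
  "graph_sum W E V = (\<Sum>C\<in>Pow V. W (profile E C))"

lemma graph_sum_bij:
  assumes "bij_betw f V V'" "\<And>x y. x \<in> V \<Longrightarrow> y \<in> V \<Longrightarrow> E' (f x) (f y) = E x y"
  shows "graph_sum W E' V' = graph_sum W E V"
proof -
  have inj: "inj_on f V" and img: "V' = f ` V" using assms(1) by (auto simp: bij_betw_def)
  have "inj_on (image f) (Pow V)" using inj by (rule inj_on_image_Pow)
  moreover have "Pow V' = image f ` Pow V" unfolding img by (rule image_Pow_surj[symmetric]) simp
  moreover have "profile E' (f ` C) = profile E C" if "C \<in> Pow V" for C
    using that assms(2) inj by (intro profile_bij[where f=f]) (auto simp: bij_betw_def intro: inj_on_subset)
  ultimately show ?thesis
    unfolding graph_sum_def by (simp add: sum.reindex)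
qed

lemma weight4_isolated:
  assumes "0 \<in># M"
  shows "weight4 M = 0"
  using assms by (auto simp: weight4_def)

lemma graph_sum_insert_isolated:
  assumes "finite V" "c \<notin> V" "\<And>x. x \<in> insert c V \<Longrightarrow> \<not> E c x"
  shows "graph_sum weight4 E (insert c V) = graph_sum weight4 E V"
proof -
  have "weight4 (profile E C) = 0" if "C \<in> insert c ` Pow V" for C
  proof (rule weight4_isolated)
    have C: "finite C" "c \<in> C" using that assms(1) by (auto intro: finite_subset)
    have "{u\<in>C. E c u} = {}" using assms(3) that by auto
    then show "0 \<in># profile E C" using C by (auto simp: profile_def image_iff intro!: bexI[of _ c])
  qed
  then have "(\<Sum>C\<in>insert c ` Pow V. weight4 (profile E C)) = 0" by simp
  moreover have "Pow V \<inter> insert c ` Pow V = {}" using assms(2) by auto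
  ultimately show ?thesis
    unfolding graph_sum_def Pow_insert using assms(1) by (simp add: sum.union_disjoint)
qed

section \<open>Effect of the triangle move on weighted counts\<close>

lemma card_filter_insert:
  assumes "finite V" "x \<notin> V"
  shows "card {u\<in>insert x V. P u} = of_bool (P x) + card {u\<in>V. P u}"
proof -
  have "{u\<in>insert x V. P u} = (if P x then insert x {u\<in>V. P u} else {u\<in>V. P u})" by auto
  then show ?thesis using assms by auto
qed

lemma profile3:
  assumes "distinct [a, b, c]" and irr: "\<And>x. \<not> E x x" and sym: "\<And>x y. E x y = E y x"
  shows "profile E {a, b, c} = {# of_bool (E a b) + of_bool (E a c),
     of_bool (E a b) + of_bool (E b c), of_bool (E a c) + of_bool (E b c) #}"
  using assms(1) irr sym[of b a] sym[of c a] sym[of c b]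
  by (simp add: profile_def card_filter_insert del: insert_iff)

lemma profile4:
  assumes "distinct [a, b, c, d]" and irr: "\<And>x. \<not> E x x" and sym: "\<And>x y. E x y = E y x"
  shows "profile E {a, b, c, d} = {#
     of_bool (E a b) + of_bool (E a c) + of_bool (E a d),
     of_bool (E a b) + of_bool (E b c) + of_bool (E b d),
     of_bool (E a c) + of_bool (E b c) + of_bool (E c d),
     of_bool (E a d) + of_bool (E b d) + of_bool (E c d) #}"
  using assms(1) irr sym[of b a] sym[of c a] sym[of c b] sym[of d a] sym[of d b] sym[of d c]
  by (simp add: profile_def card_filter_insert add_ac del: insert_iff)

lemma weight4_card: "weight4 M \<noteq> 0 \<Longrightarrow> size M = 3 \<or> size M = 4"
  by (auto simp: weight4_def split: if_splits)

lemma sum_Pow_Un: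
  assumes "A \<inter> B = {}"
  shows "sum f (Pow (A \<union> B)) = (\<Sum>S\<in>Pow A. \<Sum>T\<in>Pow B. f (S \<union> T))"
proof -
  have "sum f (Pow (A \<union> B)) = (\<Sum>(S, T)\<in>Pow A \<times> Pow B. f (S \<union> T))"
  proof (rule sum.reindex_bij_witness[where i="\<lambda>(S, T). S \<union> T" and j="\<lambda>C. (C \<inter> A, C \<inter> B)"], goal_cases)
    case (1 C) then show ?case by auto
  next
    case (2 C) then show ?case by auto
  next
    case (3 p) then show ?case using assms by auto
  next
    case (4 p) then show ?case by auto
  next
    case (5 C)
    then have "C \<inter> A \<union> C \<inter> B = C" by auto
    then show ?case by simp
  qed
  then show ?thesis by (simp add: sum.cartesian_product)
qed

lemma sum_Pow3:
  assumes "distinct [a, b, c]"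
  shows "(\<Sum>T\<in>Pow {a, b, c}. f T) =
    f {} + f {a} + f {b} + f {c} + f {a, b} + f {a, c} + f {b, c} + (f {a, b, c} :: int)"
proof -
  have "Pow {a, b, c} = {{}, {a}, {b}, {c}, {a, b}, {a, c}, {b, c}, {a, b, c}}"
    by (auto simp: Pow_insert)
  then show ?thesis using assms by (auto simp: doubleton_eq_iff insert_eq_iff)
qed

text \<open>An even number of the three holds. The condition arises from an outside chord and the
  three chords of a triangle: each of the latter joins two of three arcs, and the outside chord
  crosses it when it has these two arcs on different sides.\<close>

definition two_or_none :: "bool \<Rightarrow> bool \<Rightarrow> bool \<Rightarrow> bool" where
  "two_or_none p q r \<longleftrightarrow> (\<not> p \<and> \<not> q \<and> \<not> r) \<or> (p \<and> q \<and> \<not> r) \<or> (p \<and> \<not> q \<and> r) \<or> (\<not> p \<and> q \<and> r)"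

lemma eq_mset_iff_sorted: "sorted l \<Longrightarrow> M = mset l \<longleftrightarrow> sorted_list_of_multiset M = l"
  by (metis mset_sorted_list_of_multiset sorted_list_of_multiset_mset sorted_sort_id)

text \<open>Comparing sorted lists lets the finite case checks below run by evaluation on concrete
  numbers.\<close>

lemma weight4_sorted:
  "weight4 M = (let l = sorted_list_of_multiset M in
     if l = [1, 1, 2] then 2 else if l = [2, 2, 2, 2] then 8 else if l = [1, 1, 1, 3] then 5
     else if l = [1, 2, 2, 3] then 1 else if l = [3, 3, 3, 3] then -4
     else if l = [1, 1, 2, 2] then 2 else if l = [2, 2, 3, 3] then -2 else 0)"
  using eq_mset_iff_sorted[of "[1, 1, 2]" M] eq_mset_iff_sorted[of "[2, 2, 2, 2]" M]
    eq_mset_iff_sorted[of "[1, 1, 1, 3]" M] eq_mset_iff_sorted[of "[1, 2, 2, 3]" M]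
    eq_mset_iff_sorted[of "[3, 3, 3, 3]" M] eq_mset_iff_sorted[of "[1, 1, 2, 2]" M]
    eq_mset_iff_sorted[of "[2, 2, 3, 3]" M]
  by (simp add: weight4_def Let_def)

text \<open>The sets consist of one outside vertex d and at least two vertices of the triangle,
  after the move on the left and before it on the right; \<open>p\<close>, \<open>q\<close>,
  \<open>r\<close> are the adjacencies of d. If two of them hold, two paths and a K4 minus an edge
  give 2 + 2 - 2 on the left, and one path gives 2 on the right. If none holds, every set has an
  isolated vertex.\<close>

lemma triple_weights:
  assumes "two_or_none p q r"
  shows "weight4 {#of_bool p + of_bool q, of_bool p + 1, of_bool q + 1#}
     + weight4 {#of_bool p + of_bool r, of_bool p + 1, of_bool r + 1#}
     + weight4 {#of_bool q + of_bool r, of_bool q + 1, of_bool r + 1#}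
     + weight4 {#of_bool p + of_bool q + of_bool r, of_bool p + 1 + 1, of_bool q + 1 + 1, of_bool r + 1 + 1#}
   = weight4 {#of_bool p + of_bool q, of_bool p, of_bool q#}
     + weight4 {#of_bool p + of_bool r, of_bool p, of_bool r#}
     + weight4 {#of_bool q + of_bool r, of_bool q, of_bool r#}
     + weight4 {#of_bool p + of_bool q + of_bool r, of_bool p, of_bool q, of_bool r#}"
  using assms unfolding two_or_none_def
  by (elim disjE conjE) (simp_all add: weight4_sorted Let_def numeral_eq_Suc)

text \<open>Here \<open>e\<close> tells whether the two outside vertices are adjacent, and every set
  contains two vertices of the triangle. The cases with nonzero weights are, with the side after the
  move first: both outside vertices adjacent to the same pair, -2 + 5 + 5 = 8 without
  \<open>e\<close> and -4 + 1 + 1 = -2 with it; adjacent to different pairs, 1 + 1 + 2 = 2 + 2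
  without \<open>e\<close> and -2 - 2 + 8 = 1 + 1 + 2 with it; only one of them adjacent to a pair,
  1 + 2 + 2 = 5 with \<open>e\<close>. These are the linear equations behind the
  coefficients.\<close>

lemma pair_weights:
  assumes "two_or_none p q r" "two_or_none p' q' r'"
  shows "weight4 {#of_bool e + of_bool p + of_bool q, of_bool e + of_bool p' + of_bool q',
         of_bool p + of_bool p' + 1, of_bool q + of_bool q' + 1#}
     + weight4 {#of_bool e + of_bool p + of_bool r, of_bool e + of_bool p' + of_bool r',
         of_bool p + of_bool p' + 1, of_bool r + of_bool r' + 1#}
     + weight4 {#of_bool e + of_bool q + of_bool r, of_bool e + of_bool q' + of_bool r',
         of_bool q + of_bool q' + 1, of_bool r + of_bool r' + 1#}
   = weight4 {#of_bool e + of_bool p + of_bool q, of_bool e + of_bool p' + of_bool q',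
         of_bool p + of_bool p', of_bool q + of_bool q'#}
     + weight4 {#of_bool e + of_bool p + of_bool r, of_bool e + of_bool p' + of_bool r',
         of_bool p + of_bool p', of_bool r + of_bool r'#}
     + weight4 {#of_bool e + of_bool q + of_bool r, of_bool e + of_bool q' + of_bool r',
         of_bool q + of_bool q', of_bool r + of_bool r'#}"
  using assms unfolding two_or_none_def
  by (cases e; elim disjE conjE) (simp_all add: weight4_sorted Let_def numeral_eq_Suc)


text \<open>The sums agree already for each fixed set S of outside vertices, summed over the subsets
  T of the triangle. If T has at most one element, the induced subgraph does not change. If S has
  more than two elements and T at least two, the set is too large to carry weight. Sets S with one
  or two elements are covered by the two identities above.\<close>

lemma graph_sum_strong_RIII:
  assumes fin: "finite V" and dist: "distinct [a, b, c]" "a \<notin> V" "b \<notin> V" "c \<notin> V"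
    and sym: "\<And>x y. E x y = E y x" "\<And>x y. E' x y = E' y x"
    and irr: "\<And>x. \<not> E x x" "\<And>x. \<not> E' x x"
    and tri: "\<not> E a b" "\<not> E a c" "\<not> E b c" "E' a b" "E' a c" "E' b c"
    and two: "\<And>d. d \<in> V \<Longrightarrow> two_or_none (E a d) (E b d) (E c d)"
    and same: "\<And>d x. d \<in> V \<Longrightarrow> x \<in> V \<union> {a, b, c} \<Longrightarrow> E' x d = E x d"
  shows "graph_sum weight4 E' (V \<union> {a, b, c}) = graph_sum weight4 E (V \<union> {a, b, c})"
proof -
  have disj: "V \<inter> {a, b, c} = {}" using dist by auto
  have split: "graph_sum weight4 F (V \<union> {a, b, c}) =
     (\<Sum>S\<in>Pow V. \<Sum>T\<in>Pow {a, b, c}. weight4 (profile F (S \<union> T)))" for F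
    unfolding graph_sum_def by (rule sum_Pow_Un[OF disj, of "\<lambda>C. weight4 (profile F C)"])
  have "(\<Sum>T\<in>Pow {a, b, c}. weight4 (profile E' (S \<union> T))) =
        (\<Sum>T\<in>Pow {a, b, c}. weight4 (profile E (S \<union> T)))" if S: "S \<in> Pow V" for S
  proof -
    have fS: "finite S" using finite_subset[OF _ fin] S by blast
    have dS: "a \<notin> S" "b \<notin> S" "c \<notin> S" using S dist by auto
    have eqS: "profile E' (S \<union> T) = profile E (S \<union> T)" if T: "T \<in> {{}, {a}, {b}, {c}}" for T
    proof (rule profile_cong)
      fix x y assume xy: "x \<in> S \<union> T" "y \<in> S \<union> T"
      have T': "x = y" if "x \<notin> S" "y \<notin> S" using T xy that by auto
      have V: "x \<in> V \<union> {a, b, c}" "y \<in> V \<union> {a, b, c}" using T xy S by auto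
      show "E' x y = E x y"
      proof (cases "y \<in> S")
        case True
        then show ?thesis using same[of y x] V S by blast
      next
        case y: False
        show ?thesis
        proof (cases "x \<in> S")
          case True
          then have "E' y x = E y x" using same[of x y] V S by blast
          then show ?thesis by (subst sym(1), subst sym(2))
        next
          case False
          then show ?thesis using T' y irr by simp
        qed
      qed
    qed
    have eq0: "profile E' (S \<union> {}) = profile E (S \<union> {})"
      "profile E' (S \<union> {a}) = profile E (S \<union> {a})" "profile E' (S \<union> {b}) = profile E (S \<union> {b})"
      "profile E' (S \<union> {c}) = profile E (S \<union> {c})"
      by (rule eqS, simp)+
    consider "card S > 2" | "S = {}" | d where "S = {d}" | d e where "S = {d, e}" "d \<noteq> e"
    proof -
      consider "card S > 2" | "card S = 0" | "card S = 1" | "card S = 2" by linarith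
      then show ?thesis
      proof cases
        case 1 then show ?thesis by (rule that(1))
      next
        case 2 then show ?thesis using fS that(2) by simp
      next
        case 3 then show ?thesis using that(3) by (metis card_1_singletonE)
      next
        case 4 then show ?thesis using that(4) by (metis card_2_iff)
      qed
    qed
    then show ?thesis
    proof cases
      case 1
      have big: "weight4 (profile F (S \<union> T)) = 0" if "T \<in> {{a, b}, {a, c}, {b, c}, {a, b, c}}" for F T
      proof (rule ccontr)
        assume "weight4 (profile F (S \<union> T)) \<noteq> 0"
        then have "card (S \<union> T) = 3 \<or> card (S \<union> T) = 4" using weight4_card by (metis size_profile)
        moreover have "card (S \<union> T) = card S + card T"
          using fS dS that by (intro card_Un_disjoint) auto
        moreover have "card T \<ge> 2" using that dist by auto
        ultimately show False using 1 by linarith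
      qed
      show ?thesis unfolding sum_Pow3[OF dist(1)] 
        using eqS[of "{}"] eqS[of "{a}"] eqS[of "{b}"] eqS[of "{c}"]
          big[of "{a, b}"] big[of "{a, c}"] big[of "{b, c}"] big[of "{a, b, c}"] by simp
    next
      case 2
      have small: "weight4 (profile F T) = 0" if "T \<in> {{a, b}, {a, c}, {b, c}}" for F T
      proof (rule ccontr)
        assume "weight4 (profile F T) \<noteq> 0"
        then have "card T = 3 \<or> card T = 4" using weight4_card by (metis size_profile)
        then show False using that dist by auto
      qed
      \<comment> \<open>Without an outside vertex three isolated vertices turn into a triangle, and
        \<open>weight4\<close> vanishes on both.\<close>
      have "profile E {a, b, c} = {#0, 0, 0#}" "profile E' {a, b, c} = {#2, 2, 2#}"
        using profile3[OF dist(1) irr(1) sym(1)] profile3[OF dist(1) irr(2) sym(2)] tri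
        by (simp_all add: numeral_eq_Suc)
      then have "weight4 (profile E {a, b, c}) = 0" "weight4 (profile E' {a, b, c}) = 0"
        by (simp_all add: weight4_sorted)
      then show ?thesis
        unfolding sum_Pow3[OF dist(1)] 2
        using eqS[of "{}"] eqS[of "{a}"] eqS[of "{b}"] eqS[of "{c}"] 2
          small[of "{a, b}"] small[of "{a, c}"] small[of "{b, c}"] by simp
    next
      case (3 d)
      then have d: "d \<in> V" "distinct [d, a, b, c]" using S dS dist by auto
      have sm: "E' d x = E d x" if "x \<in> V \<union> {a, b, c}" for x
        using same[OF d(1) that] sym(1)[of d x] sym(2)[of d x] by simp
      then have sm: "E' d a = E d a" "E' d b = E d b" "E' d c = E d c" by auto
      have P3: "profile F (S \<union> {x, y}) = {# of_bool (F d x) + of_bool (F d y),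
         of_bool (F d x) + of_bool (F x y), of_bool (F d y) + of_bool (F x y) #}"
        if "distinct [d, x, y]" "F = E \<or> F = E'" for F x y
      proof -
        have "S \<union> {x, y} = {d, x, y}" using 3 by auto
        then show ?thesis using profile3[OF that(1) irr(1) sym(1)] profile3[OF that(1) irr(2) sym(2)] that(2) by auto
      qed
      have P4: "profile F (S \<union> {a, b, c}) = {#
         of_bool (F d a) + of_bool (F d b) + of_bool (F d c),
         of_bool (F d a) + of_bool (F a b) + of_bool (F a c),
         of_bool (F d b) + of_bool (F a b) + of_bool (F b c),
         of_bool (F d c) + of_bool (F a c) + of_bool (F b c) #}" if "F = E \<or> F = E'" for F
      proof -
        have "S \<union> {a, b, c} = {d, a, b, c}" using 3 by auto
        then show ?thesis using profile4[OF d(2) irr(1) sym(1)] profile4[OF d(2) irr(2) sym(2)] that by auto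
      qed
      have "two_or_none (E d a) (E d b) (E d c)"
        using two[OF d(1)] sym[of d a] sym[of d b] sym[of d c] by simp
      note weights = triple_weights[OF this]
      have P: "profile F (S \<union> {a, b}) = {# of_bool (F d a) + of_bool (F d b),
         of_bool (F d a) + of_bool (F a b), of_bool (F d b) + of_bool (F a b) #}"
        "profile F (S \<union> {a, c}) = {# of_bool (F d a) + of_bool (F d c),
         of_bool (F d a) + of_bool (F a c), of_bool (F d c) + of_bool (F a c) #}"
        "profile F (S \<union> {b, c}) = {# of_bool (F d b) + of_bool (F d c),
         of_bool (F d b) + of_bool (F b c), of_bool (F d c) + of_bool (F b c) #}"
        if "F = E \<or> F = E'" for F
        by (rule P3, use d(2) in simp, rule that)+
      show ?thesis
        unfolding sum_Pow3[OF dist(1)] eq0 P[of E, OF disjI1, OF refl] P[of E', OF disjI2, OF refl]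
          P4[of E, OF disjI1, OF refl] P4[of E', OF disjI2, OF refl]
        using weights by (simp only: sm tri of_bool_eq add_0_right)
    next
      case (4 d e)
      then have d: "d \<in> V" "e \<in> V" "distinct [d, e, a, b, c]" using S dS dist by auto
      have sm: "E' y x = E y x" if "y \<in> V" "x \<in> V \<union> {a, b, c}" for x y
        using same[OF that] sym(1)[of y x] sym(2)[of y x] by simp
      then have sm: "E' d a = E d a" "E' d b = E d b" "E' d c = E d c"
        "E' e a = E e a" "E' e b = E e b" "E' e c = E e c" "E' d e = E d e" using d by auto
      have P4: "profile F (S \<union> {x, y}) = {#
         of_bool (F d e) + of_bool (F d x) + of_bool (F d y),
         of_bool (F d e) + of_bool (F e x) + of_bool (F e y),
         of_bool (F d x) + of_bool (F e x) + of_bool (F x y),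
         of_bool (F d y) + of_bool (F e y) + of_bool (F x y) #}"
        if "distinct [d, e, x, y]" "F = E \<or> F = E'" for F x y
      proof -
        have "S \<union> {x, y} = {d, e, x, y}" using 4 by auto
        then show ?thesis using profile4[OF that(1) irr(1) sym(1)] profile4[OF that(1) irr(2) sym(2)] that(2) by auto
      qed
      have P5: "weight4 (profile F (S \<union> {a, b, c})) = 0" for F
      proof (rule ccontr)
        assume "weight4 (profile F (S \<union> {a, b, c})) \<noteq> 0"
        then have "card (S \<union> {a, b, c}) = 3 \<or> card (S \<union> {a, b, c}) = 4"
          using weight4_card by (metis size_profile)
        moreover have "S \<union> {a, b, c} = {d, e, a, b, c}" using 4 by auto
        ultimately show False using d by auto
      qed
      have "two_or_none (E d a) (E d b) (E d c)" "two_or_none (E e a) (E e b) (E e c)"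
        using two[OF d(1)] two[OF d(2)] sym[of d a] sym[of d b] sym[of d c] sym[of e a] sym[of e b] sym[of e c]
        by simp_all
      note weights = pair_weights[OF this, of "E d e"]
      have P: "profile F (S \<union> {x, y}) = {#
         of_bool (F d e) + of_bool (F d x) + of_bool (F d y),
         of_bool (F d e) + of_bool (F e x) + of_bool (F e y),
         of_bool (F d x) + of_bool (F e x) + of_bool (F x y),
         of_bool (F d y) + of_bool (F e y) + of_bool (F x y) #}"
        if "F = E \<or> F = E'" "(x, y) = (a, b) \<or> (x, y) = (a, c) \<or> (x, y) = (b, c)" for F x y
        using d(3) that(2) by (intro P4 that(1)) auto
      note Pab = P[of _ a b, OF _ disjI1, OF _ refl]
      note Pac = P[of _ a c, OF _ disjI2, OF _ disjI1, OF _ refl]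
      note Pbc = P[of _ b c, OF _ disjI2, OF _ disjI2, OF _ refl]
      show ?thesis
        unfolding sum_Pow3[OF dist(1)] eq0 P5 Pab[of E, OF disjI1, OF refl] Pab[of E', OF disjI2, OF refl]
          Pac[of E, OF disjI1, OF refl] Pac[of E', OF disjI2, OF refl]
          Pbc[of E, OF disjI1, OF refl] Pbc[of E', OF disjI2, OF refl]
        using weights by (simp only: sm tri of_bool_eq add_0_right)
    qed
  qed
  note step = this
  show ?thesis unfolding split by (intro sum.cong refl step)
qed

section \<open>Chord sets\<close>

definition crosses :: "'a::linorder set \<Rightarrow> 'a set \<Rightarrow> bool" where
  "crosses c d \<longleftrightarrow> (\<exists>s\<in>c. \<exists>t\<in>c. \<exists>u\<in>d. \<exists>v\<in>d. s < u \<and> u < t \<and> t < v \<or> u < s \<and> s < v \<and> v < t)"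

lemma crosses_sym: "crosses c d = crosses d c"
  unfolding crosses_def by blast

lemma crosses_doubleton:
  "s < t \<Longrightarrow> u < v \<Longrightarrow> crosses {s, t} {u, v} \<longleftrightarrow> s < u \<and> u < t \<and> t < v \<or> u < s \<and> s < v \<and> v < t"
  unfolding crosses_def by auto

lemma crosses_irrefl: "card c = 2 \<Longrightarrow> \<not> crosses c c"
  by (auto simp: crosses_def card_2_iff)

lemma crosses_iff_separates:
  assumes "s < t" "u < v" "{s, t} \<inter> {u, v} = {}"
  shows "crosses {s, t} {u, v} \<longleftrightarrow> (s < u \<and> u < t) \<noteq> (s < v \<and> v < t)"
  using assms by (auto simp: crosses_doubleton)

lemma filter_sorted_list_of_set:
  "finite A \<Longrightarrow> filter P (sorted_list_of_set A) = sorted_list_of_set {x\<in>A. P x}"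
  by (rule sorted_distinct_set_unique) (auto simp: sorted_filter sorted_wrt_filter)

definition chord_set :: "real set set \<Rightarrow> bool" where
  "chord_set C \<longleftrightarrow> finite C \<and> (\<forall>c\<in>C. card c = 2) \<and> disjoint C"

lemma chord_set_subset: "chord_set C \<Longrightarrow> D \<subseteq> C \<Longrightarrow> chord_set D"
  unfolding chord_set_def by (auto intro: finite_subset pairwise_subset)

lemma chord_the:
  assumes "chord_set C" "c \<in> C" "t \<in> c"
  shows "(THE c. c \<in> C \<and> t \<in> c) = c"
  using assms by (intro the_equality) (auto simp: chord_set_def disjoint_def)

lemma chord_doubleton:
  assumes "chord_set C" "c \<in> C"
  obtains s t where "s < t" "c = {s, t}"
proof -
  have "card c = 2" using assms by (simp add: chord_set_def)
  then obtain s t where "c = {s, t}" "s \<noteq> t" by (auto simp: card_2_iff)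
  then show ?thesis using that[of s t] that[of t s] by (cases "s < t") (auto simp: insert_commute)
qed

lemma finite_Union_chords:
  assumes "chord_set C"
  shows "finite (\<Union>C)"
proof -
  have "finite c" if "c \<in> C" for c
    using assms that by (metis card.infinite chord_set_def zero_neq_numeral)
  then show ?thesis using assms by (auto simp: chord_set_def)
qed

text \<open>The letters are the chords themselves, so restriction to \<open>D\<close> involves no
  renaming: both sides read the endpoints of \<open>D\<close> in increasing order. Statements about
  one or two letters of a chord word thus reduce to words of one or two chords.\<close>

lemma filter_chord_word:
  assumes C: "chord_set C" and D: "D \<subseteq> C"
  shows "filter (\<lambda>z. z \<in> D) (chord_word C) = chord_word D"
proof -
  let ?f = "\<lambda>C t. THE c. c \<in> C \<and> t \<in> c"
  have f: "?f C t \<in> D \<longleftrightarrow> t \<in> \<Union>D" if t: "t \<in> \<Union>C" for t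
  proof
    obtain c where c: "c \<in> C" "t \<in> c" using t by auto
    then have fc: "?f C t = c" using chord_the C by auto
    { assume "?f C t \<in> D" then show "t \<in> \<Union>D" using c fc by auto }
    { assume "t \<in> \<Union>D"
      then obtain d where "d \<in> D" "t \<in> d" by auto
      then show "?f C t \<in> D" using chord_the[OF C, of d t] D by auto }
  qed
  have "filter (\<lambda>z. z \<in> D) (chord_word C) = map (?f C) (filter (\<lambda>t. ?f C t \<in> D) (sorted_list_of_set (\<Union>C)))"
    by (simp add: chord_word_def filter_map comp_def)
  also have "filter (\<lambda>t. ?f C t \<in> D) (sorted_list_of_set (\<Union>C)) = filter (\<lambda>t. t \<in> \<Union>D) (sorted_list_of_set (\<Union>C))"
    using f finite_Union_chords[OF C] by (intro filter_cong) auto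
  also have "\<dots> = sorted_list_of_set {t\<in>\<Union>C. t \<in> \<Union>D}"
    using finite_Union_chords[OF C] by (rule filter_sorted_list_of_set)
  also have "{t\<in>\<Union>C. t \<in> \<Union>D} = \<Union>D" using D by auto
  also have "map (?f C) (sorted_list_of_set (\<Union>D)) = map (?f D) (sorted_list_of_set (\<Union>D))"
  proof (rule map_cong[OF refl])
    fix t assume "t \<in> set (sorted_list_of_set (\<Union>D))"
    then obtain d where "d \<in> D" "t \<in> d"
      using finite_Union_chords[OF chord_set_subset[OF C D]] by auto
    then show "?f C t = ?f D t"
      using chord_the[OF C, of d t] chord_the[OF chord_set_subset[OF C D], of d t] D by auto
  qed
  finally show ?thesis by (simp add: chord_word_def)
qed

lemma chord_word_singleton:
  assumes "s < t"
  shows "chord_word {{s, t}} = [{s, t}, {s, t}]"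
proof -
  have "chord_set {{s, t}}" using assms by (simp add: chord_set_def)
  then have "(THE c. c \<in> {{s, t}} \<and> x \<in> c) = {s, t}" if "x \<in> {s, t}" for x
    using that by (intro chord_the) auto
  then have the: "(THE c. c \<in> {{s, t}} \<and> s \<in> c) = {s, t}" "(THE c. c \<in> {{s, t}} \<and> t \<in> c) = {s, t}"
    by blast+
  have "sorted_list_of_set (set [s, t]) = [s, t]"
    by (rule sorted_list_of_set.idem_if_sorted_distinct) (use assms in auto)
  then have "sorted_list_of_set (\<Union>{{s, t}}) = [s, t]" by simp
  then show ?thesis unfolding chord_word_def by (simp only: list.map the)
qed

text \<open>Four distinct endpoints with s < t and u < v have six possible orders; the word
  alternates in exactly the two interleaved ones.\<close>

lemma chord_word_pair:
  assumes C: "chord_set {c, d}" "c \<noteq> d"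
  shows "chord_word {c, d} \<in> {[c, d, c, d], [d, c, d, c]} \<longleftrightarrow> crosses c d"
proof -
  obtain s t where c: "s < t" "c = {s, t}" using chord_doubleton[OF C(1), of c] by auto
  obtain u v where d: "u < v" "d = {u, v}" using chord_doubleton[OF C(1), of d] by auto
  have disj: "{s, t} \<inter> {u, v} = {}" using C c d by (auto simp: chord_set_def disjoint_def)
  have w: "chord_word {c, d} = map (\<lambda>x. if x \<in> c then c else d) l"
    if "sorted l" "distinct l" "set l = {s, t, u, v}" for l
  proof -
    have "\<Union>{c, d} = set l" using that(3) c(2) d(2) by auto
    then have "sorted_list_of_set (\<Union>{c, d}) = l"
      using that(1,2) by (simp only: sorted_list_of_set.idem_if_sorted_distinct)
    moreover have "(THE e. e \<in> {c, d} \<and> x \<in> e) = (if x \<in> c then c else d)" if x: "x \<in> set l" for x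
    proof (cases "x \<in> c")
      case True
      then show ?thesis using chord_the[OF C(1), of c x] by simp
    next
      case False
      then have "x \<in> d" using x \<open>set l = {s, t, u, v}\<close> c(2) d(2) by auto
      then show ?thesis using chord_the[OF C(1), of d x] False by simp
    qed
    ultimately show ?thesis unfolding chord_word_def by (auto simp only: map_eq_conv)
  qed
  have neq: "s \<noteq> u" "s \<noteq> v" "t \<noteq> u" "t \<noteq> v" using disj by auto
  have mem: "s \<in> c" "t \<in> c" "u \<notin> c" "v \<notin> c" using c d neq by auto
  have cr: "crosses c d \<longleftrightarrow> s < u \<and> u < t \<and> t < v \<or> u < s \<and> s < v \<and> v < t"
    unfolding c(2) d(2) using c(1) d(1) by (rule crosses_doubleton)
  from neq consider "t < u" | "s < u" "u < t" "t < v" | "s < u" "v < t" | "v < s"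
    | "u < s" "s < v" "v < t" | "u < s" "t < v"
    by linarith
  then show ?thesis
  proof cases
    case 1
    then have "chord_word {c, d} = map (\<lambda>x. if x \<in> c then c else d) [s, t, u, v]"
      using c(1) d(1) by (intro w) auto
    then show ?thesis using 1 c(1) d(1) C(2) by (simp add: mem cr)
  next
    case 2
    then have "chord_word {c, d} = map (\<lambda>x. if x \<in> c then c else d) [s, u, t, v]"
      using c(1) d(1) by (intro w) auto
    then show ?thesis using 2 c(1) d(1) C(2) by (simp add: mem cr)
  next
    case 3
    then have "chord_word {c, d} = map (\<lambda>x. if x \<in> c then c else d) [s, u, v, t]"
      using c(1) d(1) by (intro w) auto
    then show ?thesis using 3 c(1) d(1) C(2) by (simp add: mem cr)
  next
    case 4
    then have "chord_word {c, d} = map (\<lambda>x. if x \<in> c then c else d) [u, v, s, t]"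
      using c(1) d(1) by (intro w) auto
    then show ?thesis using 4 c(1) d(1) C(2) by (simp add: mem cr)
  next
    case 5
    then have "chord_word {c, d} = map (\<lambda>x. if x \<in> c then c else d) [u, s, v, t]"
      using c(1) d(1) by (intro w) auto
    then show ?thesis using 5 c(1) d(1) C(2) by (simp add: mem cr)
  next
    case 6
    then have "chord_word {c, d} = map (\<lambda>x. if x \<in> c then c else d) [u, s, t, v]"
      using c(1) d(1) by (intro w) auto
    then show ?thesis using 6 c(1) d(1) C(2) by (simp add: mem cr)
  qed
qed

lemma set_chord_word:
  assumes "chord_set C"
  shows "set (chord_word C) = C"
proof -
  have "set (chord_word C) = (\<lambda>t. THE c. c \<in> C \<and> t \<in> c) ` \<Union>C"
    using finite_Union_chords[OF assms] by (simp add: chord_word_def)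
  also have "\<dots> = C"
  proof (intro equalityI subsetI)
    fix c assume c: "c \<in> C"
    then obtain s t where st: "c = {s, t}" "s < t" using chord_doubleton[OF assms c] by metis
    show "c \<in> (\<lambda>t. THE c. c \<in> C \<and> t \<in> c) ` \<Union>C"
      using chord_the[OF assms c, of s] c st by (intro image_eqI[of _ _ s]) auto
  next
    fix c assume "c \<in> (\<lambda>t. THE c. c \<in> C \<and> t \<in> c) ` \<Union>C"
    then show "c \<in> C" using chord_the[OF assms] by auto
  qed
  finally show ?thesis .
qed

lemma gauss_word_chord_word:
  assumes "chord_set C"
  shows "gauss_word (chord_word C)"
  unfolding gauss_word_def
proof
  fix c assume "c \<in> set (chord_word C)"
  then have c: "c \<in> C" using set_chord_word[OF assms] by simp
  then obtain s t where st: "s < t" "c = {s, t}" using chord_doubleton[OF assms c] by metis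
  have "filter (\<lambda>z. z = c) (chord_word C) = [c, c]"
    using filter_chord_word[OF assms, of "{c}"] c chord_word_singleton[OF st(1)] st(2) by simp
  moreover have "count_list w x = length (filter (\<lambda>z. z = x) w)" for w and x :: "real set"
    by (induction w) auto
  ultimately show "count_list (chord_word C) c = 2" by simp
qed

lemma wcross_chord_word:
  assumes "chord_set C" "c \<in> C" "d \<in> C"
  shows "wcross (chord_word C) c d = crosses c d"
proof -
  have eq: "filter (\<lambda>z. z = c \<or> z = d) (chord_word C) = chord_word {c, d}"
    using filter_chord_word[OF assms(1), of "{c, d}"] assms by simp
  show ?thesis
  proof (cases "c = d")
    case True
    obtain s t where "s < t" "c = {s, t}" using chord_doubleton[OF assms(1,2)] by metis
    then have "chord_word {c, d} = [c, c]" using True chord_word_singleton by simp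
    moreover have "\<not> crosses c c" using assms by (intro crosses_irrefl) (auto simp: chord_set_def)
    ultimately show ?thesis using eq True by (simp add: wcross_def)
  next
    case False
    then show ?thesis
      using eq chord_word_pair[OF chord_set_subset[OF assms(1)] False] assms by (simp add: wcross_def)
  qed
qed

lemma wprofile_chord_word:
  assumes "chord_set C"
  shows "wprofile (chord_word C) = profile crosses C"
  unfolding wprofile_def set_chord_word[OF assms]
  by (rule profile_cong) (use assms in \<open>simp add: wcross_chord_word\<close>)

section \<open>The invariants as weighted counts of induced subgraphs\<close>

lemma subdiagram_count_profile:
  assumes g: "chord_set (chord_diagram g)"
    and "profile_test n ds y" "sorted ds" "length ds = n" "y \<noteq> []" "length y = 2 * n"
  shows "subdiagram_count y g = (\<Sum>C\<in>Pow (chord_diagram g). of_bool (profile crosses C = mset ds))"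
proof -
  let ?V = "chord_diagram g"
  have "word_iso (chord_word C) y \<longleftrightarrow> profile crosses C = mset ds" if "C \<subseteq> ?V" for C
    using word_iso_iff_profile[OF assms(2-6), of "chord_word C"] chord_set_subset[OF g that]
      gauss_word_chord_word wprofile_chord_word by metis
  then have "{C. C \<subseteq> ?V \<and> word_iso (chord_word C) y} = {C\<in>Pow ?V. profile crosses C = mset ds}"
    by auto
  moreover have "finite (Pow ?V)" using g by (simp add: chord_set_def)
  ultimately show ?thesis
    by (simp add: subdiagram_count_def Int_def)
qed

lemma weight3_sum:
  "weight3 M = of_bool (M = {#1, 1#}) - 3 * of_bool (M = {#2, 2, 2#}) + 3 * of_bool (M = {#1, 1, 2#})"
  using eq_mset_iff_sorted[of "[1, 1]" M] eq_mset_iff_sorted[of "[2, 2, 2]" M]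
    eq_mset_iff_sorted[of "[1, 1, 2]" M]
  by (simp add: weight3_def)

lemma weight4_sum:
  "weight4 M = 2 * of_bool (M = {#1, 1, 2#}) + 8 * of_bool (M = {#2, 2, 2, 2#})
     + 5 * of_bool (M = {#1, 1, 1, 3#}) + of_bool (M = {#1, 2, 2, 3#})
     - 4 * of_bool (M = {#3, 3, 3, 3#}) + 2 * of_bool (M = {#1, 1, 2, 2#})
     - 2 * of_bool (M = {#2, 2, 3, 3#})"
  using eq_mset_iff_sorted[of "[1, 1, 2]" M] eq_mset_iff_sorted[of "[2, 2, 2, 2]" M]
    eq_mset_iff_sorted[of "[1, 1, 1, 3]" M] eq_mset_iff_sorted[of "[1, 2, 2, 3]" M]
    eq_mset_iff_sorted[of "[3, 3, 3, 3]" M] eq_mset_iff_sorted[of "[1, 1, 2, 2]" M]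
    eq_mset_iff_sorted[of "[2, 2, 3, 3]" M]
  by (simp add: weight4_sorted Let_def)

lemma chord_set_chord_diagram:
  assumes "generic_immersion X g"
  shows "chord_set (chord_diagram g)"
  using assms unfolding chord_set_def chord_diagram_def generic_immersion_def disjoint_def
  by auto

lemma profile_test_y1: "profile_test 2 [1, 1] y1"
  unfolding y1_def by code_simp

lemma profile_test_y2: "profile_test 3 [2, 2, 2] y2"
  unfolding y2_def by code_simp

lemma profile_test_y3: "profile_test 3 [1, 1, 2] y3"
  unfolding y3_def by code_simp

lemma profile_test_y4: "profile_test 4 [2, 2, 2, 2] y4"
  unfolding y4_def by code_simp

lemma profile_test_y5: "profile_test 4 [1, 1, 1, 3] y5"
  unfolding y5_def by code_simp

lemma profile_test_y6: "profile_test 4 [1, 2, 2, 3] y6"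
  unfolding y6_def by code_simp

lemma profile_test_y7: "profile_test 4 [3, 3, 3, 3] y7"
  unfolding y7_def by code_simp

lemma profile_test_y8: "profile_test 4 [1, 1, 2, 2] y8"
  unfolding y8_def by code_simp

lemma profile_test_y9: "profile_test 4 [2, 2, 3, 3] y9"
  unfolding y9_def by code_simp

lemmas profile_tests =
  profile_test_y1 profile_test_y2 profile_test_y3 profile_test_y4 profile_test_y5 profile_test_y6 profile_test_y7 profile_test_y8 profile_test_y9

lemma subdiagram_counts:
  assumes "generic_immersion X g"
  defines "N \<equiv> \<lambda>M. (\<Sum>C\<in>Pow (chord_diagram g). of_bool (profile crosses C = M))"
  shows "subdiagram_count y1 g = N {#1, 1#}"
    "subdiagram_count y2 g = N {#2, 2, 2#}"
    "subdiagram_count y3 g = N {#1, 1, 2#}"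
    "subdiagram_count y4 g = N {#2, 2, 2, 2#}"
    "subdiagram_count y5 g = N {#1, 1, 1, 3#}"
    "subdiagram_count y6 g = N {#1, 2, 2, 3#}"
    "subdiagram_count y7 g = N {#3, 3, 3, 3#}"
    "subdiagram_count y8 g = N {#1, 1, 2, 2#}"
    "subdiagram_count y9 g = N {#2, 2, 3, 3#}"
proof -
  note count = subdiagram_count_profile[OF chord_set_chord_diagram[OF assms(1)]]
  show "subdiagram_count y1 g = N {#1, 1#}"
    using count[OF profile_tests(1)] by (simp add: N_def y1_def)
  show "subdiagram_count y2 g = N {#2, 2, 2#}"
    using count[OF profile_tests(2)] by (simp add: N_def y2_def)
  show "subdiagram_count y3 g = N {#1, 1, 2#}"
    using count[OF profile_tests(3)] by (simp add: N_def y3_def)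
  show "subdiagram_count y4 g = N {#2, 2, 2, 2#}"
    using count[OF profile_tests(4)] by (simp add: N_def y4_def)
  show "subdiagram_count y5 g = N {#1, 1, 1, 3#}"
    using count[OF profile_tests(5)] by (simp add: N_def y5_def)
  show "subdiagram_count y6 g = N {#1, 2, 2, 3#}"
    using count[OF profile_tests(6)] by (simp add: N_def y6_def)
  show "subdiagram_count y7 g = N {#3, 3, 3, 3#}"
    using count[OF profile_tests(7)] by (simp add: N_def y7_def)
  show "subdiagram_count y8 g = N {#1, 1, 2, 2#}"
    using count[OF profile_tests(8)] by (simp add: N_def y8_def)
  show "subdiagram_count y9 g = N {#2, 2, 3, 3#}"
    using count[OF profile_tests(9)] by (simp add: N_def y9_def)
qed

lemma lambda3_eq_graph_sum:
  assumes "generic_immersion X g"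
  shows "lambda3 g = graph_sum weight3 crosses (chord_diagram g)"
  unfolding lambda3_def graph_sum_def weight3_sum subdiagram_counts[OF assms]
  by (simp add: sum.distrib sum_subtractf sum_distrib_left)

lemma lambda4_eq_graph_sum:
  assumes "generic_immersion X g"
  shows "lambda4 g = graph_sum weight4 crosses (chord_diagram g)"
  unfolding lambda4_def graph_sum_def weight4_sum subdiagram_counts[OF assms]
  by (simp add: sum.distrib sum_subtractf sum_distrib_left)

section \<open>Double points of a generic immersion\<close>

lemma periodic_shift_int:
  fixes g :: "real \<Rightarrow> 'a"
  assumes "\<And>t. g (t + 1) = g t"
  shows "g (t + of_int n) = g t"
proof -
  have nat: "g (t + of_nat k) = g t" for t k
  proof (induction k)
    case (Suc k)
    then show ?case using assms[of "t + of_nat k"] by (simp add: add_ac)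
  qed simp
  show ?thesis
  proof (cases "n \<ge> 0")
    case True
    then show ?thesis using nat[of t "nat n"] by simp
  next
    case False
    then show ?thesis using nat[of "t + of_int n" "nat (- n)"] by simp
  qed
qed

lemma generic_periodic: "generic_immersion X g \<Longrightarrow> g (t + 1) = g t"
  by (simp add: generic_immersion_def)

lemma generic_shift: "generic_immersion X g \<Longrightarrow> g (t + of_int n) = g t"
  by (rule periodic_shift_int) (simp add: generic_immersion_def)

lemma generic_frac:
  assumes "generic_immersion X g"
  shows "g (frac t) = g t"
  using generic_shift[OF assms, of "frac t" "\<lfloor>t\<rfloor>"] by (simp add: frac_def)

lemma generic_range: "generic_immersion X g \<Longrightarrow> g t \<in> X"
  by (auto simp: generic_immersion_def)

lemma generic_velocity:
  assumes "generic_immersion X g"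
  obtains D where "\<And>t. (g has_vector_derivative D t) (at t)" "continuous_on UNIV D" "\<And>t. D t \<noteq> 0"
    "\<And>t. vector_derivative g (at t) = D t"
proof -
  obtain F where F: "F (0::nat) = g" "\<And>n t. (F n has_vector_derivative F (Suc n) t) (at t)"
    using assms unfolding generic_immersion_def smooth_def by metis
  show ?thesis
  proof
    show der: "(g has_vector_derivative F 1 t) (at t)" for t using F(2)[of 0 t] F(1) by simp
    show "continuous_on UNIV (F 1)"
      using F(2)[of 1] by (intro continuous_at_imp_continuous_on) (auto intro: has_vector_derivative_continuous)
    show vd: "vector_derivative g (at t) = F 1 t" for t using der by (rule vector_derivative_at)
    show "F 1 t \<noteq> 0" for t using assms vd[of t] by (auto simp: generic_immersion_def)
  qed
qed

lemma generic_continuous: "generic_immersion X g \<Longrightarrow> continuous_on S g"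
  by (rule generic_velocity, assumption)
    (meson continuous_at_imp_continuous_on has_vector_derivative_continuous)

lemma generic_isCont: "generic_immersion X g \<Longrightarrow> isCont g t"
  using generic_continuous[of X g UNIV] by (simp add: continuous_on_eq_continuous_at)

text \<open>Parameters less than a period apart have different fractional parts, so coincidences may
  be looked for in any window of length one.\<close>

lemma generic_double_pointI:
  assumes g: "generic_immersion X g" and "s < t" "t < s + 1" "g s = g t"
  shows "g s \<in> double_points g"
proof -
  have "frac s \<noteq> frac t"
  proof
    assume "frac s = frac t"
    then have "t - s = of_int (\<lfloor>t\<rfloor> - \<lfloor>s\<rfloor>)" by (simp add: frac_def)
    moreover define k where "k = \<lfloor>t\<rfloor> - \<lfloor>s\<rfloor>"
    ultimately have "(of_int k :: real) > 0" "(of_int k :: real) < 1" using assms(2,3) by auto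
    then show False by (simp only: of_int_0_less_iff of_int_less_1_iff)
  qed
  moreover have "frac s \<in> {0..<1}" "frac t \<in> {0..<1}" by (auto simp: frac_lt_1)
  moreover have "g (frac s) = g s" "g (frac t) = g s" using generic_frac[OF g] assms(4) by simp_all
  ultimately show ?thesis unfolding double_points_def by blast
qed

text \<open>A double point has exactly two parameters in a period, so any two distinct parameters
  with the same value already form the whole chord. The moves and the examples work with this
  description by pairs.\<close>

lemma chord_diagram_eq:
  assumes g: "generic_immersion X g"
  shows "chord_diagram g = {{u, v} | u v. 0 \<le> u \<and> u < v \<and> v < 1 \<and> g u = g v}"
proof (intro equalityI subsetI)
  fix c assume "c \<in> chord_diagram g"
  then obtain p where p: "p \<in> double_points g" "c = {t\<in>{0..<1}. g t = p}"
    by (auto simp: chord_diagram_def)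
  then have "card c = 2" using g by (auto simp: generic_immersion_def)
  then obtain x y where "c = {x, y}" "x \<noteq> y" by (auto simp: card_2_iff)
  then obtain u v where uv: "c = {u, v}" "u < v" by (metis insert_commute linorder_neqE_linordered_idom)
  then have "u \<in> {t\<in>{0..<1}. g t = p}" "v \<in> {t\<in>{0..<1}. g t = p}" using p(2) by auto
  then have "0 \<le> u" "v < 1" "g u = g v" by auto
  then show "c \<in> {{u, v} | u v. 0 \<le> u \<and> u < v \<and> v < 1 \<and> g u = g v}"
    using uv by blast
next
  fix c assume "c \<in> {{u, v} | u v. 0 \<le> u \<and> u < v \<and> v < 1 \<and> g u = g v}"
  then obtain u v where uv: "c = {u, v}" "0 \<le> u" "u < v" "v < 1" "g u = g v" by auto
  have "u \<in> {0..<1}" "v \<in> {0..<1}" "u \<noteq> v" "g v = g u" using uv by auto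
  then have d: "g u \<in> double_points g" unfolding double_points_def by blast
  then have c2: "card {t\<in>{0..<1}. g t = g u} = 2" using g by (auto simp: generic_immersion_def)
  have "c \<subseteq> {t\<in>{0..<1}. g t = g u}" using uv by auto
  then have "c = {t\<in>{0..<1}. g t = g u}"
  proof (rule card_subset_eq[rotated])
    show "finite {t\<in>{0..<1}. g t = g u}" using c2 by (metis card.infinite zero_neq_numeral)
    show "card c = card {t\<in>{0..<1}. g t = g u}" using c2 uv(1,3) by simp
  qed
  then show "c \<in> chord_diagram g" using d by (auto simp: chord_diagram_def)
qed

lemma double_point_params:
  assumes g: "generic_immersion X g" and "p \<in> double_points g"
  obtains s t where "0 \<le> s" "s < t" "t < 1" "g s = p" "g t = p"
    "{u\<in>{0..<1}. g u = p} = {s, t}" "\<And>u. g u = p \<longleftrightarrow> (\<exists>n::int. u = s + of_int n \<or> u = t + of_int n)"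
proof -
  have "{u\<in>{0..<1}. g u = p} \<in> chord_diagram g" using assms by (auto simp: chord_diagram_def)
  then obtain s t where st: "{u\<in>{0..<1}. g u = p} = {s, t}" "0 \<le> s" "s < t" "t < 1"
    unfolding chord_diagram_eq[OF g] by auto
  then have gp: "g s = p" "g t = p" by auto
  show ?thesis
  proof
    show "g u = p \<longleftrightarrow> (\<exists>n::int. u = s + of_int n \<or> u = t + of_int n)" for u
    proof
      assume "g u = p"
      then have "frac u \<in> {u\<in>{0..<1}. g u = p}" using generic_frac[OF g] by (simp add: frac_ge_0 frac_lt_1)
      then have "frac u = s \<or> frac u = t" unfolding st(1) by simp
      then show "\<exists>n::int. u = s + of_int n \<or> u = t + of_int n"
        by (metis add.commute diff_add_cancel frac_def)
    qed (use gp generic_shift[OF g] in auto)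
  qed (fact st gp)+
qed

text \<open>A simple point has at most one parameter in a period and a double point has two. It
  follows that near any parameter the curve avoids a given finite set, with the possible exception
  of that parameter itself.\<close>

lemma finite_preimage:
  assumes g: "generic_immersion X g" and F: "finite F"
  shows "finite {t\<in>{c..<c+1}. g t \<in> F}"
proof -
  have fin1: "finite {t\<in>{0..<1}. g t = p}" for p
  proof (cases "p \<in> double_points g")
    case True
    then have "card {t\<in>{0..<1}. g t = p} = 2" using g by (auto simp: generic_immersion_def)
    then show ?thesis by (metis card.infinite zero_neq_numeral)
  next
    case False
    then have "s = t" if "s \<in> {t\<in>{0..<1}. g t = p}" "t \<in> {t\<in>{0..<1}. g t = p}" for s t
      using that False unfolding double_points_def by blast
    then show ?thesis by (metis (no_types, lifting) finite.simps is_singletonI' is_singleton_def)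
  qed
  have "{t\<in>{0..<1}. g t \<in> F} = (\<Union>p\<in>F. {t\<in>{0..<1}. g t = p})" by auto
  then have fin: "finite {t\<in>{0..<1}. g t \<in> F}" using F fin1 by auto
  have "inj_on frac {t\<in>{c..<c+1}. g t \<in> F}"
  proof (rule inj_onI)
    fix x y assume xy: "x \<in> {t\<in>{c..<c+1}. g t \<in> F}" "y \<in> {t\<in>{c..<c+1}. g t \<in> F}" "frac x = frac y"
    then have "x - y = of_int (\<lfloor>x\<rfloor> - \<lfloor>y\<rfloor>)" by (simp add: frac_def)
    moreover have "\<bar>x - y\<bar> < 1" using xy by auto
    moreover define k where "k = \<lfloor>x\<rfloor> - \<lfloor>y\<rfloor>"
    ultimately have "x - y = of_int k" "\<bar>of_int k :: real\<bar> < 1" by auto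
    then have "\<bar>k\<bar> < 1" by (metis of_int_abs of_int_less_1_iff)
    then show "x = y" using \<open>x - y = of_int k\<close> by simp
  qed
  moreover have "frac ` {t\<in>{c..<c+1}. g t \<in> F} \<subseteq> {t\<in>{0..<1}. g t \<in> F}"
    using generic_frac[OF g] by (auto simp: frac_ge_0 frac_lt_1)
  ultimately show ?thesis by (intro finite_imageD[OF finite_subset[OF _ fin]])
qed

section \<open>Germs of the curve relative to a subset of its image\<close>

lemma eventually_avoids:
  assumes g: "generic_immersion X g" and F: "finite F"
  shows "\<forall>\<^sub>F v in at u. g v \<notin> F"
proof -
  let ?Z = "{t\<in>{u-1/2..<u-1/2+1}. g t \<in> F}"
  have "\<not> u islimpt ?Z" using finite_preimage[OF g F] by (rule islimpt_finite)
  then have "\<forall>\<^sub>F v in at u. v \<notin> ?Z" by (simp add: islimpt_iff_eventually)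
  moreover have "\<forall>\<^sub>F v in at u. v \<in> {u-1/2<..<u+1/2}"
    by (rule eventually_at_in_open') auto
  ultimately show ?thesis by eventually_elim auto
qed

text \<open>The parameter \<open>u\<close> itself is left out: at a crossing the point
  \<open>g u\<close> may lie in a loop \<open>K\<close> because of the other branch, while the
  branch through \<open>u\<close> runs outside.\<close>

definition in_near :: "(real \<Rightarrow> 'a) \<Rightarrow> 'a set \<Rightarrow> real \<Rightarrow> bool" where
  "in_near g K u \<longleftrightarrow> (\<forall>\<^sub>F v in at u. g v \<in> K)"

lemma in_near_not_both: "in_near g K u \<Longrightarrow> in_near g (- K) u \<Longrightarrow> False"
proof -
  assume "in_near g K u" "in_near g (- K) u"
  then have "\<forall>\<^sub>F v in at u. False" unfolding in_near_def by eventually_elim auto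
  then show False by simp
qed

lemma in_near_shift:
  assumes g: "generic_immersion X g"
  shows "in_near g K (u + of_int n) = in_near g K u"
proof -
  have "in_near g K (u + of_int n) = (\<forall>\<^sub>F v in at u. g (v + of_int n) \<in> K)"
    unfolding in_near_def
    by (subst eventually_at_to_0, subst (2) eventually_at_to_0) (simp add: add_ac)
  then show ?thesis by (simp add: in_near_def generic_shift[OF g])
qed

lemma open_in_near:
  assumes "in_near g K u"
  shows "\<exists>e>0. \<forall>v. \<bar>v - u\<bar> < e \<longrightarrow> in_near g K v"
proof -
  obtain e where e: "e > 0" "\<And>v. v \<noteq> u \<Longrightarrow> \<bar>v - u\<bar> < e \<Longrightarrow> g v \<in> K"
    using assms unfolding in_near_def eventually_at by (auto simp: dist_real_def)
  have "in_near g K v" if v: "\<bar>v - u\<bar> < e" for v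
  proof (cases "v = u")
    case False
    have "open ({u - e<..<u + e} - {u})" by (intro open_delete) auto
    then have "\<forall>\<^sub>F w in at v. w \<in> {u - e<..<u + e} - {u}"
      using v False by (intro eventually_at_in_open') auto
    then show ?thesis unfolding in_near_def by eventually_elim (auto intro: e)
  qed (use assms in simp)
  then show ?thesis using e(1) by auto
qed

text \<open>Two disjoint open conditions that cover an interval cannot both occur in it, by
  connectedness. This turns an alternative at each parameter into one alternative for a whole arc of
  the curve.\<close>

lemma interval_alternative:
  fixes P Q :: "real \<Rightarrow> bool"
  assumes alt: "\<And>u. a < u \<Longrightarrow> u < b \<Longrightarrow> P u \<or> Q u" and "\<And>u. P u \<Longrightarrow> Q u \<Longrightarrow> False"
    and P: "\<And>u. P u \<Longrightarrow> \<exists>e>0. \<forall>v. \<bar>v - u\<bar> < e \<longrightarrow> P v"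
    and Q: "\<And>u. Q u \<Longrightarrow> \<exists>e>0. \<forall>v. \<bar>v - u\<bar> < e \<longrightarrow> Q v"
  shows "(\<forall>u\<in>{a<..<b}. P u) \<or> (\<forall>u\<in>{a<..<b}. Q u)"
proof (rule ccontr)
  assume neg: "\<not> ?thesis"
  have "open {u. P u}" "open {u. Q u}"
    using P Q by (auto simp: open_dist dist_real_def)
  moreover have "{u. P u} \<inter> {u. Q u} \<inter> {a<..<b} = {}"
    using assms(2) by blast
  moreover have cover: "u \<in> {u. P u} \<union> {u. Q u}" if "u \<in> {a<..<b}" for u
    using alt[of u] that by auto
  then have "{a<..<b} \<subseteq> {u. P u} \<union> {u. Q u}" by blast
  moreover obtain x y where "x \<in> {a<..<b}" "\<not> P x" "y \<in> {a<..<b}" "\<not> Q y" using neg by blast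
  then have "{u. P u} \<inter> {a<..<b} \<noteq> {}" "{u. Q u} \<inter> {a<..<b} \<noteq> {}"
    using cover by blast+
  ultimately show False
    using connected_Ioo[of a b] unfolding connected_def by blast
qed

lemma interval_in_near:
  assumes "\<And>u. a < u \<Longrightarrow> u < b \<Longrightarrow> in_near g K u \<or> in_near g (- K) u"
  shows "(\<forall>u\<in>{a<..<b}. in_near g K u) \<or> (\<forall>u\<in>{a<..<b}. in_near g (- K) u)"
  using assms by (intro interval_alternative) (auto intro: open_in_near in_near_not_both)

text \<open>The counterpart of \<open>in_near\<close> that mentions only the image of the curve.
  Since it uses nothing but relatively open sets of \<open>X\<close>, it is preserved by
  homeomorphisms of \<open>X\<close>.\<close>

definition all_near :: "'a::topological_space set \<Rightarrow> 'a set \<Rightarrow> 'a set \<Rightarrow> 'a \<Rightarrow> bool" where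
  "all_near X P K q \<longleftrightarrow> (\<exists>U. openin (top_of_set X) U \<and> q \<in> U \<and> U \<inter> P - {q} \<subseteq> K)"

text \<open>The image of the compact set \<open>{0..1} - Q\<close> is closed and misses
  \<open>q\<close>; its complement is the required neighbourhood.\<close>

lemma curve_near_point:
  assumes g: "generic_immersion X g" and q: "q \<in> X" and Q: "open Q" "\<And>u. g u = q \<Longrightarrow> u \<in> Q"
  shows "\<exists>U. openin (top_of_set X) U \<and> q \<in> U \<and> (\<forall>r\<in>U \<inter> range g. \<exists>v\<in>Q. r = g v)"
proof -
  have "compact (g ` ({0..1} - Q))"
    using Q(1) generic_continuous[OF g] by (intro compact_continuous_image compact_diff) auto
  then have "closed (g ` ({0..1} - Q))" by (rule compact_imp_closed)
  then have "openin (top_of_set X) (X \<inter> - (g ` ({0..1} - Q)))" by (auto intro: openin_open_Int)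
  moreover have "q \<in> X \<inter> - (g ` ({0..1} - Q))" using q Q(2) by auto
  moreover have "\<exists>v\<in>Q. r = g v" if r: "r \<in> (X \<inter> - (g ` ({0..1} - Q))) \<inter> range g" for r
  proof -
    obtain v where v: "r = g v" using r by auto
    then have rv: "r = g (frac v)" using generic_frac[OF g] by simp
    have "frac v \<in> {0..1}" by (simp add: frac_ge_0 less_imp_le frac_lt_1)
    then have "frac v \<in> Q" using r rv by auto
    then show ?thesis using rv by auto
  qed
  ultimately show ?thesis by blast
qed

text \<open>The bridge between image and parameters. In one direction continuity pulls the
  neighbourhood back, and nearby parameters avoid \<open>q\<close>. In the other, points of the
  curve near \<open>q\<close> come from parameters near those of \<open>q\<close>, by
  \<open>curve_near_point\<close>.\<close>

lemma all_near_iff: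
  assumes g: "generic_immersion X g" and q: "q \<in> X"
  shows "all_near X (range g) K q \<longleftrightarrow> (\<forall>u. g u = q \<longrightarrow> in_near g K u)"
proof
  assume "all_near X (range g) K q"
  then obtain U where U: "openin (top_of_set X) U" "q \<in> U" "U \<inter> range g - {q} \<subseteq> K"
    by (auto simp: all_near_def)
  then obtain O' where O': "open O'" "U = X \<inter> O'" by (auto simp: openin_open)
  show "\<forall>u. g u = q \<longrightarrow> in_near g K u"
  proof (intro allI impI)
    fix u assume u: "g u = q"
    have "g \<midarrow>u\<rightarrow> g u" using generic_isCont[OF g] by (simp add: isCont_def)
    then have "\<forall>\<^sub>F v in at u. g v \<in> O'" using O' U(2) u by (intro topological_tendstoD) auto
    moreover have "\<forall>\<^sub>F v in at u. g v \<notin> {q}" by (rule eventually_avoids[OF g]) simp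
    ultimately show "in_near g K u"
      unfolding in_near_def
      by eventually_elim (use U(3) O'(2) generic_range[OF g] in auto)
  qed
next
  assume *: "\<forall>u. g u = q \<longrightarrow> in_near g K u"
  \<comment> \<open>The union runs over all parameters of \<open>q\<close> and all admissible radii,
    which spares a choice of radii; radii that are not positive contribute empty balls.\<close>
  define Q where "Q = (\<Union>u\<in>{u. g u = q}. \<Union>e\<in>{e. \<forall>v. v \<noteq> u \<and> \<bar>v - u\<bar> < e \<longrightarrow> g v \<in> K}. ball u e)"
  have "open Q" by (auto simp: Q_def)
  moreover have "u \<in> Q" if u: "g u = q" for u
  proof -
    obtain e where "e > 0" "\<forall>v. v \<noteq> u \<and> \<bar>v - u\<bar> < e \<longrightarrow> g v \<in> K"
      using * u unfolding in_near_def eventually_at by (auto simp: dist_real_def)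
    then show ?thesis using u unfolding Q_def by (intro UN_I[of u] UN_I[of e]) auto
  qed
  ultimately obtain U where U: "openin (top_of_set X) U" "q \<in> U" "\<forall>r\<in>U \<inter> range g. \<exists>v\<in>Q. r = g v"
    using curve_near_point[OF g q, of Q] by metis
  have "U \<inter> range g - {q} \<subseteq> K"
  proof
    fix r assume r: "r \<in> U \<inter> range g - {q}"
    then obtain v where v: "v \<in> Q" "r = g v" using U(3) by blast
    then obtain u e where ue: "g u = q" "\<forall>v. v \<noteq> u \<and> \<bar>v - u\<bar> < e \<longrightarrow> g v \<in> K" "v \<in> ball u e"
      by (auto simp: Q_def)
    then have "v \<noteq> u" using r v by auto
    moreover have "\<bar>v - u\<bar> < e" using ue(3) by (simp add: dist_real_def abs_minus_commute)
    ultimately show "r \<in> K" using ue(2) v(2) by blast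
  qed
  then show "all_near X (range g) K q" using U(1,2) by (auto simp: all_near_def)
qed

section \<open>Transport along homeomorphisms of the surface\<close>

lemma homeomorphism_openin:
  assumes "homeomorphism X X h h'" "openin (top_of_set X) U"
  shows "openin (top_of_set X) (h ` U)"
  using assms homeomorphism_imp_open_map by blast

text \<open>Only an implication on points of \<open>P\<close> is asked of \<open>K'\<close>, so the
  lemma serves the image of a loop as well as the complement of that image.\<close>

lemma all_near_transfer:
  assumes h: "homeomorphism X X h h'" and "all_near X P K q" "q \<in> X" "P \<subseteq> X"
    and K: "\<And>r. r \<in> P \<Longrightarrow> r \<in> K \<Longrightarrow> h r \<in> K'"
  shows "all_near X (h ` P) K' (h q)"
proof -
  obtain U where U: "openin (top_of_set X) U" "q \<in> U" "U \<inter> P - {q} \<subseteq> K"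
    using assms(2) by (auto simp: all_near_def)
  have UX: "U \<subseteq> X" using U(1) openin_imp_subset by blast
  have inj: "inj_on h X" using h by (metis homeomorphism_apply1 inj_on_inverseI)
  have "h ` U \<inter> h ` P - {h q} \<subseteq> K'"
  proof
    fix y assume "y \<in> h ` U \<inter> h ` P - {h q}"
    then obtain r r' where r: "r \<in> U" "y = h r" "r' \<in> P" "y = h r'" "y \<noteq> h q" by auto
    then have "r = r'" using inj UX assms(4) by (auto dest: inj_onD)
    then have "r \<in> K" using r U(3) by auto
    then show "y \<in> K'" using K r \<open>r = r'\<close> by auto
  qed
  then show ?thesis
    using homeomorphism_openin[OF h U(1)] U(2) unfolding all_near_def by blast
qed

definition accumulates :: "'a::topological_space set \<Rightarrow> 'a set \<Rightarrow> 'a \<Rightarrow> bool" where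
  "accumulates X S q \<longleftrightarrow> (\<forall>V. openin (top_of_set X) V \<and> q \<in> V \<longrightarrow> V \<inter> S \<noteq> {})"

text \<open>A topological substitute for the curve \<open>P\<close> crossing the branch \<open>K\<close> at \<open>q\<close>.\<close>

definition splits :: "'a::topological_space set \<Rightarrow> 'a set \<Rightarrow> 'a set \<Rightarrow> 'a \<Rightarrow> bool" where
  "splits X P K q \<longleftrightarrow> (\<exists>A B U. q \<in> K \<and> openin (top_of_set X) A \<and> openin (top_of_set X) B \<and>
     openin (top_of_set X) U \<and> A \<inter> B = {} \<and> q \<in> U \<and> U - K = A \<union> B \<and>
     accumulates X (A \<inter> P) q \<and> accumulates X (B \<inter> P) q)"

lemma accumulates_transfer:
  assumes h: "homeomorphism X X h h'" and acc: "accumulates X S q" and "q \<in> X"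
  shows "accumulates X (h ` S) (h q)"
  unfolding accumulates_def
proof (intro allI impI)
  fix V assume V: "openin (top_of_set X) V \<and> h q \<in> V"
  then have VX: "V \<subseteq> X" using openin_imp_subset by blast
  have "homeomorphism X X h' h" using h by (rule homeomorphism_symD)
  then have "openin (top_of_set X) (h' ` V)" using V by (intro homeomorphism_openin) auto
  moreover have "q \<in> h' ` V" using V h assms(3) by (metis homeomorphism_apply1 imageI)
  ultimately have "h' ` V \<inter> S \<noteq> {}" using acc by (auto simp: accumulates_def)
  then obtain v where v: "v \<in> V" "h' v \<in> S" by auto
  then have "h (h' v) = v" using h VX by (metis homeomorphism_apply2 subsetD)
  then show "V \<inter> h ` S \<noteq> {}" using v by force
qed

lemma splits_transfer:
  assumes h: "homeomorphism X X h h'" and s: "splits X P K q" and sub: "q \<in> X" "P \<subseteq> X" "K \<subseteq> X"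
  shows "splits X (h ` P) (h ` K) (h q)"
proof -
  obtain A B U where AB: "q \<in> K" "openin (top_of_set X) A" "openin (top_of_set X) B"
    "openin (top_of_set X) U" "A \<inter> B = {}" "q \<in> U" "U - K = A \<union> B"
    "accumulates X (A \<inter> P) q" "accumulates X (B \<inter> P) q"
    using s unfolding splits_def by (elim exE conjE)
  have inj: "inj_on h X" using h by (metis homeomorphism_apply1 inj_on_inverseI)
  have sX: "A \<subseteq> X" "B \<subseteq> X" "U \<subseteq> X" using AB(2-4) openin_imp_subset by blast+
  have "h ` A \<inter> h ` B = {}" using inj_on_image_Int[OF inj sX(1,2)] AB(5) by simp
  moreover have "h ` U - h ` K = h ` A \<union> h ` B"
  proof -
    have "U - K \<subseteq> X" using sX by auto
    then have "h ` (U - K) = h ` U - h ` K"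
      using inj_on_image_set_diff[OF inj] sub(3) by blast
    then show ?thesis using AB(7) by (simp add: image_Un)
  qed
  moreover have "accumulates X (h ` A \<inter> h ` P) (h q)"
    using accumulates_transfer[OF h AB(8) sub(1)] inj_on_image_Int[OF inj sX(1) sub(2)] by simp
  moreover have "accumulates X (h ` B \<inter> h ` P) (h q)"
    using accumulates_transfer[OF h AB(9) sub(1)] inj_on_image_Int[OF inj sX(2) sub(2)] by simp
  moreover have "h q \<in> h ` K" "h q \<in> h ` U" using AB(1,6) by (auto intro: imageI)
  moreover note homeomorphism_openin[OF h AB(2)] homeomorphism_openin[OF h AB(3)]
    homeomorphism_openin[OF h AB(4)]
  ultimately show ?thesis
    unfolding splits_def by (intro exI[of _ "h ` A"] exI[of _ "h ` B"] exI[of _ "h ` U"] conjI)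
qed

section \<open>Charts and planar separation\<close>

text \<open>The coordinate map is, up to translation, the restriction of a linear map of the ambient
  space. Velocities are therefore transported by \<open>L\<close> itself, and of the inverse
  \<open>S\<close> only continuity matters.\<close>

definition chart :: "'a::euclidean_space set \<Rightarrow> 'a \<Rightarrow> ('a \<Rightarrow> complex) \<Rightarrow> (complex \<Rightarrow> 'a) \<Rightarrow> real \<Rightarrow> bool" where
  "chart X q L S r \<longleftrightarrow> 0 < r \<and> bounded_linear L \<and>
     (\<exists>V. openin (top_of_set X) V \<and> q \<in> V \<and> homeomorphism V (ball 0 r) (\<lambda>x. L (x - q)) S)"

lemma chart_image:
  assumes "chart X q L S r"
  shows "openin (top_of_set X) (S ` ball 0 r)" "q \<in> S ` ball 0 r"
    "homeomorphism (S ` ball 0 r) (ball 0 r) (\<lambda>x. L (x - q)) S"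
proof -
  obtain V where V: "openin (top_of_set X) V" "q \<in> V" "homeomorphism V (ball 0 r) (\<lambda>x. L (x - q)) S"
    using assms by (auto simp: chart_def)
  then have "V = S ` ball 0 r" by (simp add: homeomorphism_def)
  with V show "openin (top_of_set X) (S ` ball 0 r)" "q \<in> S ` ball 0 r"
    "homeomorphism (S ` ball 0 r) (ball 0 r) (\<lambda>x. L (x - q)) S"
    by simp_all
qed

lemma chart_left:
  assumes "chart X q L S r" "z \<in> ball 0 r"
  shows "L (S z - q) = z"
  using chart_image(3)[OF assms(1)] assms(2) by (auto simp: homeomorphism_def)

lemma chart_right:
  assumes "chart X q L S r" "x \<in> S ` ball 0 r"
  shows "S (L (x - q)) = x" "L (x - q) \<in> ball 0 r"
  using chart_image(3)[OF assms(1)] assms(2) by (auto simp: homeomorphism_def)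

lemma chart_zero:
  assumes "chart X q L S r"
  shows "S 0 = q"
proof -
  have "L 0 = 0" using assms by (simp add: chart_def bounded_linear.linear linear_0)
  then show ?thesis using chart_right(1)[OF assms chart_image(2)[OF assms]] by simp
qed

lemma chart_in: "chart X q L S r \<Longrightarrow> z \<in> ball 0 r \<Longrightarrow> S z \<in> X"
  using chart_image(1)[of X q L S r] openin_imp_subset by blast

lemma chart_continuous: "chart X q L S r \<Longrightarrow> continuous_on (ball 0 r) S"
  using chart_image(3)[of X q L S r] by (simp add: homeomorphism_def)

lemma chart_inj:
  assumes "chart X q L S r" "z \<in> ball 0 r" "w \<in> ball 0 r" "S z = S w"
  shows "z = w"
  using chart_left[OF assms(1,2)] chart_left[OF assms(1,3)] assms(4) by metis

lemma chart_openin_image: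
  assumes c: "chart X q L S r" and W: "open W" "W \<subseteq> ball 0 r"
  shows "openin (top_of_set X) (S ` W)"
proof -
  have "openin (top_of_set (ball 0 r)) W" using W by (metis Int_absorb1 openin_open_Int)
  then have "openin (top_of_set (S ` ball 0 r)) (S ` W)"
    using homeomorphism_imp_open_map[OF homeomorphism_symD[OF chart_image(3)[OF c]]] by blast
  then show ?thesis using chart_image(1)[OF c] openin_trans by blast
qed

lemma chart_open_vimage:
  assumes c: "chart X q L S r" and A: "openin (top_of_set X) A"
  shows "open {z\<in>ball 0 r. S z \<in> A}"
proof -
  have "openin (top_of_set (ball 0 r)) (ball 0 r \<inter> S -` A)"
    using chart_continuous[OF c] chart_in[OF c] A by (intro continuous_openin_preimage[of _ S X]) auto
  then have "open (ball 0 r \<inter> S -` A)" using openin_open_trans[of "ball 0 r"] by blast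
  moreover have "ball 0 r \<inter> S -` A = {z\<in>ball 0 r. S z \<in> A}" by auto
  ultimately show ?thesis by simp
qed

lemma chart_small:
  assumes c: "chart X q L S r" and A: "openin (top_of_set X) A" "q \<in> A"
  obtains e where "0 < e" "e \<le> r" "\<And>z. z \<in> ball 0 e \<Longrightarrow> S z \<in> A"
proof -
  have "0 < r" using c by (simp add: chart_def)
  moreover have "0 \<in> {z\<in>ball 0 r. S z \<in> A}" using A(2) chart_zero[OF c] \<open>0 < r\<close> by simp
  ultimately obtain e where e: "e > 0" "ball 0 e \<subseteq> {z\<in>ball 0 r. S z \<in> A}"
    using chart_open_vimage[OF c A(1)] open_contains_ball by blast
  show ?thesis
  proof (rule that[of "min e r"])
    show "0 < min e r" using e(1) \<open>0 < r\<close> by simp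
    show "S z \<in> A" if "z \<in> ball 0 (min e r)" for z
    proof -
      have "z \<in> ball 0 e" using that by simp
      then show ?thesis using e(2) by blast
    qed
  qed simp
qed

text \<open>A linear change of coordinates; the radius shrinks so that \<open>N\<close> maps the new
  disc into the old one.\<close>

lemma chart_compose:
  assumes c: "chart X q L S r" and M: "bounded_linear M" and N: "bounded_linear N"
    and MN: "\<And>z. M (N z) = z" "\<And>z. N (M z) = z"
  shows "\<exists>e. chart X q (\<lambda>x. M (L x)) (\<lambda>z. S (N z)) e"
proof -
  have r: "0 < r" and L: "bounded_linear L" using c by (auto simp: chart_def)
  have cM: "continuous_on A M" and cN: "continuous_on A N" for A
    using M N by (auto intro: linear_continuous_on)
  have "N 0 = 0" using N by (simp add: bounded_linear.linear linear_0)
  moreover have "isCont N 0" using cN[of UNIV] by (simp add: continuous_on_eq_continuous_at)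
  ultimately obtain e where e: "e > 0" "\<And>z. dist z 0 < e \<Longrightarrow> dist (N z) 0 < r"
    using r unfolding continuous_at_eps_delta by metis
  let ?W = "N ` ball 0 e"
  have W: "?W \<subseteq> ball 0 r" using e(2) by (auto simp: dist_commute)
  have "?W = M -` ball 0 e"
  proof (intro set_eqI iffI)
    fix x assume "x \<in> M -` ball 0 e"
    then have "N (M x) \<in> ?W" by (intro imageI) simp
    then show "x \<in> ?W" using MN(2) by simp
  qed (use MN(1) in auto)
  then have "open ?W" using cM[of UNIV] by (simp add: open_vimage)
  then have "openin (top_of_set X) (S ` ?W)" using chart_openin_image[OF c] W by blast
  moreover have "q \<in> S ` ?W"
    using chart_zero[OF c] e(1) \<open>N 0 = 0\<close> by (metis centre_in_ball imageI)
  moreover have "homeomorphism (S ` ?W) (ball 0 e) (\<lambda>x. M (L (x - q))) (\<lambda>z. S (N z))"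
  proof -
    have "homeomorphism (S ` ?W) ?W (\<lambda>x. L (x - q)) S"
      by (rule homeomorphism_of_subsets[OF chart_image(3)[OF c]])
        (use W chart_left[OF c] in \<open>force simp: image_iff\<close>)+
    moreover have "homeomorphism ?W (ball 0 e) M N"
      using MN cM cN by (intro homeomorphismI) auto
    ultimately have "homeomorphism (S ` ?W) (ball 0 e) (M \<circ> (\<lambda>x. L (x - q))) (S \<circ> N)"
      by (rule homeomorphism_compose)
    then show ?thesis by (simp add: o_def)
  qed
  moreover have "bounded_linear (\<lambda>x. M (L x))" using M L by (rule bounded_linear_compose)
  ultimately have "chart X q (\<lambda>x. M (L x)) (\<lambda>z. S (N z)) e" using e(1) unfolding chart_def by blast
  then show ?thesis by blast
qed

lemma chart_adapted:
  assumes c: "chart X q L S r" and ind: "Im (cnj x * y) \<noteq> 0"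
  shows "\<exists>M S' e. chart X q (\<lambda>v. M (L v)) S' e \<and> M x = 1 \<and> M y = \<i>"
proof -
  \<comment> \<open>The determinant of \<open>x\<close> and \<open>y\<close>. \<open>M\<close>
    computes the coordinates of a vector in the basis \<open>x\<close>, \<open>y\<close> by Cramer's
    rule, and \<open>N\<close> recombines them.\<close>
  define D where "D = Im (cnj x * y)"
  define M where "M z = Complex (Im (cnj z * y) / D) (Im (cnj x * z) / D)" for z
  define N where "N z = of_real (Re z) * x + of_real (Im z) * y" for z
  have D: "D \<noteq> 0" using ind by (simp add: D_def)
  have xy: "M x = 1" "M y = \<i>" using D by (auto simp: M_def complex_eq_iff D_def algebra_simps)
  have lM: "linear M"
    by (rule linearI) (auto simp: M_def complex_eq_iff algebra_simps add_divide_distrib diff_divide_distrib)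
  have lN: "linear N" by (rule linearI) (auto simp: N_def complex_eq_iff algebra_simps)
  have MN: "M (N z) = z" for z
  proof -
    have "M (N z) = Re z *\<^sub>R M x + Im z *\<^sub>R M y"
      unfolding N_def using lM by (simp add: linear_add linear_scale flip: scaleR_conv_of_real)
    then show ?thesis by (simp add: xy complex_eq_iff)
  qed
  have "N (M z) = z" for z
  proof -
    have "linear (N \<circ> M)" "inj N" using lM lN MN by (auto intro: linear_compose inj_on_inverseI)
    then have "surj N" using lN linear_injective_imp_surjective by blast
    then obtain w where "z = N w" by auto
    then show ?thesis using MN by simp
  qed
  then show ?thesis
    using chart_compose[OF c, of M N] lM lN MN xy by (auto simp: linear_conv_bounded_linear)
qed

text \<open>\<open>T\<close> stands for the tangent space: it contains all velocities at
  \<open>q\<close> of curves in \<open>X\<close>, and \<open>L\<close> is injective on it. Linearly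
  independent velocities therefore stay independent in the chart.\<close>

definition surface :: "'a::euclidean_space set \<Rightarrow> bool" where
  "surface X \<longleftrightarrow> (\<forall>q\<in>X. \<exists>L S r T. chart X q L S r \<and> subspace T \<and> (\<forall>v\<in>T. L v = 0 \<longrightarrow> v = 0) \<and>
     (\<forall>\<gamma> t v. range \<gamma> \<subseteq> X \<and> \<gamma> t = q \<and> (\<gamma> has_vector_derivative v) (at t) \<longrightarrow> v \<in> T))"

lemma generic_chart:
  assumes X: "surface X" and g: "generic_immersion X g" and q: "g u = q"
    and D: "\<And>t. (g has_vector_derivative D t) (at t)" "\<And>t. D t \<noteq> 0"
  shows "\<exists>L S r. chart X q L S r \<and> L (D u) = 1"
    and "g v = q \<Longrightarrow> \<not> collinear {0, D u, D v} \<Longrightarrow> \<exists>L S r. chart X q L S r \<and> L (D u) = 1 \<and> L (D v) = \<i>"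
proof -
  have "q \<in> X" using generic_range[OF g] q by auto
  then obtain L S r T where c: "chart X q L S r" and T: "subspace T" "\<forall>v\<in>T. L v = 0 \<longrightarrow> v = 0"
    and tan: "\<forall>\<gamma> t v. range \<gamma> \<subseteq> X \<and> \<gamma> t = q \<and> (\<gamma> has_vector_derivative v) (at t) \<longrightarrow> v \<in> T"
    using X unfolding surface_def by meson
  have L: "linear L" using c by (simp add: chart_def bounded_linear.linear)
  have DT: "D t \<in> T" if "g t = q" for t using tan D that generic_range[OF g] by blast
  have Lu: "L (D u) \<noteq> 0" using T(2) DT q D(2) by blast
  \<comment> \<open>With a single branch any second basis vector will do; the image velocity turned
    by a right angle is taken.\<close>
  have "Im (cnj (L (D u)) * (\<i> * L (D u))) \<noteq> 0"
    using Lu by (auto simp: complex_eq_iff sum_squares_eq_zero_iff simp flip: power2_eq_square)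
  from chart_adapted[OF c this] show "\<exists>L S r. chart X q L S r \<and> L (D u) = 1" by blast
  assume v: "g v = q" "\<not> collinear {0, D u, D v}"
  have "Im (cnj (L (D u)) * L (D v)) \<noteq> 0"
  proof
    define x where "x = L (D u)"
    \<comment> \<open>The projection coefficient. If the determinant vanishes, the image of
      \<open>D v\<close> is \<open>k\<close> times that of \<open>D u\<close>, and injectivity on
      \<open>T\<close> makes the velocities themselves proportional.\<close>
    define k where "k = Re (cnj x * L (D v)) / (norm x)\<^sup>2"
    assume "Im (cnj (L (D u)) * L (D v)) = 0"
    then have "cnj x * L (D v) = of_real (Re (cnj x * L (D v)))"
      by (simp add: complex_eq_iff x_def)
    moreover have "cnj x * x = of_real ((norm x)\<^sup>2)" by (metis complex_norm_square mult.commute of_real_power)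
    then have "cnj x * (of_real k * x) = of_real (k * (norm x)\<^sup>2)" by (simp add: mult.left_commute)
    moreover have "k * (norm x)\<^sup>2 = Re (cnj x * L (D v))" using Lu by (simp add: k_def x_def)
    ultimately have "cnj x * (L (D v) - of_real k * x) = 0" by (simp only: right_diff_distrib) simp
    then have "L (D v) = k *\<^sub>R L (D u)" using Lu by (simp add: x_def scaleR_conv_of_real)
    then have "L (D v - k *\<^sub>R D u) = 0" using L by (simp add: linear_diff linear_scale)
    moreover have "D v - k *\<^sub>R D u \<in> T" using T(1) DT q v(1) by (simp add: subspace_diff subspace_scale)
    ultimately have "D v = k *\<^sub>R D u" using T(2) by auto
    then show False using v(2) by (auto simp: collinear_lemma)
  qed
  from chart_adapted[OF c this] show "\<exists>L S r. chart X q L S r \<and> L (D u) = 1 \<and> L (D v) = \<i>" by blast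
qed

lemma chart_curve_derivative:
  assumes c: "chart X q L S r" and g: "(g has_vector_derivative v) (at t)"
  shows "((\<lambda>t. L (g t - q)) has_vector_derivative L v) (at t)"
proof -
  have "bounded_linear L" using c by (simp add: chart_def)
  moreover have "((\<lambda>t. g t - q) has_vector_derivative v) (at t)"
    using g by (auto intro!: derivative_eq_intros)
  ultimately show ?thesis by (rule bounded_linear.has_vector_derivative)
qed

text \<open>For \<open>d\<close> in \<open>directions\<close>, \<open>sector d\<close> is the open quarter plane bisected by the ray through \<open>d\<close>.\<close>

definition half_plane :: "complex \<Rightarrow> complex set" where
  "half_plane d = {z. 0 < Re (z / d) + Im (z / d)}"

definition sector :: "complex \<Rightarrow> complex set" where
  "sector d = half_plane d \<inter> half_plane (- \<i> * d)"

abbreviation directions :: "complex set" where "directions \<equiv> {1, \<i>, - 1, - \<i>}"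

section \<open>The four quarter planes and the separation of a disc\<close>

lemma in_sector_iff: "z \<in> sector d \<longleftrightarrow> \<bar>Im (z / d)\<bar> < Re (z / d)"
proof -
  have eq: "z / (- \<i> * d) = \<i> * (z / d)"
    by (simp add: divide_inverse)
  have "z \<in> half_plane (- \<i> * d) \<longleftrightarrow> Im (z / d) < Re (z / d)"
    unfolding half_plane_def mem_Collect_eq eq Re_i_times Im_i_times by linarith
  moreover have "z \<in> half_plane d \<longleftrightarrow> 0 < Re (z / d) + Im (z / d)"
    by (simp add: half_plane_def)
  ultimately show ?thesis unfolding sector_def Int_iff by linarith
qed

text \<open>\<open>half_plane d\<close> contains two neighbouring quarter planes, those of
  \<open>d\<close> and \<open>\<i> * d\<close>, and the open ray between them. Its convexity is what
  connects these two sectors across that ray.\<close>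

lemma convex_half_plane: "convex (half_plane d)"
proof -
  have "linear (\<lambda>z. Re (z / d) + Im (z / d))"
    by (rule linearI) (auto simp: divide_inverse algebra_simps)
  from convex_linear_vimage[OF this, of "{0<..}"] show ?thesis
    by (simp add: half_plane_def vimage_def)
qed

lemma half_plane_minus: "half_plane d \<inter> half_plane (- d) = {}"
  by (auto simp: half_plane_def)

lemma sector_sub: "sector d \<subseteq> half_plane d" "sector (\<i> * d) \<subseteq> half_plane d"
  by (auto simp: sector_def)

lemma sector_disjoint_half: "sector (- d) \<inter> half_plane d = {}" "sector (- \<i> * d) \<inter> half_plane d = {}"
  using half_plane_minus[of d] by (auto simp: sector_def)

lemma sectors_disjoint:
  assumes "d \<in> directions" "d' \<in> directions" "z \<in> sector d" "z \<in> sector d'"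
  shows "d = d'"
  using assms by (auto simp: in_sector_iff)

lemma four_directions:
  assumes "a \<in> directions" "b \<in> directions"
  shows "b = a \<or> b = \<i> * a \<or> b = - a \<or> a = \<i> * b"
  using assms by auto

text \<open>A branch set in a chart at a crossing: \<open>E\<close> is the trace of
  \<open>K\<close>, and \<open>A\<close> and \<open>B\<close> are its two sides. \<open>E\<close>
  stays within the open sectors and the origin, so the diagonals between the sectors, apart from the
  origin, are free of it.\<close>

locale planar_separation =
  fixes r :: real and E A B :: "complex set"
  assumes r: "r > 0"
    and E: "E \<subseteq> insert 0 (\<Union>d\<in>directions. sector d)"
    and AB: "open A" "open B" "A \<inter> B = {}" "ball 0 r - E \<subseteq> A \<union> B"
begin

text \<open>A convex set meets the disc in a connected set; if it avoids \<open>E\<close>, the open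
  sets \<open>A\<close> and \<open>B\<close> cannot both meet it.\<close>

lemma one_side:
  assumes "convex Z" "Z \<inter> ball 0 r \<inter> E = {}" "Z \<inter> ball 0 r \<inter> A \<noteq> {}" "Z \<inter> ball 0 r \<inter> B \<noteq> {}"
  shows False
proof -
  have "connected (Z \<inter> ball 0 r)"
    using assms(1) by (intro convex_connected convex_Int) auto
  moreover have "Z \<inter> ball 0 r \<subseteq> A \<union> B" using assms(2) AB(4) by blast
  moreover have "A \<inter> B \<inter> (Z \<inter> ball 0 r) = {}" using AB(3) by blast
  ultimately show False
    using AB(1,2) assms(3,4) unfolding connected_def by (metis Int_commute)
qed

lemma same_sector:
  assumes "E \<inter> sector d = {}" "sector d \<inter> ball 0 r \<inter> A \<noteq> {}" "sector d \<inter> ball 0 r \<inter> B \<noteq> {}"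
  shows False
proof (rule one_side)
  show "convex (sector d)" unfolding sector_def by (intro convex_Int convex_half_plane)
qed (use assms in blast)+

lemma adjacent_sectors:
  assumes d: "d \<in> directions" and "E \<inter> sector d = {}" "E \<inter> sector (\<i> * d) = {}"
  shows "half_plane d \<inter> ball 0 r \<inter> E = {}"
proof -
  have "half_plane d \<inter> sector e = {}" if "e \<in> directions" "e \<noteq> d" "e \<noteq> \<i> * d" for e
  proof -
    have "e = - d \<or> e = - \<i> * d" using four_directions[OF d that(1)] that(2,3) by auto
    then show ?thesis using sector_disjoint_half[of d] by auto
  qed
  moreover have "0 \<notin> half_plane d" by (simp add: half_plane_def)
  ultimately have "z \<notin> E" if "z \<in> half_plane d" for z
  proof -
    assume *: "\<And>e. e \<in> directions \<Longrightarrow> e \<noteq> d \<Longrightarrow> e \<noteq> \<i> * d \<Longrightarrow> half_plane d \<inter> sector e = {}" "0 \<notin> half_plane d"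
    show "z \<notin> E"
    proof
      assume z: "z \<in> E"
      have "z \<noteq> 0" using *(2) that by metis
      then have "z \<in> (\<Union>d\<in>directions. sector d)" using E z by (meson insertE subsetD)
      then obtain e where e: "e \<in> directions" "z \<in> sector e" by (rule UN_E)
      then have "e = d \<or> e = \<i> * d" using *(1)[OF e(1)] that by blast
      then show False using e(2) z assms(2,3) by blast
    qed
  qed
  then show ?thesis by blast
qed

lemma adjacent_AB:
  assumes "d \<in> directions" "E \<inter> sector d = {}" "E \<inter> sector (\<i> * d) = {}"
    "sector d \<inter> ball 0 r \<inter> A \<noteq> {}" "sector (\<i> * d) \<inter> ball 0 r \<inter> B \<noteq> {}"
  shows False
  by (rule one_side[OF convex_half_plane adjacent_sectors[OF assms(1-3)]])
    (use assms(4,5) sector_sub[of d] in blast)+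

lemma adjacent_BA:
  assumes "d \<in> directions" "E \<inter> sector d = {}" "E \<inter> sector (\<i> * d) = {}"
    "sector d \<inter> ball 0 r \<inter> B \<noteq> {}" "sector (\<i> * d) \<inter> ball 0 r \<inter> A \<noteq> {}"
  shows False
  by (rule one_side[OF convex_half_plane adjacent_sectors[OF assms(1-3)]])
    (use assms(4,5) sector_sub[of d] in blast)+

lemma sector_meets:
  assumes d: "d \<in> directions" and "E \<inter> sector d = {}"
  shows "sector d \<inter> ball 0 r \<inter> A \<noteq> {} \<or> sector d \<inter> ball 0 r \<inter> B \<noteq> {}"
proof -
  have "of_real (r / 2) * d \<in> sector d" "of_real (r / 2) * d \<in> ball 0 r"
    using r d by (auto simp: in_sector_iff norm_mult)
  then show ?thesis using AB(4) assms(2) by blast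
qed

text \<open>Two sectors free of \<open>E\<close> that show different sides are neither equal nor
  neighbours, since equal or neighbouring free sectors are connected off \<open>E\<close>; hence
  they are opposite. A free sector between them would be a neighbour of both and belong to some
  side, which would contradict one of the two.\<close>

lemma opposite_sectors:
  assumes a: "a \<in> directions" "E \<inter> sector a = {}" "sector a \<inter> ball 0 r \<inter> A \<noteq> {}"
    and b: "b \<in> directions" "E \<inter> sector b = {}" "sector b \<inter> ball 0 r \<inter> B \<noteq> {}"
  shows "b = - a \<and> E \<inter> sector (\<i> * a) \<noteq> {} \<and> E \<inter> sector (- (\<i> * a)) \<noteq> {}"
proof -
  have b': "b = - a"
    using four_directions[OF a(1) b(1)]
  proof (elim disjE)
    assume "b = a" then show ?thesis using same_sector[OF a(2,3)] b(3) by simp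
  next
    assume "b = \<i> * a" then show ?thesis using adjacent_AB[OF a(1,2) _ a(3)] b(2,3) by simp
  next
    assume "a = \<i> * b" then show ?thesis using adjacent_BA[OF b(1,2) _ b(3)] a(2,3) by simp
  qed
  have ia: "\<i> * a \<in> directions" "- (\<i> * a) \<in> directions" using a(1) by auto
  have i1: "\<i> * (\<i> * a) = b" "\<i> * (- (\<i> * a)) = a" "\<i> * b = - (\<i> * a)"
    using b' by (simp_all add: algebra_simps flip: mult.assoc)
  have "E \<inter> sector (\<i> * a) \<noteq> {}"
  proof
    assume e: "E \<inter> sector (\<i> * a) = {}"
    from sector_meets[OF ia(1) e] show False
    proof
      assume "sector (\<i> * a) \<inter> ball 0 r \<inter> A \<noteq> {}"
      then show False using adjacent_AB[OF ia(1) e] b(2,3) unfolding i1 by metis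
    next
      assume "sector (\<i> * a) \<inter> ball 0 r \<inter> B \<noteq> {}"
      then show False by (rule adjacent_AB[OF a(1,2) e a(3)])
    qed
  qed
  moreover have "E \<inter> sector (- (\<i> * a)) \<noteq> {}"
  proof
    assume e: "E \<inter> sector (- (\<i> * a)) = {}"
    from sector_meets[OF ia(2) e] show False
    proof
      assume "sector (- (\<i> * a)) \<inter> ball 0 r \<inter> A \<noteq> {}"
      then show False using adjacent_BA[OF b(1,2) _ b(3)] e unfolding i1 by metis
    next
      assume "sector (- (\<i> * a)) \<inter> ball 0 r \<inter> B \<noteq> {}"
      then show False using adjacent_BA[OF ia(2) e] a(2,3) unfolding i1 by metis
    qed
  qed
  ultimately show ?thesis using b' by simp
qed

end

lemma curve_in_sector:
  fixes \<gamma> :: "real \<Rightarrow> complex"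
  assumes der: "(\<gamma> has_vector_derivative d) (at u)" and "\<gamma> u = 0" "d \<noteq> 0"
  shows "\<exists>\<delta>>0. (\<forall>v. u < v \<and> v < u + \<delta> \<longrightarrow> \<gamma> v \<in> sector d) \<and> (\<forall>v. u - \<delta> < v \<and> v < u \<longrightarrow> \<gamma> v \<in> sector (- d))"
proof -
  have "((\<lambda>v. \<gamma> v / d) has_vector_derivative d / d) (at u)"
    using der by (rule has_vector_derivative_divide)
  then have "((\<lambda>v. \<gamma> v / d) has_vector_derivative 1) (at u)" using assms(3) by simp
  \<comment> \<open>With error at most a third of the step, the forward component is at least two
    thirds of it and the transverse one at most a third, so the curve is inside the sector. Any
    constant below 1/2 has this effect.\<close>
  then obtain \<delta> where \<delta>: "\<delta> > 0"
    "\<And>v. norm (v - u) < \<delta> \<Longrightarrow> norm (\<gamma> v / d - \<gamma> u / d - (v - u) *\<^sub>R 1) \<le> 1/3 * norm (v - u)"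
    unfolding has_vector_derivative_def has_derivative_at_alt
    by (meson divide_pos_pos zero_less_numeral zero_less_one)
  have est: "\<bar>Re (\<gamma> v / d) - (v - u)\<bar> \<le> 1/3 * \<bar>v - u\<bar> \<and> \<bar>Im (\<gamma> v / d)\<bar> \<le> 1/3 * \<bar>v - u\<bar>"
    if "\<bar>v - u\<bar> < \<delta>" for v
  proof -
    let ?w = "\<gamma> v / d - of_real (v - u)"
    have n: "norm ?w \<le> 1/3 * \<bar>v - u\<bar>" using \<delta>(2)[of v] that assms(2) by (simp add: scaleR_conv_of_real)
    have "\<bar>Re ?w\<bar> \<le> 1/3 * \<bar>v - u\<bar>" "\<bar>Im ?w\<bar> \<le> 1/3 * \<bar>v - u\<bar>"
      using order_trans[OF abs_Re_le_cmod n] order_trans[OF abs_Im_le_cmod n] by auto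
    then show ?thesis by simp
  qed
  have arith: "I < R" if "\<bar>R - x\<bar> \<le> 1/3 * x" "I \<le> 1/3 * x" "0 < x" for I R x :: real
    using that by linarith
  have "\<gamma> v \<in> sector d" if "u < v" "v < u + \<delta>" for v
  proof -
    have abs: "\<bar>v - u\<bar> = v - u" and "\<bar>v - u\<bar> < \<delta>" and pos: "0 < v - u" using that by auto
    from est[OF this(2)] show ?thesis
      unfolding in_sector_iff abs by (elim conjE) (rule arith[OF _ _ pos])
  qed
  moreover have "\<gamma> v \<in> sector (- d)" if "u - \<delta> < v" "v < u" for v
  proof -
    have abs: "\<bar>v - u\<bar> = u - v" and "\<bar>v - u\<bar> < \<delta>" and pos: "0 < u - v" using that by auto
    have "\<bar>- R - (u - v)\<bar> = \<bar>R - (v - u)\<bar>" for R by linarith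
    from est[OF \<open>\<bar>v - u\<bar> < \<delta>\<close>, unfolded abs, folded this] show ?thesis
      unfolding in_sector_iff divide_minus_right uminus_complex.simps abs_minus_cancel
      by (elim conjE) (rule arith[OF _ _ pos])
  qed
  ultimately show ?thesis using \<delta>(1) by blast
qed

section \<open>The plane and the sphere are surfaces in this sense\<close>

lemma surface_plane: "surface plane"
  unfolding surface_def
proof
  fix q :: "real^2" assume "q \<in> plane"
  define L :: "real^2 \<Rightarrow> complex" where "L x = Complex (x $ 1) (x $ 2)" for x
  define N :: "complex \<Rightarrow> real^2" where "N z = vector [Re z, Im z]" for z
  have L: "linear L" by (rule linearI) (auto simp: L_def complex_eq_iff)
  have N: "linear N" by (rule linearI) (auto simp: N_def vec_eq_iff forall_2)
  have LN: "L (N z) = z" for z by (simp add: L_def N_def complex_eq_iff)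
  have NL: "N (L x) = x" for x by (simp add: L_def N_def vec_eq_iff forall_2)
  have cL: "continuous_on A (\<lambda>x. L (x - q))" for A
  proof -
    have "continuous_on A (\<lambda>x. L x - L q)"
      using linear_continuous_on[OF linear_conv_bounded_linear[THEN iffD1, OF L]]
      by (intro continuous_on_diff continuous_on_const)
    then show ?thesis using L by (simp add: linear_diff)
  qed
  have cN: "continuous_on A (\<lambda>z. N z + q)" for A
    using linear_continuous_on[OF linear_conv_bounded_linear[THEN iffD1, OF N]]
    by (intro continuous_intros) auto
  have "chart plane q L (\<lambda>z. N z + q) 1"
    unfolding chart_def
  proof (intro conjI exI)
    let ?V = "(\<lambda>x. L (x - q)) -` ball 0 1"
    show "openin (top_of_set plane) ?V" using cL[of UNIV] by (simp add: open_vimage)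
    show "q \<in> ?V" using L by (simp add: linear_0)
    show "homeomorphism ?V (ball 0 1) (\<lambda>x. L (x - q)) (\<lambda>z. N z + q)"
      using cL cN LN NL by (intro homeomorphismI) auto
  qed (use L in \<open>simp_all add: linear_conv_bounded_linear\<close>)
  moreover have "v = 0" if "L v = 0" for v
    using that NL[of v] N by (simp add: linear_0)
  ultimately show "\<exists>L S r T. chart plane q L S r \<and> subspace T \<and> (\<forall>v\<in>T. L v = 0 \<longrightarrow> v = 0) \<and>
     (\<forall>\<gamma> t v. range \<gamma> \<subseteq> plane \<and> \<gamma> t = q \<and> (\<gamma> has_vector_derivative v) (at t) \<longrightarrow> v \<in> T)"
    by (intro exI[of _ L] exI[of _ "\<lambda>z. N z + q"] exI[of _ 1] exI[of _ UNIV]) auto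
qed

text \<open>The chart is the orthogonal projection of the open hemisphere around \<open>q\<close> to
  the tangent plane at \<open>q\<close>. Velocities at \<open>q\<close> are orthogonal to
  \<open>q\<close>, as one sees by differentiating the constant squared norm.\<close>

lemma surface_S2: "surface S2"
  unfolding surface_def
proof
  fix q :: "real^3" assume "q \<in> S2"
  then have q: "norm q = 1" by simp
  \<comment> \<open>An orthogonal map that takes the third axis to \<open>q\<close> provides an
    orthonormal frame \<open>e1\<close>, \<open>e2\<close>, \<open>q\<close>.\<close>
  obtain f :: "real^3 \<Rightarrow> real^3" where f: "orthogonal_transformation f" "f (axis 3 1) = q"
    using orthogonal_transformation_exists_1[of "axis 3 1 :: real^3" q] q norm_axis_1 by metis
  define e1 e2 where "e1 = f (axis 1 1)" and "e2 = f (axis 2 1)"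
  have inner_f: "f x \<bullet> f y = x \<bullet> y" for x y using f(1) by (simp add: orthogonal_transformation_def)
  have lf: "linear f" using f(1) by (simp add: orthogonal_transformation_def)
  have on: "e1 \<bullet> e1 = 1" "e2 \<bullet> e2 = 1" "q \<bullet> q = 1" "e1 \<bullet> e2 = 0" "e1 \<bullet> q = 0" "e2 \<bullet> q = 0"
    "e2 \<bullet> e1 = 0" "q \<bullet> e1 = 0" "q \<bullet> e2 = 0"
    unfolding e1_def e2_def f(2)[symmetric] inner_f by (simp_all add: inner_axis_axis)
  have expand: "x = (x \<bullet> e1) *\<^sub>R e1 + (x \<bullet> e2) *\<^sub>R e2 + (x \<bullet> q) *\<^sub>R q" for x
  proof -
    obtain y where y: "x = f y" using orthogonal_transformation_surj[OF f(1)] by (metis surjD)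
    have "y = (y $ 1) *\<^sub>R axis 1 1 + (y $ 2) *\<^sub>R axis 2 1 + (y $ 3) *\<^sub>R axis 3 1"
      by (simp add: vec_eq_iff forall_3 axis_def)
    from arg_cong[OF this, of f] have "x = (y $ 1) *\<^sub>R e1 + (y $ 2) *\<^sub>R e2 + (y $ 3) *\<^sub>R q"
      unfolding y e1_def e2_def f(2)[symmetric] linear_add[OF lf] linear_scale[OF lf] .
    moreover have "x \<bullet> e1 = y $ 1" "x \<bullet> e2 = y $ 2" "x \<bullet> q = y $ 3"
      unfolding y e1_def e2_def f(2)[symmetric] inner_f by (simp_all add: inner_axis)
    ultimately show ?thesis by simp
  qed
  define L where "L x = Complex (x \<bullet> e1) (x \<bullet> e2)" for x
  define S where "S z = Re z *\<^sub>R e1 + Im z *\<^sub>R e2 + sqrt (1 - (norm z)\<^sup>2) *\<^sub>R q" for z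
  have L: "linear L" by (rule linearI) (auto simp: L_def complex_eq_iff inner_add_left)
  have Lq: "L (x - q) = L x" for x by (simp add: L_def inner_diff_left on)
  have cL: "continuous_on A L" for A
    using linear_continuous_on[OF linear_conv_bounded_linear[THEN iffD1, OF L]] .
  have LS: "L (S z) = z" for z
    by (simp add: L_def S_def inner_add_left on complex_eq_iff)
  have SS: "S z \<in> S2" "S z \<bullet> q > 0" if z: "z \<in> ball 0 1" for z
  proof -
    have lt: "(norm z)\<^sup>2 < 1" using z by (simp add: abs_square_less_1)
    then show "S z \<bullet> q > 0" by (simp add: S_def inner_add_left on)
    have "S z \<bullet> S z = (Re z)\<^sup>2 + (Im z)\<^sup>2 + (1 - (norm z)\<^sup>2)"
      using lt by (simp add: S_def inner_add_left inner_add_right on power2_eq_square)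
    also have "\<dots> = 1" by (simp add: cmod_power2)
    finally show "S z \<in> S2" by (simp add: norm_eq_1)
  qed
  have nL: "(norm (L x))\<^sup>2 = 1 - (x \<bullet> q)\<^sup>2" if "x \<in> S2" for x
  proof -
    have "x \<bullet> x = 1" using that by (simp add: norm_eq_1)
    moreover have "x \<bullet> x = x \<bullet> ((x \<bullet> e1) *\<^sub>R e1 + (x \<bullet> e2) *\<^sub>R e2 + (x \<bullet> q) *\<^sub>R q)"
      using expand[of x] by metis
    ultimately have "1 = (x \<bullet> e1)\<^sup>2 + (x \<bullet> e2)\<^sup>2 + (x \<bullet> q)\<^sup>2"
      by (simp add: inner_add_right power2_eq_square)
    then show ?thesis by (simp add: L_def cmod_power2)
  qed
  have SL: "S (L x) = x" if x: "x \<in> S2" "x \<bullet> q > 0" for x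
  proof -
    have "sqrt (1 - (norm (L x))\<^sup>2) = x \<bullet> q" using nL[OF x(1)] x(2) by simp
    then have "S (L x) = (x \<bullet> e1) *\<^sub>R e1 + (x \<bullet> e2) *\<^sub>R e2 + (x \<bullet> q) *\<^sub>R q"
      by (simp add: S_def L_def)
    then show ?thesis using expand[of x] by simp
  qed
  have "chart S2 q L S 1"
    unfolding chart_def Lq
  proof (intro conjI exI)
    let ?V = "S2 \<inter> {x. x \<bullet> q > 0}"
    have "open {x. x \<bullet> q > 0}" by (intro open_Collect_less continuous_intros)
    then show "openin (top_of_set S2) ?V" by (simp add: openin_open_Int)
    show "q \<in> ?V" using q on by simp
    show "homeomorphism ?V (ball 0 1) L S"
    proof (rule homeomorphismI)
      show "continuous_on (ball 0 1) S" unfolding S_def by (intro continuous_intros)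
      show "L ` ?V \<subseteq> ball 0 1"
      proof
        fix z assume "z \<in> L ` ?V"
        then obtain x where x: "x \<in> S2" "x \<bullet> q > 0" "z = L x" by blast
        then have "(norm z)\<^sup>2 < 1" using nL[OF x(1)] by simp
        then show "z \<in> ball 0 1" by (simp add: abs_square_less_1)
      qed
    qed (use cL SS SL LS in blast)+
  qed (use L in \<open>simp_all add: linear_conv_bounded_linear\<close>)
  moreover have "subspace {v. v \<bullet> q = 0}" by (simp add: subspace_def inner_add_left)
  moreover have "v = 0" if "v \<bullet> q = 0" "L v = 0" for v
    using expand[of v] that by (simp add: L_def complex_eq_iff)
  moreover have "v \<bullet> q = 0" if "range \<gamma> \<subseteq> S2" "\<gamma> t = q" "(\<gamma> has_vector_derivative v) (at t)" for \<gamma> t v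
  proof -
    have "\<gamma> s \<bullet> \<gamma> s = 1" for s using that(1) by (auto simp: norm_eq_1 subset_iff)
    then have "(\<lambda>s. \<gamma> s \<bullet> \<gamma> s) = (\<lambda>s. 1)" by auto
    moreover have "((\<lambda>s. \<gamma> s \<bullet> \<gamma> s) has_vector_derivative (\<gamma> t \<bullet> v + v \<bullet> \<gamma> t)) (at t)"
      using bounded_bilinear.has_vector_derivative[OF bounded_bilinear_inner that(3) that(3)] by simp
    ultimately have "\<gamma> t \<bullet> v + v \<bullet> \<gamma> t = 0"
      by (metis has_vector_derivative_const vector_derivative_unique_at)
    then show ?thesis using that(2) by (simp add: inner_commute)
  qed
  ultimately show "\<exists>L S r T. chart S2 q L S r \<and> subspace T \<and> (\<forall>v\<in>T. L v = 0 \<longrightarrow> v = 0) \<and>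
     (\<forall>\<gamma> t v. range \<gamma> \<subseteq> S2 \<and> \<gamma> t = q \<and> (\<gamma> has_vector_derivative v) (at t) \<longrightarrow> v \<in> T)"
    by (intro exI[of _ L] exI[of _ S] exI[of _ 1] exI[of _ "{v. v \<bullet> q = 0}"]) auto
qed

section \<open>Branches near a double point\<close>

lemma velocity_shift:
  assumes g: "generic_immersion X g" and D: "\<And>t. (g has_vector_derivative D t) (at t)"
  shows "D (t + of_int n) = D t"
proof -
  have "((\<lambda>x. x + of_int n) has_vector_derivative 1) (at t)"
    by (auto intro!: derivative_eq_intros)
  from vector_diff_chain_at[OF this D]
  have "((g \<circ> (\<lambda>x. x + of_int n)) has_vector_derivative D (t + of_int n)) (at t)" by simp
  moreover have "g \<circ> (\<lambda>x. x + of_int n) = g" using generic_shift[OF g] by auto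
  ultimately show ?thesis using D[of t] vector_derivative_unique_at by metis
qed

text \<open>The transversality clause of \<open>generic_immersion\<close> concerns
  \<open>{0..<1}\<close>; periodicity of the velocity extends it to all parameters that do not
  differ by an integer.\<close>

lemma generic_transverse:
  assumes g: "generic_immersion X g" and D: "\<And>t. (g has_vector_derivative D t) (at t)"
    and uv: "g u = g v" "\<And>n::int. v \<noteq> u + of_int n"
  shows "\<not> collinear {0, D u, D v}"
proof -
  have DD: "vector_derivative g (at (frac t)) = D t" for t
    using vector_derivative_at[OF D[of "frac t"]] velocity_shift[OF g D, of "frac t" "\<lfloor>t\<rfloor>"]
    by (simp add: frac_def)
  have "frac u \<noteq> frac v"
  proof
    assume "frac u = frac v"
    then have "v = u + of_int (\<lfloor>v\<rfloor> - \<lfloor>u\<rfloor>)" by (simp add: frac_def)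
    then show False using uv(2) by blast
  qed
  moreover have "frac u \<in> {0..<1}" "frac v \<in> {0..<1}" by (auto simp: frac_lt_1)
  moreover have "g (frac u) = g (frac v)" using generic_frac[OF g] uv(1) by simp
  ultimately show ?thesis
    using g unfolding generic_immersion_def DD[symmetric] by blast
qed

lemma double_point_preimage:
  assumes "generic_immersion X g" "q \<in> double_points g"
  shows "\<exists>s t. \<forall>u. g u = q \<longleftrightarrow> (\<exists>n::int. u = s + of_int n \<or> u = t + of_int n)"
proof (rule double_point_params[OF assms])
  fix s t assume "\<And>u. g u = q \<longleftrightarrow> (\<exists>n::int. u = s + of_int n \<or> u = t + of_int n)"
  then show ?thesis by blast
qed

lemma two_params:
  assumes g: "generic_immersion X g" and uv: "g u = q" "g v = q" "\<And>n::int. v \<noteq> u + of_int n"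
    and w: "g w = q"
  shows "\<exists>n::int. w = u + of_int n \<or> w = v + of_int n"
proof -
  have "frac u \<noteq> frac v"
  proof
    assume "frac u = frac v"
    then have "v = u + of_int (\<lfloor>v\<rfloor> - \<lfloor>u\<rfloor>)" by (simp add: frac_def)
    then show False using uv(3) by blast
  qed
  moreover have "frac u \<in> {0..<1}" "frac v \<in> {0..<1}" by (auto simp: frac_lt_1)
  moreover have "g (frac u) = q" "g (frac v) = q" using generic_frac[OF g] uv by simp_all
  ultimately have "q \<in> double_points g" unfolding double_points_def by blast
  then obtain s t where st: "\<And>u. g u = q \<longleftrightarrow> (\<exists>n::int. u = s + of_int n \<or> u = t + of_int n)"
    using double_point_preimage[OF g] by blast
  obtain a b c :: int where abc: "u = s + of_int a \<or> u = t + of_int a"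
    "v = s + of_int b \<or> v = t + of_int b" "w = s + of_int c \<or> w = t + of_int c"
    using uv(1,2) w st by metis
  have "v \<noteq> u + of_int (b - a)" using uv(3) .
  then have "w = u + of_int (c - a) \<or> w = v + of_int (c - b)"
    using abc by auto
  then show ?thesis by blast
qed

lemma curve_openin:
  assumes g: "generic_immersion X g" and A: "openin (top_of_set X) A" "g u \<in> A"
  shows "\<exists>e>0. \<forall>w. \<bar>w - u\<bar> < e \<longrightarrow> g w \<in> A"
proof -
  obtain T where T: "open T" "A = X \<inter> T" using A(1) by (auto simp: openin_open)
  have "isCont g u" by (rule generic_isCont[OF g])
  then have "\<forall>\<^sub>F w in at u. g w \<in> T" using T A(2) by (auto simp: isCont_def intro: topological_tendstoD)
  then obtain e where e: "e > 0" "\<And>w. w \<noteq> u \<Longrightarrow> \<bar>w - u\<bar> < e \<Longrightarrow> g w \<in> T"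
    unfolding eventually_at by (auto simp: dist_real_def)
  have "g w \<in> A" if "\<bar>w - u\<bar> < e" for w
    using e(2)[of w] that A(2) T(2) generic_range[OF g, of w] by (cases "w = u") auto
  then show ?thesis using e(1) by blast
qed

lemma in_nearE:
  assumes "in_near g K u"
  obtains e where "e > 0" "\<And>w. w \<noteq> u \<Longrightarrow> \<bar>w - u\<bar> < e \<Longrightarrow> g w \<in> K"
  using assms unfolding in_near_def eventually_at by (auto simp: dist_real_def)

text \<open>All parameters of \<open>q\<close> are integer translates of \<open>u\<close> and
  \<open>v\<close>, so by periodicity a nearby point has a parameter close to \<open>u\<close> or
  \<open>v\<close> itself.\<close>

lemma curve_near_crossing:
  assumes g: "generic_immersion X g" and q: "g u = q" and "0 < \<delta>"
    and all: "\<And>w. g w = q \<Longrightarrow> \<exists>n::int. w = u + of_int n \<or> w = v + of_int n"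
  shows "\<exists>U. openin (top_of_set X) U \<and> q \<in> U \<and>
     (\<forall>r\<in>U \<inter> range g. \<exists>w. r = g w \<and> (\<bar>w - u\<bar> < \<delta> \<or> \<bar>w - v\<bar> < \<delta>))"
proof -
  define Q where "Q = (\<Union>n::int. ball (u + of_int n) \<delta> \<union> ball (v + of_int n) \<delta>)"
  have "open Q" unfolding Q_def by blast
  moreover have "w \<in> Q" if gw: "g w = q" for w
  proof -
    obtain n :: int where "w = u + of_int n \<or> w = v + of_int n" using all[OF gw] by blast
    then show ?thesis using \<open>0 < \<delta>\<close> unfolding Q_def by (intro UN_I[of n]) auto
  qed
  moreover have "q \<in> X" using generic_range[OF g] q by blast
  ultimately obtain U where U: "openin (top_of_set X) U" "q \<in> U" "\<forall>r\<in>U \<inter> range g. \<exists>v\<in>Q. r = g v"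
    using curve_near_point[OF g, of q Q] by metis
  have "\<exists>w. r = g w \<and> (\<bar>w - u\<bar> < \<delta> \<or> \<bar>w - v\<bar> < \<delta>)" if r: "r \<in> U \<inter> range g" for r
  proof -
    obtain w where "w \<in> Q" "r = g w" using U(3) r by blast
    then obtain n :: int where n: "dist (u + of_int n) w < \<delta> \<or> dist (v + of_int n) w < \<delta>"
      unfolding Q_def by auto
    have "r = g (w + of_int (- n))" using generic_shift[OF g] \<open>r = g w\<close> by metis
    moreover have "\<bar>(w + of_int (- n)) - u\<bar> < \<delta> \<or> \<bar>(w + of_int (- n)) - v\<bar> < \<delta>"
      using n by (auto simp: dist_real_def abs_minus_commute algebra_simps)
    ultimately show ?thesis by blast
  qed
  then show ?thesis using U(1,2) by blast
qed

text \<open>In a chart at the crossing the branch \<open>K\<close> is the graph of a function; the two sides are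
  the points above and below the graph.\<close>

lemma branch_splits:
  assumes X: "surface X" and g: "generic_immersion X g" and u: "g u = q" and v: "g v = q"
    and Ku: "in_near g K u" and Kv: "in_near g (- K) v" and K: "q \<in> K" "K \<subseteq> range g"
  shows "splits X (range g) K q"
proof -
  obtain D where D: "\<And>t. (g has_vector_derivative D t) (at t)" "continuous_on UNIV D" "\<And>t. D t \<noteq> 0"
    using generic_velocity[OF g] by metis
  \<comment> \<open>If \<open>v\<close> were an integer translate of \<open>u\<close>, the same germ
    would lie in \<open>K\<close> and in its complement.\<close>
  have uv: "v \<noteq> u + of_int n" for n :: int
    using Ku Kv in_near_shift[OF g] in_near_not_both by metis
  have "\<not> collinear {0, D u, D v}" using generic_transverse[OF g D(1)] u v uv by simp
  from generic_chart(2)[OF X g u D(1,3) v this] obtain L S r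
    where c: "chart X q L S r" and Lu: "L (D u) = 1" and Lv: "L (D v) = \<i>" by blast
  define \<gamma> where "\<gamma> t = L (g t - q)" for t
  have \<gamma>': "(\<gamma> has_vector_derivative L (D t)) (at t)" for t
    unfolding \<gamma>_def by (rule chart_curve_derivative[OF c D(1)])
  have L: "bounded_linear L" using c by (simp add: chart_def)
  have \<gamma>0: "\<gamma> u = 0" "\<gamma> v = 0" using u v L by (simp_all add: \<gamma>_def bounded_linear.linear linear_0)
  have c\<gamma>: "continuous_on A \<gamma>" for A
    using \<gamma>' by (meson continuous_at_imp_continuous_on has_vector_derivative_continuous)
  define V where "V = S ` ball 0 r"
  have V: "openin (top_of_set X) V" "q \<in> V" unfolding V_def using chart_image[OF c] by auto
  obtain d1 where d1: "d1 > 0" "\<And>w. u < w \<Longrightarrow> w < u + d1 \<Longrightarrow> \<gamma> w \<in> sector 1"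
    "\<And>w. u - d1 < w \<Longrightarrow> w < u \<Longrightarrow> \<gamma> w \<in> sector (- 1)"
    using curve_in_sector[OF \<gamma>'[of u] \<gamma>0(1)] Lu by auto
  obtain d2 where d2: "d2 > 0" "\<And>w. v < w \<Longrightarrow> w < v + d2 \<Longrightarrow> \<gamma> w \<in> sector \<i>"
    "\<And>w. v - d2 < w \<Longrightarrow> w < v \<Longrightarrow> \<gamma> w \<in> sector (- \<i>)"
    using curve_in_sector[OF \<gamma>'[of v] \<gamma>0(2)] Lv by auto
  obtain d3 where d3: "d3 > 0" "\<And>w. w \<noteq> u \<Longrightarrow> \<bar>w - u\<bar> < d3 \<Longrightarrow> g w \<in> K" using in_nearE[OF Ku] by metis
  obtain d4 where d4: "d4 > 0" "\<And>w. w \<noteq> v \<Longrightarrow> \<bar>w - v\<bar> < d4 \<Longrightarrow> g w \<in> - K" using in_nearE[OF Kv] by metis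
  obtain d5 where d5: "d5 > 0" "\<And>w. \<bar>w - u\<bar> < d5 \<Longrightarrow> g w \<in> V"
    using curve_openin[OF g V(1), of u] V(2) u by auto
  obtain d6 where d6: "d6 > 0" "\<And>w. \<bar>w - u\<bar> < d6 \<Longrightarrow> 0 < Re (L (D w))"
  proof -
    have "continuous_on UNIV (\<lambda>t. Re (L (D t)))"
      by (intro continuous_on_Re continuous_on_compose2[OF linear_continuous_on[OF L, of UNIV] D(2)]) auto
    then have "isCont (\<lambda>t. Re (L (D t))) u" by (simp add: continuous_on_eq_continuous_at)
    then obtain s where "s > 0" "\<And>w. dist w u < s \<Longrightarrow> dist (Re (L (D w))) (Re (L (D u))) < 1"
      unfolding continuous_at_eps_delta by (meson zero_less_one)
    then show ?thesis using that[of s] Lu by (force simp: dist_real_def)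
  qed
  \<comment> \<open>Halving makes the closed interval \<open>I\<close> satisfy all six open
    conditions.\<close>
  define \<delta> where "\<delta> = min d1 (min d2 (min d3 (min d4 (min d5 d6)))) / 2"
  have pos: "0 < \<delta>" using d1(1) d2(1) d3(1) d4(1) d5(1) d6(1) by (simp add: \<delta>_def)
  have "2 * \<delta> \<le> d1" "2 * \<delta> \<le> d2" "2 * \<delta> \<le> d3" "2 * \<delta> \<le> d4" "2 * \<delta> \<le> d5" "2 * \<delta> \<le> d6"
    by (simp_all add: \<delta>_def min_le_iff_disj)
  then have lt: "\<delta> < d1" "\<delta> < d2" "\<delta> < d3" "\<delta> < d4" "\<delta> < d5" "\<delta> < d6" using pos by linarith+
  define I where "I = {u - \<delta>..u + \<delta>}"
  have I: "w \<in> I \<longleftrightarrow> \<bar>w - u\<bar> \<le> \<delta>" for w by (auto simp: I_def)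
  define \<phi> where "\<phi> w = Re (\<gamma> w)" for w
  have c\<phi>: "continuous_on A \<phi>" for A unfolding \<phi>_def by (intro continuous_intros c\<gamma>)
  \<comment> \<open>The real part has derivative 1 at \<open>u\<close> and positive derivative
    nearby, so the branch is a graph over the real axis.\<close>
  have inc: "\<phi> x < \<phi> y" if "x \<in> I" "y \<in> I" "x < y" for x y
  proof (rule DERIV_pos_imp_increasing[OF that(3)])
    fix w assume "x \<le> w" "w \<le> y"
    then have "\<bar>w - u\<bar> < d6" using that lt(6) I_def by auto
    moreover have "(\<phi> has_real_derivative Re (L (D w))) (at w)"
      unfolding \<phi>_def has_real_derivative_iff_has_vector_derivative
      by (rule bounded_linear.has_vector_derivative[OF bounded_linear_Re \<gamma>'])
    ultimately show "\<exists>y. (\<phi> has_real_derivative y) (at w) \<and> 0 < y" using d6(2) by blast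
  qed
  have inj: "inj_on \<phi> I" by (rule linorder_inj_onI') (use inc in \<open>metis less_irrefl\<close>)
  define \<psi> where "\<psi> = inv_into I \<phi>"
  have \<psi>: "\<psi> (\<phi> w) = w" if "w \<in> I" for w unfolding \<psi>_def using inj that by (rule inv_into_f_f)
  have \<phi>\<psi>: "\<psi> x \<in> I" "\<phi> (\<psi> x) = x" if "x \<in> \<phi> ` I" for x
    using that unfolding \<psi>_def by (auto intro: inv_into_into f_inv_into_f)
  have c\<psi>: "continuous_on (\<phi> ` I) \<psi>"
    by (rule continuous_on_inv[OF c\<phi>]) (auto simp: \<psi> I_def)
  define f where "f x = Im (\<gamma> (\<psi> x))" for x
  have cf: "continuous_on (\<phi> ` I) f"
    unfolding f_def by (intro continuous_intros continuous_on_compose2[OF c\<gamma>[of UNIV] c\<psi>]) auto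
  have f_small: "\<bar>f x\<bar> \<le> \<bar>x\<bar>" if "x \<in> \<phi> ` I" for x
  proof -
    obtain w where w: "w \<in> I" "x = \<phi> w" using \<open>x \<in> \<phi> ` I\<close> by blast
    then have fx: "f x = Im (\<gamma> w)" by (simp add: f_def \<psi>)
    consider "w = u" | "u < w" "w < u + d1" | "w < u" "u - d1 < w" using w(1) lt(1) I_def by fastforce
    then show ?thesis
    proof cases
      case 1 then show ?thesis using \<gamma>0 fx by simp
    next
      case 2 then show ?thesis using d1(2)[of w] fx w(2) by (simp add: in_sector_iff \<phi>_def)
    next
      case 3 then show ?thesis using d1(3)[of w] fx w(2) by (simp add: in_sector_iff \<phi>_def)
    qed
  qed
  \<comment> \<open>By the intermediate value theorem the branch over \<open>I\<close> covers every
    abscissa of absolute value below \<open>\<rho>\<close>.\<close>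
  define \<rho> where "\<rho> = min (- \<phi> (u - \<delta>)) (\<phi> (u + \<delta>))"
  have "\<phi> u = 0" using \<gamma>0 by (simp add: \<phi>_def)
  then have \<rho>: "\<rho> > 0" using inc[of "u - \<delta>" u] inc[of u "u + \<delta>"] pos by (simp add: \<rho>_def I_def)
  have rI: "x \<in> \<phi> ` I" if "\<bar>x\<bar> < \<rho>" for x
  proof -
    have "\<phi> (u - \<delta>) \<le> x" "x \<le> \<phi> (u + \<delta>)" using that by (auto simp: \<rho>_def)
    then obtain w where "u - \<delta> \<le> w" "w \<le> u + \<delta>" "\<phi> w = x"
      using IVT'[of \<phi> "u - \<delta>" x "u + \<delta>"] c\<phi> pos by auto
    then show ?thesis by (auto simp: I_def)
  qed
  obtain U1 where U1: "openin (top_of_set X) U1" "q \<in> U1"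
    "\<And>r. r \<in> U1 \<inter> range g \<Longrightarrow> \<exists>w. r = g w \<and> (\<bar>w - u\<bar> < \<delta> \<or> \<bar>w - v\<bar> < \<delta>)"
    using curve_near_crossing[OF g u pos two_params[OF g u v uv]] by blast
  obtain e1 where e1: "0 < e1" "e1 \<le> r" "\<And>z. z \<in> ball 0 e1 \<Longrightarrow> S z \<in> U1"
    using chart_small[OF c U1(1,2)] by metis
  define e where "e = min e1 \<rho>"
  have e: "0 < e" "ball 0 e \<subseteq> ball 0 r" "ball 0 e \<subseteq> ball (0::complex) e1" using e1 \<rho> by (auto simp: e_def)
  have Re_I: "Re z \<in> \<phi> ` I" if "z \<in> ball 0 e" for z
    using rI[of "Re z"] that abs_Re_le_cmod[of z] by (auto simp: e_def)
  have S\<gamma>: "S (\<gamma> w) = g w" "\<gamma> w \<in> ball 0 r" if "g w \<in> V" for w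
    using chart_right[OF c] that by (simp_all add: V_def \<gamma>_def)
  have \<gamma>S: "\<gamma> w = z" if "g w = S z" "z \<in> ball 0 e" for w z
    using chart_left[OF c subsetD[OF e(2) that(2)]] that(1) by (simp add: \<gamma>_def)
  have K_iff: "S z \<in> K \<longleftrightarrow> Im z = f (Re z)" if z: "z \<in> ball 0 e" for z
  proof
    assume SK: "S z \<in> K"
    have "S z \<in> U1" using e1(3) z e(3) by blast
    then obtain w where w: "S z = g w" "\<bar>w - u\<bar> < \<delta> \<or> \<bar>w - v\<bar> < \<delta>"
      using U1(3)[of "S z"] SK K(2) by blast
    have zw: "\<gamma> w = z" using \<gamma>S[of w z] w(1) z by simp
    from w(2) show "Im z = f (Re z)"
    proof
      assume "\<bar>w - u\<bar> < \<delta>"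
      then have "w \<in> I" by (simp add: I)
      then show ?thesis using \<psi>[of w] zw by (simp add: f_def \<phi>_def)
    next
      assume "\<bar>w - v\<bar> < \<delta>"
      \<comment> \<open>Close to \<open>v\<close> the second branch meets \<open>K\<close> at most
        at the crossing itself.\<close>
      then have "w = v" using d4(2)[of w] SK w(1) lt(4) by fastforce
      then have "z = 0" using zw \<gamma>0 by simp
      moreover have "\<psi> 0 = u" using \<psi>[of u] \<open>\<phi> u = 0\<close> pos by (simp add: I)
      ultimately show ?thesis using \<gamma>0 by (simp add: f_def)
    qed
  next
    assume Imz: "Im z = f (Re z)"
    define w where "w = \<psi> (Re z)"
    have w: "w \<in> I" "\<phi> w = Re z" using \<phi>\<psi>[OF Re_I[OF z]] by (auto simp: w_def)
    have "Im (\<gamma> w) = Im z" using Imz by (simp add: f_def w_def)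
    then have "\<gamma> w = z" using w(2) by (simp add: \<phi>_def complex_eq_iff)
    moreover have "g w \<in> V" using d5(2) w(1) lt(5) by (auto simp: I)
    ultimately have "S z = g w" using S\<gamma>(1) by metis
    moreover have "g w \<in> K"
      using d3(2)[of w] w(1) lt(3) u K(1) by (cases "w = u") (auto simp: I)
    ultimately show "S z \<in> K" by simp
  qed
  define A0 B0 where "A0 = {z\<in>ball 0 e. 0 < Im z - f (Re z)}" and "B0 = {z\<in>ball 0 e. Im z - f (Re z) < 0}"
  have cont: "continuous_on (ball 0 e) (\<lambda>z. Im z - f (Re z))"
    using Re_I by (intro continuous_intros continuous_on_compose2[OF cf]) auto
  have "open A0" "open B0"
  proof -
    have "open (ball 0 e \<inter> (\<lambda>z. Im z - f (Re z)) -` {0<..})"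
      by (rule continuous_open_preimage[OF cont]) auto
    moreover have "A0 = ball 0 e \<inter> (\<lambda>z. Im z - f (Re z)) -` {0<..}" by (auto simp: A0_def)
    ultimately show "open A0" by simp
    have "open (ball 0 e \<inter> (\<lambda>z. Im z - f (Re z)) -` {..<0})"
      by (rule continuous_open_preimage[OF cont]) auto
    moreover have "B0 = ball 0 e \<inter> (\<lambda>z. Im z - f (Re z)) -` {..<0}" by (auto simp: B0_def)
    ultimately show "open B0" by simp
  qed
  have sub: "A0 \<subseteq> ball 0 e" "B0 \<subseteq> ball 0 e" by (auto simp: A0_def B0_def)
  have opens: "openin (top_of_set X) (S ` A0)" "openin (top_of_set X) (S ` B0)"
    "openin (top_of_set X) (S ` ball 0 e)"
    using chart_openin_image[OF c] \<open>open A0\<close> \<open>open B0\<close> sub e(2) by (meson open_ball subset_trans)+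
  have near_v: "\<exists>\<eta>>0. \<eta> < \<delta> \<and> (\<forall>w. \<bar>w - v\<bar> \<le> \<eta> \<longrightarrow> g w \<in> W \<and> \<gamma> w \<in> ball 0 e \<and> S (\<gamma> w) = g w)"
    if W: "openin (top_of_set X) W" "q \<in> W" for W
  proof -
    have "q \<in> S ` ball 0 e" using chart_zero[OF c] e(1) by (metis centre_in_ball imageI)
    then have "openin (top_of_set X) (W \<inter> S ` ball 0 e)" "g v \<in> W \<inter> S ` ball 0 e"
      using W v opens(3) by auto
    from curve_openin[OF g this] obtain \<epsilon> where \<epsilon>: "\<epsilon> > 0" "\<And>w. \<bar>w - v\<bar> < \<epsilon> \<Longrightarrow> g w \<in> W \<inter> S ` ball 0 e"
      by blast
    have "g w \<in> W \<and> \<gamma> w \<in> ball 0 e \<and> S (\<gamma> w) = g w" if close: "\<bar>w - v\<bar> < \<epsilon>" for w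
    proof -
      obtain z where "z \<in> ball 0 e" "g w = S z" using \<epsilon>(2)[OF close] by blast
      then show ?thesis using \<gamma>S[of w z] \<epsilon>(2)[OF close] by auto
    qed
    then show ?thesis using \<epsilon>(1) pos by (intro exI[of _ "min \<epsilon> \<delta> / 2"]) auto
  qed
  have "accumulates X (S ` A0 \<inter> range g) q"
    unfolding accumulates_def
  proof (intro allI impI)
    fix W assume "openin (top_of_set X) W \<and> q \<in> W"
    then obtain \<eta> where \<eta>: "\<eta> > 0" "\<eta> < \<delta>"
      "\<And>w. \<bar>w - v\<bar> \<le> \<eta> \<Longrightarrow> g w \<in> W \<and> \<gamma> w \<in> ball 0 e \<and> S (\<gamma> w) = g w" using near_v by blast
    have *: "g (v + \<eta>) \<in> W" "\<gamma> (v + \<eta>) \<in> ball 0 e" "S (\<gamma> (v + \<eta>)) = g (v + \<eta>)" using \<eta>(3)[of "v + \<eta>"] \<eta>(1) by auto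
    have "\<bar>Re (\<gamma> (v + \<eta>))\<bar> < Im (\<gamma> (v + \<eta>))"
      using d2(2)[of "v + \<eta>"] \<eta>(1,2) lt(2) by (simp add: in_sector_iff)
    \<comment> \<open>The second branch runs into the upper sector, where the ordinate exceeds the
      absolute value of the abscissa, while the graph is bounded by that absolute value; hence the
      point is above the graph.\<close>
    then have "\<gamma> (v + \<eta>) \<in> A0" using f_small[OF Re_I[OF *(2)]] *(2) by (simp add: A0_def)
    then have "g (v + \<eta>) \<in> S ` A0" using *(3) by (metis imageI)
    then show "W \<inter> (S ` A0 \<inter> range g) \<noteq> {}" using *(1) by blast
  qed
  moreover have "accumulates X (S ` B0 \<inter> range g) q"
    unfolding accumulates_def
  proof (intro allI impI)
    fix W assume "openin (top_of_set X) W \<and> q \<in> W"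
    then obtain \<eta> where \<eta>: "\<eta> > 0" "\<eta> < \<delta>"
      "\<And>w. \<bar>w - v\<bar> \<le> \<eta> \<Longrightarrow> g w \<in> W \<and> \<gamma> w \<in> ball 0 e \<and> S (\<gamma> w) = g w" using near_v by blast
    have *: "g (v - \<eta>) \<in> W" "\<gamma> (v - \<eta>) \<in> ball 0 e" "S (\<gamma> (v - \<eta>)) = g (v - \<eta>)" using \<eta>(3)[of "v - \<eta>"] \<eta>(1) by auto
    have "\<bar>Re (\<gamma> (v - \<eta>))\<bar> < - Im (\<gamma> (v - \<eta>))"
      using d2(3)[of "v - \<eta>"] \<eta>(1,2) lt(2) by (simp add: in_sector_iff)
    then have "\<gamma> (v - \<eta>) \<in> B0" using f_small[OF Re_I[OF *(2)]] *(2) by (simp add: B0_def)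
    then have "g (v - \<eta>) \<in> S ` B0" using *(3) by (metis imageI)
    then show "W \<inter> (S ` B0 \<inter> range g) \<noteq> {}" using *(1) by blast
  qed
  moreover have "S ` A0 \<inter> S ` B0 = {}"
  proof (rule ccontr)
    assume "S ` A0 \<inter> S ` B0 \<noteq> {}"
    then obtain a b where ab: "a \<in> A0" "b \<in> B0" "S a = S b" by blast
    then have "a = b" using chart_inj[OF c] sub e(2) by (metis subsetD)
    then show False using ab by (simp add: A0_def B0_def)
  qed
  moreover have "S ` ball 0 e - K = S ` A0 \<union> S ` B0"
  proof -
    have "S ` ball 0 e - K = S ` {z\<in>ball 0 e. S z \<notin> K}" by blast
    also have "{z\<in>ball 0 e. S z \<notin> K} = A0 \<union> B0" using K_iff by (auto simp: A0_def B0_def)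
    finally show ?thesis by (simp add: image_Un)
  qed
  moreover have "q \<in> S ` ball 0 e" using chart_zero[OF c] e(1) by (metis centre_in_ball imageI)
  moreover note opens K(1)
  ultimately show ?thesis
    unfolding splits_def by (intro exI[of _ "S ` A0"] exI[of _ "S ` B0"] exI[of _ "S ` ball 0 e"] conjI)
qed

section \<open>Splitting forces opposite arms\<close>

lemma eventually_constant_interval:
  fixes g :: "real \<Rightarrow> 'a"
  assumes "\<And>v. a < v \<Longrightarrow> v < b \<Longrightarrow> (\<forall>\<^sub>F x in nhds v. g x \<in> K) \<or> (\<forall>\<^sub>F x in nhds v. g x \<notin> K)"
  shows "(\<forall>v\<in>{a<..<b}. g v \<in> K) \<or> (\<forall>v\<in>{a<..<b}. g v \<notin> K)"
proof -
  have op: "\<exists>e>0. \<forall>w. \<bar>w - v\<bar> < e \<longrightarrow> (\<forall>\<^sub>F x in nhds w. P x)" if "\<forall>\<^sub>F x in nhds v. P x"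
    for P and v :: real
  proof -
    have "\<forall>\<^sub>F w in nhds v. \<forall>\<^sub>F x in nhds w. P x" using that by (simp add: eventually_eventually)
    then show ?thesis unfolding eventually_nhds_metric by (auto simp: dist_real_def)
  qed
  have "(\<forall>v\<in>{a<..<b}. \<forall>\<^sub>F x in nhds v. g x \<in> K) \<or> (\<forall>v\<in>{a<..<b}. \<forall>\<^sub>F x in nhds v. g x \<notin> K)"
    using assms
  proof (rule interval_alternative)
    fix v assume "\<forall>\<^sub>F x in nhds v. g x \<in> K" "\<forall>\<^sub>F x in nhds v. g x \<notin> K"
    then show False by (auto dest!: eventually_nhds_x_imp_x)
  qed (assumption | (rule op, assumption))+
  then show ?thesis using eventually_nhds_x_imp_x by blast
qed

text \<open>\<open>J d\<close> is the parameter interval of the arm in direction \<open>d\<close>,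
  and is empty if there is no such arm. On either side of \<open>K\<close> the curve reaches
  \<open>q\<close> along an arm that misses \<open>K\<close>. By \<open>opposite_sectors\<close>
  these two arms are opposite and the two remaining sectors are met by \<open>K\<close>; since
  membership in \<open>K\<close> is constant along an arm, those arms lie in
  \<open>K\<close>.\<close>

lemma splits_arms:
  assumes c: "chart X q L S r" and P: "K \<subseteq> P" and s: "splits X P K q"
    and J_sector: "\<And>d v. d \<in> directions \<Longrightarrow> v \<in> J d \<Longrightarrow> L (g v - q) \<in> sector d"
    and J_const: "\<And>d. d \<in> directions \<Longrightarrow> (\<forall>v\<in>J d. g v \<in> K) \<or> (\<forall>v\<in>J d. g v \<notin> K)"
    and U1: "openin (top_of_set X) U1" "q \<in> U1"
    and J_cover: "\<And>r. r \<in> U1 \<inter> P \<Longrightarrow> r \<noteq> q \<Longrightarrow> \<exists>d\<in>directions. \<exists>v\<in>J d. r = g v"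
  shows "\<exists>d\<in>directions. (\<forall>v\<in>J d. g v \<notin> K) \<and> (\<forall>v\<in>J (- d). g v \<notin> K) \<and>
     (\<forall>v\<in>J (\<i> * d). g v \<in> K) \<and> (\<forall>v\<in>J (- (\<i> * d)). g v \<in> K)"
proof -
  obtain A B U where AU: "q \<in> K" "openin (top_of_set X) A" "openin (top_of_set X) B"
    "openin (top_of_set X) U" "A \<inter> B = {}" "q \<in> U" "U - K = A \<union> B"
    and acc: "accumulates X (A \<inter> P) q" "accumulates X (B \<inter> P) q"
    using s unfolding splits_def by (elim exE conjE)
  have UU: "openin (top_of_set X) (U \<inter> U1)" "q \<in> U \<inter> U1" using AU(4,6) U1 by auto
  obtain e where e: "0 < e" "e \<le> r" "\<And>z. z \<in> ball 0 e \<Longrightarrow> S z \<in> U \<inter> U1"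
    using chart_small[OF c UU] by metis
  have er: "ball 0 e \<subseteq> ball (0::complex) r" using e(2) by auto
  have L0: "L 0 = 0" using c by (simp add: chart_def bounded_linear.linear linear_0)
  define E where "E = {z\<in>ball 0 e. S z \<in> K}"
  define A0 B0 where "A0 = {z\<in>ball 0 r. S z \<in> A}" and "B0 = {z\<in>ball 0 r. S z \<in> B}"
  have LS: "L (S z - q) = z" if "z \<in> ball 0 e" for z using chart_left[OF c subsetD[OF er that]] .
  have arm: "\<exists>d\<in>directions. \<exists>v\<in>J d. S z = g v \<and> z \<in> sector d"
    if z: "z \<in> ball 0 e" "S z \<in> P" "S z \<noteq> q" for z
  proof -
    obtain d v where dv: "d \<in> directions" "v \<in> J d" "S z = g v" using J_cover[of "S z"] e(3)[OF z(1)] z by blast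
    have "z \<in> sector d" using J_sector[OF dv(1,2)] LS[OF z(1)] dv(3) by simp
    then show ?thesis using dv by blast
  qed
  interpret planar_separation e E A0 B0
  proof
    show "E \<subseteq> insert 0 (\<Union>d\<in>directions. sector d)"
    proof
      fix z assume z: "z \<in> E"
      show "z \<in> insert 0 (\<Union>d\<in>directions. sector d)"
      proof (cases "S z = q")
        case True
        then show ?thesis using LS[of z] z L0 by (simp add: E_def)
      next
        case False
        then obtain d where "d \<in> directions" "z \<in> sector d" using arm[of z] z P by (auto simp only: E_def mem_Collect_eq subset_iff)
        then show ?thesis by blast
      qed
    qed
    show "open A0" "open B0" unfolding A0_def B0_def using chart_open_vimage[OF c] AU(2,3) by blast+
    show "A0 \<inter> B0 = {}" using AU(5) by (auto simp: A0_def B0_def)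
    show "ball 0 e - E \<subseteq> A0 \<union> B0"
    proof
      fix z assume z: "z \<in> ball 0 e - E"
      then have "S z \<in> U - K" using e(3)[of z] by (simp add: E_def)
      then show "z \<in> A0 \<union> B0" using AU(7) z er unfolding A0_def B0_def by blast
    qed
  qed (rule e(1))
  have outI: "E \<inter> sector d = {}" if d: "d \<in> directions" "\<forall>v\<in>J d. g v \<notin> K" for d
  proof (rule ccontr)
    assume "E \<inter> sector d \<noteq> {}"
    then obtain z where z: "z \<in> ball 0 e" "S z \<in> K" "z \<in> sector d" by (auto simp: E_def)
    have "z \<noteq> 0" using z(3) by (auto simp: in_sector_iff)
    then have "S z \<noteq> q" using LS[OF z(1)] L0 by auto
    then obtain d' v where dv: "d' \<in> directions" "v \<in> J d'" "S z = g v" "z \<in> sector d'"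
      using arm[OF z(1)] z(2) P by blast
    then have "d' = d" using sectors_disjoint[OF d(1) dv(1) z(3)] by simp
    then show False using d(2) dv(2,3) z(2) by metis
  qed
  have side: "\<exists>d\<in>directions. (\<forall>v\<in>J d. g v \<notin> K) \<and> sector d \<inter> ball 0 e \<inter> {z\<in>ball 0 r. S z \<in> C} \<noteq> {}"
    if C: "C \<inter> K = {}" "accumulates X (C \<inter> P) q" for C
  proof -
    have "openin (top_of_set X) (S ` ball 0 e)" using chart_openin_image[OF c open_ball er] .
    moreover have "q \<in> S ` ball 0 e" using chart_zero[OF c] e(1) by (metis centre_in_ball imageI)
    ultimately obtain z where z: "z \<in> ball 0 e" "S z \<in> C" "S z \<in> P"
      using C(2) unfolding accumulates_def by blast
    then have "S z \<notin> K" using C(1) by blast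
    then have "S z \<noteq> q" using AU(1) by blast
    then obtain d v where dv: "d \<in> directions" "v \<in> J d" "S z = g v" "z \<in> sector d"
      using arm[OF z(1,3)] by blast
    then have "\<forall>v\<in>J d. g v \<notin> K" using J_const[OF dv(1)] \<open>S z \<notin> K\<close> by metis
    moreover have "z \<in> sector d \<inter> ball 0 e \<inter> {z\<in>ball 0 r. S z \<in> C}" using dv(4) z er by blast
    ultimately show ?thesis using dv(1) by blast
  qed
  have "A \<inter> K = {}" "B \<inter> K = {}" using AU(7) by blast+
  then obtain a b where a: "a \<in> directions" "\<forall>v\<in>J a. g v \<notin> K" "sector a \<inter> ball 0 e \<inter> A0 \<noteq> {}"
    and b: "b \<in> directions" "\<forall>v\<in>J b. g v \<notin> K" "sector b \<inter> ball 0 e \<inter> B0 \<noteq> {}"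
    using side[OF _ acc(1)] side[OF _ acc(2)] unfolding A0_def B0_def by meson
  from opposite_sectors[OF a(1) outI[OF a(1,2)] a(3) b(1) outI[OF b(1,2)] b(3)]
  have opp: "b = - a" "E \<inter> sector (\<i> * a) \<noteq> {}" "E \<inter> sector (- (\<i> * a)) \<noteq> {}" by auto
  have ia: "\<i> * a \<in> directions" "- (\<i> * a) \<in> directions" using a(1) by auto
  have "\<forall>v\<in>J (\<i> * a). g v \<in> K" using J_const[OF ia(1)] outI[OF ia(1)] opp(2) by blast
  moreover have "\<forall>v\<in>J (- (\<i> * a)). g v \<in> K" using J_const[OF ia(2)] outI[OF ia(2)] opp(3) by blast
  ultimately show ?thesis using a(1,2) b(2) opp(1) by blast
qed

text \<open>The point where a turn from one branch into the other is excluded. The hypothesis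
  \<open>loc\<close> makes membership in \<open>K\<close> constant along each arm, and
  \<open>splits_arms\<close> gives opposite arms the same status. The arms just before and just
  after \<open>u\<close> are opposite, because the velocity at \<open>u\<close> does not
  vanish.\<close>

lemma splits_in_near:
  assumes X: "surface X" and g: "generic_immersion X g" and s: "splits X (range g) K q"
    and K: "K \<subseteq> range g"
    and loc: "\<And>w. g w = q \<Longrightarrow> \<forall>\<^sub>F v in at w. (\<forall>\<^sub>F x in nhds v. g x \<in> K) \<or> (\<forall>\<^sub>F x in nhds v. g x \<notin> K)"
    and u: "g u = q"
  shows "in_near g K u \<or> in_near g (- K) u"
proof -
  obtain D where D: "\<And>t. (g has_vector_derivative D t) (at t)" "\<And>t. D t \<noteq> 0"
    using generic_velocity[OF g] by metis
  define two where "two v \<longleftrightarrow> g v = q \<and> (\<forall>n::int. v \<noteq> u + of_int n)" for v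
  \<comment> \<open>A second parameter of \<open>q\<close> modulo integers, if there is one;
    otherwise \<open>v\<close> is \<open>u\<close> and the arms in the directions
    \<open>\<i>\<close> and \<open>- \<i>\<close> are empty.\<close>
  define v where "v = (if \<exists>v. two v then SOME v. two v else u)"
  have v: "g v = q" "two v \<or> (\<forall>w. g w = q \<longrightarrow> (\<exists>n::int. w = u + of_int n))"
  proof -
    have "two v \<or> (v = u \<and> (\<forall>w. \<not> two w))" unfolding v_def by (metis someI_ex)
    then show "g v = q" "two v \<or> (\<forall>w. g w = q \<longrightarrow> (\<exists>n::int. w = u + of_int n))"
      using u unfolding two_def by metis+
  qed
  have all: "\<exists>n::int. w = u + of_int n \<or> w = v + of_int n" if "g w = q" for w
    using v(2) that two_params[OF g u v(1)] unfolding two_def by metis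
  have "\<exists>L S r. chart X q L S r \<and> L (D u) = 1 \<and> (two v \<longrightarrow> L (D v) = \<i>)"
  proof (cases "two v")
    case True
    then have "\<not> collinear {0, D u, D v}"
      using generic_transverse[OF g D(1), of u v] u v(1) unfolding two_def by simp
    then show ?thesis using generic_chart(2)[OF X g u D v(1)] by blast
  qed (use generic_chart(1)[OF X g u D] in blast)
  then obtain L S r where c: "chart X q L S r" and Lu: "L (D u) = 1" and Lv: "two v \<Longrightarrow> L (D v) = \<i>"
    by blast
  define \<gamma> where "\<gamma> t = L (g t - q)" for t
  have \<gamma>': "(\<gamma> has_vector_derivative L (D t)) (at t)" for t
    unfolding \<gamma>_def by (rule chart_curve_derivative[OF c D(1)])
  have "L 0 = 0" using c by (simp add: chart_def bounded_linear.linear linear_0)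
  then have \<gamma>0: "\<gamma> u = 0" "\<gamma> v = 0" using u v by (simp_all add: \<gamma>_def)
  obtain d1 where d1: "d1 > 0" "\<And>w. u < w \<Longrightarrow> w < u + d1 \<Longrightarrow> \<gamma> w \<in> sector 1"
    "\<And>w. u - d1 < w \<Longrightarrow> w < u \<Longrightarrow> \<gamma> w \<in> sector (- 1)"
    using curve_in_sector[OF \<gamma>'[of u] \<gamma>0(1)] Lu by auto
  have "\<exists>d2>0. two v \<longrightarrow> (\<forall>w. v < w \<and> w < v + d2 \<longrightarrow> \<gamma> w \<in> sector \<i>) \<and>
      (\<forall>w. v - d2 < w \<and> w < v \<longrightarrow> \<gamma> w \<in> sector (- \<i>))"
    using curve_in_sector[OF \<gamma>'[of v] \<gamma>0(2)] Lv by (cases "two v") (auto intro: exI[of _ 1])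
  then obtain d2 where d2: "d2 > 0" "\<And>w. two v \<Longrightarrow> v < w \<Longrightarrow> w < v + d2 \<Longrightarrow> \<gamma> w \<in> sector \<i>"
    "\<And>w. two v \<Longrightarrow> v - d2 < w \<Longrightarrow> w < v \<Longrightarrow> \<gamma> w \<in> sector (- \<i>)" by blast
  have locE: "\<exists>d>0. \<forall>v. v \<noteq> w \<and> \<bar>v - w\<bar> < d \<longrightarrow>
      (\<forall>\<^sub>F x in nhds v. g x \<in> K) \<or> (\<forall>\<^sub>F x in nhds v. g x \<notin> K)" if "g w = q" for w
    using loc[OF that] unfolding eventually_at by (auto simp: dist_real_def)
  obtain d3 where d3: "d3 > 0" "\<And>x. x \<noteq> u \<Longrightarrow> \<bar>x - u\<bar> < d3 \<Longrightarrow>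
      (\<forall>\<^sub>F x in nhds x. g x \<in> K) \<or> (\<forall>\<^sub>F x in nhds x. g x \<notin> K)" using locE[OF u] by blast
  obtain d4 where d4: "d4 > 0" "\<And>x. x \<noteq> v \<Longrightarrow> \<bar>x - v\<bar> < d4 \<Longrightarrow>
      (\<forall>\<^sub>F x in nhds x. g x \<in> K) \<or> (\<forall>\<^sub>F x in nhds x. g x \<notin> K)" using locE[OF v(1)] by blast
  define \<delta> where "\<delta> = min (min d1 d2) (min d3 d4)"
  have \<delta>: "\<delta> > 0" "\<delta> \<le> d1" "\<delta> \<le> d2" "\<delta> \<le> d3" "\<delta> \<le> d4"
    using d1(1) d2(1) d3(1) d4(1) by (auto simp: \<delta>_def)
  define J where "J d = (if d = 1 then {u<..<u + \<delta>} else if d = - 1 then {u - \<delta><..<u}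
     else if \<not> two v then {} else if d = \<i> then {v<..<v + \<delta>} else {v - \<delta><..<v})" for d :: complex
  have J: "J 1 = {u<..<u + \<delta>}" "J (- 1) = {u - \<delta><..<u}"
    "J \<i> = (if two v then {v<..<v + \<delta>} else {})" "J (- \<i>) = (if two v then {v - \<delta><..<v} else {})"
    by (auto simp: J_def complex_eq_iff)
  have J_sector: "L (g w - q) \<in> sector d" if "d \<in> directions" "w \<in> J d" for d w
    using that d1(2,3)[of w] d2(2,3)[of w] \<delta> unfolding \<gamma>_def by (auto simp: J split: if_splits)
  have iv1: "(\<forall>x\<in>{u<..<u + \<delta>}. g x \<in> K) \<or> (\<forall>x\<in>{u<..<u + \<delta>}. g x \<notin> K)"
  proof (rule eventually_constant_interval)
    fix x assume "u < x" "x < u + \<delta>"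
    then show "(\<forall>\<^sub>F y in nhds x. g y \<in> K) \<or> (\<forall>\<^sub>F y in nhds x. g y \<notin> K)"
      using \<delta>(4) by (intro d3(2)) auto
  qed
  have iv2: "(\<forall>x\<in>{u - \<delta><..<u}. g x \<in> K) \<or> (\<forall>x\<in>{u - \<delta><..<u}. g x \<notin> K)"
  proof (rule eventually_constant_interval)
    fix x assume "u - \<delta> < x" "x < u"
    then show "(\<forall>\<^sub>F y in nhds x. g y \<in> K) \<or> (\<forall>\<^sub>F y in nhds x. g y \<notin> K)"
      using \<delta>(4) by (intro d3(2)) auto
  qed
  have iv3: "(\<forall>x\<in>{v<..<v + \<delta>}. g x \<in> K) \<or> (\<forall>x\<in>{v<..<v + \<delta>}. g x \<notin> K)"
  proof (rule eventually_constant_interval)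
    fix x assume "v < x" "x < v + \<delta>"
    then show "(\<forall>\<^sub>F y in nhds x. g y \<in> K) \<or> (\<forall>\<^sub>F y in nhds x. g y \<notin> K)"
      using \<delta>(5) by (intro d4(2)) auto
  qed
  have iv4: "(\<forall>x\<in>{v - \<delta><..<v}. g x \<in> K) \<or> (\<forall>x\<in>{v - \<delta><..<v}. g x \<notin> K)"
  proof (rule eventually_constant_interval)
    fix x assume "v - \<delta> < x" "x < v"
    then show "(\<forall>\<^sub>F y in nhds x. g y \<in> K) \<or> (\<forall>\<^sub>F y in nhds x. g y \<notin> K)"
      using \<delta>(5) by (intro d4(2)) auto
  qed
  have J_const: "(\<forall>v\<in>J d. g v \<in> K) \<or> (\<forall>v\<in>J d. g v \<notin> K)" if d: "d \<in> directions" for d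
  proof -
    have "(\<forall>v\<in>J 1. g v \<in> K) \<or> (\<forall>v\<in>J 1. g v \<notin> K)" unfolding J by (rule iv1)
    moreover have "(\<forall>v\<in>J (- 1). g v \<in> K) \<or> (\<forall>v\<in>J (- 1). g v \<notin> K)" unfolding J by (rule iv2)
    moreover have "(\<forall>v\<in>J \<i>. g v \<in> K) \<or> (\<forall>v\<in>J \<i>. g v \<notin> K)" unfolding J using iv3 by (cases "two v") simp_all
    moreover have "(\<forall>v\<in>J (- \<i>). g v \<in> K) \<or> (\<forall>v\<in>J (- \<i>). g v \<notin> K)" unfolding J using iv4 by (cases "two v") simp_all
    ultimately show ?thesis using d by blast
  qed
  obtain U1 where U1: "openin (top_of_set X) U1" "q \<in> U1"
    "\<And>r. r \<in> U1 \<inter> range g \<Longrightarrow> \<exists>w. r = g w \<and> (\<bar>w - u\<bar> < \<delta> \<or> \<bar>w - v\<bar> < \<delta>)"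
    using curve_near_crossing[OF g u \<delta>(1) all] by blast
  have v_not_two: "v = u" if "\<not> two v" using that unfolding v_def by (metis someI_ex)
  have J_cover: "\<exists>d\<in>directions. \<exists>w\<in>J d. r = g w" if r: "r \<in> U1 \<inter> range g" "r \<noteq> q" for r
  proof -
    obtain w where w: "r = g w" "\<bar>w - u\<bar> < \<delta> \<or> \<bar>w - v\<bar> < \<delta>" using U1(3)[OF r(1)] by blast
    have "w \<noteq> u" "w \<noteq> v" using w(1) r(2) u v(1) by auto
    then have "w \<in> J 1 \<or> w \<in> J (- 1) \<or> w \<in> J \<i> \<or> w \<in> J (- \<i>)"
      using w(2) v_not_two by (cases "two v") (auto simp: J)
    then show ?thesis using w(1) by blast
  qed
  obtain d where d: "d \<in> directions" "\<forall>v\<in>J d. g v \<notin> K" "\<forall>v\<in>J (- d). g v \<notin> K"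
      "\<forall>v\<in>J (\<i> * d). g v \<in> K" "\<forall>v\<in>J (- (\<i> * d)). g v \<in> K"
    using splits_arms[OF c K s J_sector J_const U1(1,2) J_cover] by blast
  \<comment> \<open>Up to order the directions 1 and -1 are \<open>d\<close> and \<open>- d\<close>,
    or \<open>\<i> * d\<close> and \<open>- (\<i> * d)\<close>; in either case they agree about
    \<open>K\<close>.\<close>
  then have "(\<forall>w\<in>J 1 \<union> J (- 1). g w \<in> K) \<or> (\<forall>w\<in>J 1 \<union> J (- 1). g w \<notin> K)" by auto
  moreover have "\<forall>\<^sub>F w in at u. w \<in> J 1 \<union> J (- 1)"
    unfolding eventually_at J using \<delta>(1) by (intro exI[of _ \<delta>]) (auto simp: dist_real_def)
  ultimately show ?thesis
  proof (elim disjE)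
    assume "\<forall>\<^sub>F w in at u. w \<in> J 1 \<union> J (- 1)" "\<forall>w\<in>J 1 \<union> J (- 1). g w \<in> K"
    then have "in_near g K u" unfolding in_near_def by (elim eventually_mono) blast
    then show ?thesis ..
  next
    assume "\<forall>\<^sub>F w in at u. w \<in> J 1 \<union> J (- 1)" "\<forall>w\<in>J 1 \<union> J (- 1). g w \<notin> K"
    then have "in_near g (- K) u" unfolding in_near_def by (elim eventually_mono) blast
    then show ?thesis ..
  qed
qed

section \<open>Crossing chords are determined topologically\<close>

definition chord_at :: "(real \<Rightarrow> 'a) \<Rightarrow> 'a \<Rightarrow> real set" where
  "chord_at g p = {t\<in>{0..<1}. g t = p}"

lemma chord_at_params:
  assumes "generic_immersion X g" "p \<in> double_points g"
  shows "\<exists>s t. 0 \<le> s \<and> s < t \<and> t < 1 \<and> g s = p \<and> g t = p \<and> chord_at g p = {s, t} \<and>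
    (\<forall>u. g u = p \<longleftrightarrow> (\<exists>n::int. u = s + of_int n \<or> u = t + of_int n))"
proof (rule double_point_params[OF assms], intro exI conjI)
  fix s t assume "{u\<in>{0..<1}. g u = p} = {s, t}"
  then show "chord_at g p = {s, t}" unfolding chord_at_def .
qed blast+

lemma frac_representative:
  fixes x s :: real
  shows "\<exists>n::int. s \<le> x + of_int n \<and> x + of_int n < s + 1"
proof (intro exI[of _ "- \<lfloor>x - s\<rfloor>"] conjI)
  show "s \<le> x + of_int (- \<lfloor>x - s\<rfloor>)" using of_int_floor_le[of "x - s"] unfolding of_int_minus by linarith
  show "x + of_int (- \<lfloor>x - s\<rfloor>) < s + 1" using real_of_int_floor_add_one_gt[of "x - s"] unfolding of_int_minus by linarith
qed

text \<open>\<open>K\<close> is one of the two loops into which \<open>p\<close> divides the curve.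
  Parameters strictly between \<open>s\<close> and \<open>t\<close> run inside it; on the
  complementary arc the curve meets \<open>K\<close> only at double points, which are finitely many.
  Thus every germ away from \<open>p\<close> is of one of two kinds.\<close>

locale loop =
  fixes X :: "'a::euclidean_space set" and g :: "real \<Rightarrow> 'a" and s t :: real and p :: 'a and K :: "'a set"
  assumes g: "generic_immersion X g" and st: "s < t" "t < s + 1" "g s = p" "g t = p"
  defines "K \<equiv> g ` {s..t}"
begin

lemma in_loop_inner: "s < u \<Longrightarrow> u < t \<Longrightarrow> in_near g K u"
proof -
  assume "s < u" "u < t"
  then have "\<forall>\<^sub>F v in at u. v \<in> {s<..<t}" by (intro eventually_at_in_open') auto
  then show ?thesis unfolding in_near_def K_def by eventually_elim auto
qed

lemma not_in_loop_outer:
  assumes "t < u" "u < s + 1" "g u \<notin> double_points g"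
  shows "g u \<notin> K"
proof
  assume "g u \<in> K"
  then obtain w where w: "s \<le> w" "w \<le> t" "g w = g u" by (auto simp: K_def)
  then have "g w \<in> double_points g" using assms(1,2) by (intro generic_double_pointI[OF g, of w u]) auto
  then show False using w(3) assms(3) by simp
qed

lemma in_loop_outer: "t < u \<Longrightarrow> u < s + 1 \<Longrightarrow> in_near g (- K) u"
proof -
  assume "t < u" "u < s + 1"
  then have "\<forall>\<^sub>F v in at u. v \<in> {t<..<s + 1}" by (intro eventually_at_in_open') auto
  moreover have "\<forall>\<^sub>F v in at u. g v \<notin> double_points g"
    using g by (intro eventually_avoids[OF g]) (simp add: generic_immersion_def)
  ultimately show ?thesis unfolding in_near_def by eventually_elim (use not_in_loop_outer in auto)
qed

lemma representative:
  assumes "g u \<noteq> p"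
  obtains n :: int where "s < u + of_int n" "u + of_int n < t" | n :: int where "t < u + of_int n" "u + of_int n < s + 1"
proof -
  obtain n :: int where n: "s \<le> u + of_int n" "u + of_int n < s + 1" using frac_representative by blast
  have "g (u + of_int n) \<noteq> p" using assms generic_shift[OF g] by simp
  then have "u + of_int n \<noteq> s" "u + of_int n \<noteq> t" using st by auto
  then show ?thesis using n that by (cases "u + of_int n < t") force+
qed

lemma loop_alternative: "g u \<noteq> p \<Longrightarrow> in_near g K u \<or> in_near g (- K) u"
  by (erule representative) (metis in_loop_inner in_loop_outer in_near_shift[OF g])+

lemma in_near_imp_mem:
  assumes "g u \<noteq> p" "in_near g K u"
  shows "g u \<in> K"
  using assms(1)
proof (rule representative)
  fix n :: int assume "s < u + of_int n" "u + of_int n < t"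
  then have "g (u + of_int n) \<in> K" unfolding K_def by (intro imageI) auto
  then show ?thesis using generic_shift[OF g] by simp
next
  fix n :: int assume "t < u + of_int n" "u + of_int n < s + 1"
  then have "in_near g (- K) u" using in_loop_outer in_near_shift[OF g] by blast
  then show ?thesis using assms(2) in_near_not_both by blast
qed

lemma same_point_shift:
  assumes "g u \<notin> double_points g" "g v = g u"
  shows "\<exists>n::int. v = u + of_int n"
proof -
  obtain n :: int where n: "u \<le> v + of_int n" "v + of_int n < u + 1" using frac_representative by blast
  have "g (v + of_int n) = g u" using generic_shift[OF g] assms(2) by simp
  have "v + of_int n = u"
  proof (rule ccontr)
    assume "v + of_int n \<noteq> u"
    then have "u < v + of_int n" using n(1) by simp
    from generic_double_pointI[OF g this n(2)] show False using \<open>g (v + of_int n) = g u\<close> assms(1) by simp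
  qed
  then show ?thesis by (intro exI[of _ "- n"]) auto
qed

lemma simple_point_types:
  assumes r: "r \<in> range g" "r \<notin> double_points g" "r \<noteq> p"
  shows "r \<in> K \<and> all_near X (range g) K r \<or> r \<notin> K \<and> all_near X (range g) (- K) r"
proof -
  obtain u where u: "r = g u" using r(1) by blast
  have rX: "r \<in> X" using generic_range[OF g] u by simp
  have all: "in_near g M v" if "in_near g M u" "g v = r" for M v
    using same_point_shift[of u v] that u r(2) in_near_shift[OF g] by metis
  from r(3) u have "g u \<noteq> p" by simp
  then show ?thesis
  proof (rule representative)
    fix n :: int assume n: "s < u + of_int n" "u + of_int n < t"
    then have "in_near g K u" using in_loop_inner in_near_shift[OF g] by blast
    then show ?thesis using all all_near_iff[OF g rX] in_near_imp_mem \<open>g u \<noteq> p\<close> u by blast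
  next
    fix n :: int assume n: "t < u + of_int n" "u + of_int n < s + 1"
    then have "in_near g (- K) u" using in_loop_outer in_near_shift[OF g] by blast
    moreover have "g (u + of_int n) \<notin> K"
      by (rule not_in_loop_outer) (use n r(2) u generic_shift[OF g] in auto)
    ultimately show ?thesis using all all_near_iff[OF g rX] u generic_shift[OF g] by metis
  qed
qed

text \<open>Each of the three alternatives is a topological property of the pair of image and loop.
  Germs of both kinds at the same point mean that one branch through it belongs to \<open>K\<close>
  and the other does not, and then \<open>branch_splits\<close> applies.\<close>

lemma point_types:
  assumes X: "surface X" and r: "r \<in> range g" "r \<noteq> p"
  shows "all_near X (range g) K r \<or> all_near X (range g) (- K) r \<or> splits X (range g) K r"
proof -
  have rX: "r \<in> X" using generic_range[OF g] r(1) by blast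
  have alt: "in_near g K u \<or> in_near g (- K) u" if "g u = r" for u
    using loop_alternative that r(2) by blast
  consider "\<forall>u. g u = r \<longrightarrow> in_near g K u" | "\<forall>u. g u = r \<longrightarrow> in_near g (- K) u"
    | u v where "g u = r" "in_near g K u" "g v = r" "in_near g (- K) v"
    using alt by blast
  then show ?thesis
  proof cases
    case 3
    have "r \<in> K" using in_near_imp_mem[of u] 3 r(2) by simp
    moreover have "K \<subseteq> range g" unfolding K_def by blast
    ultimately show ?thesis using branch_splits[OF X g] 3 by blast
  qed (use all_near_iff[OF g rX] in blast)+
qed

lemma simple_param: "\<exists>u. a < u \<and> u < b \<and> g u \<notin> double_points g" if "a < b" for a b :: real
proof -
  have "\<forall>\<^sub>F v in at ((a + b) / 2). v \<in> {a<..<b}" using that by (intro eventually_at_in_open') auto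
  moreover have "\<forall>\<^sub>F v in at ((a + b) / 2). g v \<notin> double_points g"
    using g by (intro eventually_avoids[OF g]) (simp add: generic_immersion_def)
  ultimately have "\<forall>\<^sub>F v in at ((a + b) / 2). v \<in> {a<..<b} \<and> g v \<notin> double_points g"
    by (rule eventually_conj)
  then have "\<exists>v. v \<in> {a<..<b} \<and> g v \<notin> double_points g" using eventually_happens at_neq_bot by blast
  then show ?thesis by auto
qed

lemma p_double: "p \<in> double_points g"
  using generic_double_pointI[OF g, of s t] st by simp

lemma inner_point: "\<exists>r. r \<in> range g \<and> r \<noteq> p \<and> all_near X (range g) K r"
proof -
  obtain u where u: "s < u" "u < t" "g u \<notin> double_points g" using simple_param st(1) by blast
  have "g u \<noteq> p" using u(3) p_double by blast
  moreover have "g u \<in> K" unfolding K_def using u by (intro imageI) auto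
  ultimately show ?thesis using simple_point_types[of "g u"] u(3) by blast
qed

lemma outer_point: "\<exists>r. r \<in> range g \<and> r \<noteq> p \<and> all_near X (range g) (- K) r"
proof -
  obtain u where u: "t < u" "u < s + 1" "g u \<notin> double_points g" using simple_param st(2) by blast
  have "g u \<noteq> p" using u(3) p_double by blast
  moreover have "g u \<notin> K" using not_in_loop_outer u by blast
  ultimately show ?thesis using simple_point_types[of "g u"] u(3) by blast
qed

end

text \<open>\<open>K\<close> plays the role of one of the two loops at \<open>p\<close>.\<close>

locale bisection =
  fixes X :: "'a::euclidean_space set" and g :: "real \<Rightarrow> 'a" and p :: 'a and K :: "'a set"
  assumes g: "generic_immersion X g" and p: "p \<in> range g"
    and alt: "\<And>u. g u \<noteq> p \<Longrightarrow> in_near g K u \<or> in_near g (- K) u"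
    and ex_in: "\<exists>u. g u \<noteq> p \<and> in_near g K u" and ex_out: "\<exists>u. g u \<noteq> p \<and> in_near g (- K) u"
begin

text \<open>If \<open>p\<close> had a single parameter modulo integers, the rest of the curve would
  be one open interval of parameters, on which only one kind of germ could occur. This is how double
  points are recognised in the image.\<close>

lemma bisected_double_point: "p \<in> double_points g"
proof (rule ccontr)
  assume nd: "p \<notin> double_points g"
  obtain w where w: "g w = p" using p by blast
  have "g u \<noteq> p" if "w < u" "u < w + 1" for u
    using generic_double_pointI[OF g, of w u] that w nd by metis
  then have "(\<forall>u\<in>{w<..<w + 1}. in_near g K u) \<or> (\<forall>u\<in>{w<..<w + 1}. in_near g (- K) u)"
    using alt by (intro interval_in_near) blast
  moreover have "\<exists>v\<in>{w<..<w + 1}. \<forall>M. in_near g M v = in_near g M u" if "g u \<noteq> p" for u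
  proof -
    obtain n :: int where n: "w \<le> u + of_int n" "u + of_int n < w + 1" using frac_representative by blast
    have "u + of_int n \<noteq> w" using that w generic_shift[OF g] by metis
    then show ?thesis using n in_near_shift[OF g] by (intro bexI[of _ "u + of_int n"]) auto
  qed
  ultimately show False using ex_in ex_out in_near_not_both by metis
qed

text \<open>The parameters of \<open>p\<close> cut the circle into two arcs, each of which has germs
  of one kind only. Both kinds occur, so exactly one arc is in \<open>K\<close>. The chord of
  \<open>q\<close> crosses that of \<open>p\<close> when its ends lie on different arcs, that is,
  when the two germs at \<open>q\<close> are of different kinds.\<close>

lemma crosses_iff:
  assumes q: "q \<in> double_points g" "q \<noteq> p"
  shows "crosses (chord_at g p) (chord_at g q) \<longleftrightarrow>
    \<not> all_near X (range g) K q \<and> \<not> all_near X (range g) (- K) q"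
proof -
  obtain s t where st: "0 \<le> s" "s < t" "t < 1" "g s = p" "g t = p" "chord_at g p = {s, t}"
    and pst: "\<And>u. g u = p \<longleftrightarrow> (\<exists>n::int. u = s + of_int n \<or> u = t + of_int n)"
    using chord_at_params[OF g bisected_double_point] by blast
  obtain u v where uv: "0 \<le> u" "u < v" "v < 1" "g u = q" "g v = q" "chord_at g q = {u, v}"
    and puv: "\<And>x. g x = q \<longleftrightarrow> (\<exists>n::int. x = u + of_int n \<or> x = v + of_int n)"
    using chord_at_params[OF g q(1)] by blast
  have np: "g x \<noteq> p" if "s < x" "x < s + 1" "x \<noteq> t" for x
  proof
    assume "g x = p"
    then obtain n :: int where "x = s + of_int n \<or> x = t + of_int n" using pst by blast
    then show False
    proof
      assume x: "x = s + of_int n"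
      then have "(0::real) < of_int n" "(of_int n::real) < 1" using that by auto
      then show False by (simp only: of_int_0_less_iff of_int_less_1_iff)
    next
      assume x: "x = t + of_int n"
      then have "(of_int n::real) < 1" "(-1::real) < of_int n" using that st by auto
      then have "n < 1" "-1 < n" by (simp_all only: of_int_less_1_iff)
      then have "n = 0" by linarith
      then show False using x that(3) by simp
    qed
  qed
  have "(\<forall>x\<in>{s<..<t}. in_near g K x) \<or> (\<forall>x\<in>{s<..<t}. in_near g (- K) x)"
    using np st by (intro interval_in_near alt) auto
  moreover have "(\<forall>x\<in>{t<..<s + 1}. in_near g K x) \<or> (\<forall>x\<in>{t<..<s + 1}. in_near g (- K) x)"
    using np st by (intro interval_in_near alt) auto
  moreover have rep: "\<exists>y\<in>{s<..<t} \<union> {t<..<s + 1}. \<forall>M. in_near g M y = in_near g M x" if "g x \<noteq> p" for x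
  proof -
    obtain n :: int where n: "s \<le> x + of_int n" "x + of_int n < s + 1" using frac_representative by blast
    have "x + of_int n \<noteq> s" "x + of_int n \<noteq> t" using that st generic_shift[OF g] by metis+
    then show ?thesis using n in_near_shift[OF g] by (intro bexI[of _ "x + of_int n"]) auto
  qed
  moreover have "\<not> (\<forall>x\<in>{s<..<t} \<union> {t<..<s + 1}. in_near g K x)"
    using rep ex_out in_near_not_both by metis
  moreover have "\<not> (\<forall>x\<in>{s<..<t} \<union> {t<..<s + 1}. in_near g (- K) x)"
    using rep ex_in in_near_not_both by metis
  ultimately consider "\<forall>x\<in>{s<..<t}. in_near g K x" "\<forall>x\<in>{t<..<s + 1}. in_near g (- K) x"
    | "\<forall>x\<in>{s<..<t}. in_near g (- K) x" "\<forall>x\<in>{t<..<s + 1}. in_near g K x"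
    by blast
  \<comment> \<open>Either of the two arcs may be the one in \<open>K\<close>; crossing does not
    distinguish them.\<close>
  then have type: "(\<forall>x. 0 \<le> x \<and> x < 1 \<and> g x \<noteq> p \<longrightarrow> (in_near g K x \<longleftrightarrow> s < x \<and> x < t)) \<or>
     (\<forall>x. 0 \<le> x \<and> x < 1 \<and> g x \<noteq> p \<longrightarrow> (in_near g K x \<longleftrightarrow> \<not> (s < x \<and> x < t)))"
  proof cases
    case 1
    have "in_near g K x \<longleftrightarrow> s < x \<and> x < t" if x: "0 \<le> x" "x < 1" "g x \<noteq> p" for x
    proof -
      have "x \<noteq> s" "x \<noteq> t" using x(3) st by auto
      \<comment> \<open>Parameters below \<open>s\<close> reach the second arc after the addition of
        a full period.\<close>
      then consider "x \<in> {s<..<t}" | "x \<in> {t<..<s + 1}" | "x + of_int 1 \<in> {t<..<s + 1}" "x < s"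
        using x st by fastforce
      then show ?thesis using 1 in_near_shift[OF g, of _ x 1] in_near_not_both by cases fastforce+
    qed
    then show ?thesis by blast
  next
    case 2
    have "in_near g K x \<longleftrightarrow> \<not> (s < x \<and> x < t)" if x: "0 \<le> x" "x < 1" "g x \<noteq> p" for x
    proof -
      have "x \<noteq> s" "x \<noteq> t" using x(3) st by auto
      then consider "x \<in> {s<..<t}" | "x \<in> {t<..<s + 1}" | "x + of_int 1 \<in> {t<..<s + 1}" "x < s"
        using x st by fastforce
      then show ?thesis using 2 in_near_shift[OF g, of _ x 1] in_near_not_both by cases fastforce+
    qed
    then show ?thesis by blast
  qed
  have gq: "g u \<noteq> p" "g v \<noteq> p" using uv q(2) by auto
  have qX: "q \<in> X" using generic_range[OF g] uv(4) by blast
  have near: "all_near X (range g) M q \<longleftrightarrow> in_near g M u \<and> in_near g M v" for M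
  proof -
    have "all_near X (range g) M q \<longleftrightarrow> (\<forall>x. (\<exists>n::int. x = u + of_int n \<or> x = v + of_int n) \<longrightarrow> in_near g M x)"
      using all_near_iff[OF g qX] puv by simp
    also have "\<dots> \<longleftrightarrow> in_near g M u \<and> in_near g M v"
      using in_near_shift[OF g] by (metis add.right_neutral of_int_0)
    finally show ?thesis .
  qed
  have neg: "in_near g (- K) u \<longleftrightarrow> \<not> in_near g K u" "in_near g (- K) v \<longleftrightarrow> \<not> in_near g K v"
    using alt gq in_near_not_both by blast+
  have "{s, t} \<inter> {u, v} = {}" using st(4,5) uv(4,5) q(2) by auto
  then have "crosses {s, t} {u, v} \<longleftrightarrow> (s < u \<and> u < t) \<noteq> (s < v \<and> v < t)"
    by (rule crosses_iff_separates[OF st(2) uv(2)])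
  moreover have "(in_near g K u = in_near g K v) = ((s < u \<and> u < t) = (s < v \<and> v < t))"
    using type gq uv(1-3) by (elim disjE) auto
  ultimately show ?thesis unfolding st(6) uv(6) near neg by blast
qed

end

section \<open>Transport of loops and of crossings to another curve\<close>

lemma all_near_nhds:
  assumes g: "generic_immersion X g" and "all_near X (range g) K (g v)" "g v \<in> K"
  shows "\<forall>\<^sub>F x in nhds v. g x \<in> K"
  using assms all_near_iff[OF g generic_range[OF g]]
  by (auto simp: eventually_nhds_conv_at in_near_def)

text \<open>The type of each point is carried over by \<open>h\<close>. At points where all germs
  agree, \<open>all_near_iff\<close> for \<open>g'\<close> gives the alternative; at points that
  \<open>K\<close> splits, \<open>splits_in_near\<close> shows that \<open>g'\<close> respects the
  image of the loop. The inner and outer points of the loop show that both kinds occur.\<close>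

lemma loop_bisects_image:
  assumes X: "surface X" and g': "generic_immersion X g'" and h: "homeomorphism X X h h'"
    and img: "h ` range g = range g'" and lp: "loop X g s t p"
  shows "bisection X g' (h p) (h ` g ` {s..t})"
proof -
  interpret loop X g s t p "g ` {s..t}" by (fact lp)
  let ?K = "g ` {s..t}"
  have inj: "inj_on h X" using h by (metis homeomorphism_apply1 inj_on_inverseI)
  have PX: "range g \<subseteq> X" using generic_range[OF g] by blast
  have pP: "p \<in> range g" using st(3) by blast
  have mem: "h r \<in> h ` ?K \<longleftrightarrow> r \<in> ?K" if "r \<in> range g" for r
  proof
    assume "h r \<in> h ` ?K"
    then obtain r' where r': "r' \<in> ?K" "h r = h r'" by blast
    have "r \<in> X" "r' \<in> X" using r'(1) that PX by blast+
    then show "r \<in> ?K" using inj r' by (metis inj_onD)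
  qed (rule imageI)
  have tr: "all_near X (range g') (h ` ?K) (h r)" if "all_near X (range g) ?K r" "r \<in> range g" for r
    unfolding img[symmetric]
    by (rule all_near_transfer[OF h that(1) _ PX]) (use that(2) PX in blast)+
  have tr': "all_near X (range g') (- h ` ?K) (h r)" if "all_near X (range g) (- ?K) r" "r \<in> range g" for r
    unfolding img[symmetric]
  proof (rule all_near_transfer[OF h that(1) _ PX])
    fix y assume "y \<in> range g" "y \<in> - ?K"
    then show "h y \<in> - h ` ?K" using mem by blast
  qed (use that(2) PX in blast)
  have neq: "h r \<noteq> h p" if "r \<in> range g" "r \<noteq> p" for r
    using inj that pP PX by (metis inj_onD subsetD)
  show ?thesis
  proof
    show "generic_immersion X g'" by fact
    show "h p \<in> range g'" using pP img by blast
    show "in_near g' (h ` ?K) u \<or> in_near g' (- h ` ?K) u" if u: "g' u \<noteq> h p" for u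
    proof -
      have "g' u \<in> h ` range g" unfolding img by blast
      then obtain q where q: "q \<in> range g" "g' u = h q" by blast
      have qp: "q \<noteq> p" using q(2) u by auto
      have qX: "q \<in> X" "h q \<in> X" using q PX generic_range[OF g'] by auto (metis)
      from point_types[OF X q(1) qp] show ?thesis
      proof (elim disjE)
        assume "splits X (range g) ?K q"
        then have "splits X (h ` range g) (h ` ?K) (h q)"
          using h qX PX by (intro splits_transfer) auto
        then have sp: "splits X (range g') (h ` ?K) (h q)" unfolding img .
        show ?thesis
        proof (rule splits_in_near[OF X g' sp _ _ q(2)])
          show "h ` ?K \<subseteq> range g'" unfolding img[symmetric] by blast
          fix w assume "g' w = h q"
          \<comment> \<open>The exceptional points are the images of the double points of
            \<open>g\<close>. That these are the double points of \<open>g'\<close> is not yet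
            known; it is a consequence of the present lemma.\<close>
          have "finite (h ` double_points g)" using g by (simp add: generic_immersion_def)
          from eventually_avoids[OF g' this, of w]
          show "\<forall>\<^sub>F v in at w. (\<forall>\<^sub>F x in nhds v. g' x \<in> h ` ?K) \<or> (\<forall>\<^sub>F x in nhds v. g' x \<notin> h ` ?K)"
          proof eventually_elim
            fix v assume v: "g' v \<notin> h ` double_points g"
            have "g' v \<in> h ` range g" unfolding img by blast
            then obtain r where r: "r \<in> range g" "g' v = h r" by blast
            then have "r \<notin> double_points g" "r \<noteq> p" using v p_double by auto
            from simple_point_types[OF r(1) this]
            show "(\<forall>\<^sub>F x in nhds v. g' x \<in> h ` ?K) \<or> (\<forall>\<^sub>F x in nhds v. g' x \<notin> h ` ?K)"
            proof
              assume "r \<in> ?K \<and> all_near X (range g) ?K r"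
              then show ?thesis using all_near_nhds[OF g', of "h ` ?K" v] tr r by auto
            next
              assume "r \<notin> ?K \<and> all_near X (range g) (- ?K) r"
              then show ?thesis using all_near_nhds[OF g', of "- h ` ?K" v] tr' r mem by auto
            qed
          qed
        qed
      qed (use tr tr' q all_near_iff[OF g' qX(2)] in metis)+
    qed
    obtain r where r: "r \<in> range g" "r \<noteq> p" "all_near X (range g) ?K r" using inner_point by blast
    then obtain w where w: "g' w = h r" using img by (metis image_iff)
    have "h r \<in> X" using generic_range[OF g'] w by metis
    then have "in_near g' (h ` ?K) w" using all_near_iff[OF g'] tr r w by blast
    then show "\<exists>u. g' u \<noteq> h p \<and> in_near g' (h ` ?K) u" using neq r w by metis
    obtain r where r: "r \<in> range g" "r \<noteq> p" "all_near X (range g) (- ?K) r" using outer_point by blast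
    then obtain w where w: "g' w = h r" using img by (metis image_iff)
    have "h r \<in> X" using generic_range[OF g'] w by metis
    then have "in_near g' (- h ` ?K) w" using all_near_iff[OF g'] tr' r w by blast
    then show "\<exists>u. g' u \<noteq> h p \<and> in_near g' (- h ` ?K) u" using neq r w by metis
  qed
qed

lemma loop_bisects:
  assumes lp: "loop X g s t p"
  shows "bisection X g p (g ` {s..t})"
proof -
  interpret loop X g s t p "g ` {s..t}" by (fact lp)
  show ?thesis
  proof
    show "p \<in> range g" using st(3) by blast
    obtain r where r: "r \<in> range g" "r \<noteq> p" "all_near X (range g) (g ` {s..t}) r" using inner_point by blast
    then obtain w where "g w = r" by blast
    then show "\<exists>u. g u \<noteq> p \<and> in_near g (g ` {s..t}) u"
      using all_near_iff[OF g generic_range[OF g]] r by metis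
    obtain r where r: "r \<in> range g" "r \<noteq> p" "all_near X (range g) (- g ` {s..t}) r" using outer_point by blast
    then obtain w where "g w = r" by blast
    then show "\<exists>u. g u \<noteq> p \<and> in_near g (- g ` {s..t}) u"
      using all_near_iff[OF g generic_range[OF g]] r by metis
  qed (use g loop_alternative in blast)+
qed

lemma double_point_loop:
  assumes "generic_immersion X g" "p \<in> double_points g"
  shows "\<exists>s t. loop X g s t p"
proof (rule double_point_params[OF assms])
  fix s t assume "0 \<le> s" "s < t" "t < 1" "g s = p" "g t = p"
  then show ?thesis using assms(1) by (intro exI[of _ s] exI[of _ t] loop.intro) auto
qed

lemma homeomorphism_double_point:
  assumes X: "surface X" and "generic_immersion X g" "generic_immersion X g'" "homeomorphism X X h h'"
    and "h ` range g = range g'" "p \<in> double_points g"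
  shows "h p \<in> double_points g'"
proof -
  obtain s t where "loop X g s t p" using double_point_loop assms by blast
  from loop_bisects_image[OF X assms(3,4,5) this] show ?thesis by (rule bisection.bisected_double_point)
qed

lemma homeomorphism_crosses:
  assumes X: "surface X" and g: "generic_immersion X g" and g': "generic_immersion X g'"
    and h: "homeomorphism X X h h'" and img: "h ` range g = range g'"
    and pq: "p \<in> double_points g" "q \<in> double_points g" "p \<noteq> q"
  shows "crosses (chord_at g' (h p)) (chord_at g' (h q)) = crosses (chord_at g p) (chord_at g q)"
proof -
  obtain s t where lp: "loop X g s t p" using double_point_loop g pq by blast
  let ?K = "g ` {s..t}"
  have PX: "range g \<subseteq> X" using generic_range[OF g] by blast
  have q: "q \<in> range g" "p \<in> range g" "q \<in> X" "p \<in> X" using pq PX by (auto simp: double_points_def)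
  have inj: "inj_on h X" using h by (metis homeomorphism_apply1 inj_on_inverseI)
  have hq: "h q \<in> double_points g'" "h q \<noteq> h p"
    using homeomorphism_double_point[OF X g g' h img] pq inj q by (auto dest: inj_onD)
  have mem: "h r \<in> h ` ?K \<longleftrightarrow> r \<in> ?K" if "r \<in> range g" for r
  proof
    assume "h r \<in> h ` ?K"
    then obtain r' where r': "r' \<in> ?K" "h r = h r'" by blast
    have "r \<in> X" "r' \<in> X" using r'(1) that PX by blast+
    then show "r \<in> ?K" using inj r' by (metis inj_onD)
  qed (rule imageI)
  have hh: "h' (h r) = r" if "r \<in> X" for r using h that by (simp add: homeomorphism_def)
  have "h' (h (g x)) = g x" for x using hh generic_range[OF g] by blast
  then have h'img: "h' ` range g' = range g" unfolding img[symmetric] by (simp add: image_image)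
  have P'X: "range g' \<subseteq> X" using generic_range[OF g'] by blast
  have "all_near X (range g') M' (h q) \<longleftrightarrow> all_near X (range g) M q"
    if M: "\<And>r. r \<in> range g \<Longrightarrow> h r \<in> M' \<longleftrightarrow> r \<in> M" for M M'
  proof
    assume "all_near X (range g) M q"
    from all_near_transfer[OF h this q(3) PX, of M'] M img show "all_near X (range g') M' (h q)" by simp
  next
    assume a: "all_near X (range g') M' (h q)"
    have hq': "h q \<in> X" using q(3) h by (auto simp: homeomorphism_def)
    have "all_near X (h' ` range g') M (h' (h q))"
    proof (rule all_near_transfer[OF homeomorphism_symD[OF h] a hq' P'X])
      fix y assume y: "y \<in> range g'" "y \<in> M'"
      then obtain r where r: "r \<in> range g" "y = h r" using img by (metis image_iff)
      then have "h' y = r" using hh PX by blast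
      then show "h' y \<in> M" using M[OF r(1)] r(2) y(2) by simp
    qed
    then show "all_near X (range g) M q" using h'img hh q by simp
  qed
  from this[of "h ` ?K" ?K] this[of "- h ` ?K" "- ?K"] mem
  have "all_near X (range g') (h ` ?K) (h q) \<longleftrightarrow> all_near X (range g) ?K q"
    "all_near X (range g') (- h ` ?K) (h q) \<longleftrightarrow> all_near X (range g) (- ?K) q" by blast+
  then show ?thesis
    using bisection.crosses_iff[OF loop_bisects_image[OF X g' h img lp] hq]
      bisection.crosses_iff[OF loop_bisects[OF lp] pq(2)] pq(3) by metis
qed

lemma graph_sum_double_points:
  assumes g: "generic_immersion X g"
  shows "graph_sum W crosses (chord_diagram g) =
    graph_sum W (\<lambda>p q. crosses (chord_at g p) (chord_at g q)) (double_points g)"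
proof (rule graph_sum_bij)
  show "bij_betw (chord_at g) (double_points g) (chord_diagram g)"
    unfolding bij_betw_def chord_diagram_def chord_at_def
  proof (intro conjI inj_onI)
    fix p q assume p: "p \<in> double_points g" and eq: "{t\<in>{0..<1}. g t = p} = {t\<in>{0..<1}. g t = q}"
    obtain t where "t \<in> {t\<in>{0..<1}. g t = p}" using p by (auto simp: double_points_def)
    moreover from this have "t \<in> {t\<in>{0..<1}. g t = q}" unfolding eq .
    ultimately show "p = q" by simp
  qed simp
qed simp

theorem lambda4_homeomorphism:
  assumes X: "surface X" and g: "generic_immersion X g" and g': "generic_immersion X g'"
    and h: "homeomorphism X X h h'" and img: "h ` range g = range g'"
  shows "lambda4 g = lambda4 g'"
proof -
  have PX: "range g \<subseteq> X" "range g' \<subseteq> X" using generic_range g g' by blast+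
  have dX: "double_points g \<subseteq> range g" "double_points g' \<subseteq> range g'" by (auto simp: double_points_def)
  have hh: "h' (h r) = r" "h (h' r) = r" if "r \<in> X" for r using h that by (simp_all add: homeomorphism_def)
  have "h' (h (g x)) = g x" for x using hh generic_range[OF g] by blast
  then have h'img: "h' ` range g' = range g" unfolding img[symmetric] by (simp add: image_image)
  have "bij_betw h (double_points g) (double_points g')"
  proof (rule bij_betw_byWitness[where f'=h'])
    show "h ` double_points g \<subseteq> double_points g'"
      using homeomorphism_double_point[OF X g g' h img] by blast
    show "h' ` double_points g' \<subseteq> double_points g"
      using homeomorphism_double_point[OF X g' g homeomorphism_symD[OF h] h'img] by blast
    show "\<forall>x\<in>double_points g. h' (h x) = x" using hh(1) PX(1) dX(1) by (meson subsetD)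
    show "\<forall>x\<in>double_points g'. h (h' x) = x" using hh(2) PX(2) dX(2) by (meson subsetD)
  qed
  moreover have "crosses (chord_at g' (h p)) (chord_at g' (h q)) = crosses (chord_at g p) (chord_at g q)"
    if "p \<in> double_points g" "q \<in> double_points g" for p q
  proof (cases "p = q")
    case True
    have "h p \<in> double_points g'" by (rule homeomorphism_double_point[OF X g g' h img that(1)])
    then have "card (chord_at g p) = 2" "card (chord_at g' (h p)) = 2"
      using g g' that unfolding generic_immersion_def chord_at_def by blast+
    then show ?thesis using True crosses_irrefl by blast
  qed (use homeomorphism_crosses[OF X g g' h img] that in blast)
  ultimately show ?thesis
    unfolding lambda4_eq_graph_sum[OF g] lambda4_eq_graph_sum[OF g']
      graph_sum_double_points[OF g] graph_sum_double_points[OF g']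
    by (intro graph_sum_bij[symmetric]) auto
qed

section \<open>Kinks\<close>

text \<open>The identity map as homeomorphism: the value depends on the image only, so the
  parametrizations that come with a move may be used.\<close>

lemma lambda4_same_range:
  assumes "surface X" "generic_immersion X g" "generic_immersion X g'" "range g = range g'"
  shows "lambda4 g = lambda4 g'"
  using lambda4_homeomorphism[OF assms(1-3) homeomorphism_ident] assms(4) by simp

lemma ambient_isotopic_invariant:
  assumes X: "surface X"
  shows "invariant_under X (ambient_isotopic X) lambda4"
  unfolding invariant_under_def
proof (intro allI impI, elim conjE)
  fix g g' assume g: "generic_immersion X g" "generic_immersion X g'"
    and iso: "ambient_isotopic X (range g) (range g')"
  from iso obtain h where h: "homotopic_with_canon (\<lambda>f. \<exists>f'. homeomorphism X X f f') X X id h"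
    "h ` range g = range g'"
    unfolding ambient_isotopic_def by blast
  from homotopic_with_imp_property[OF h(1)] obtain h' where "homeomorphism X X h h'" by blast
  from lambda4_homeomorphism[OF X g this h(2)] show "lambda4 g = lambda4 g'" .
qed

section \<open>Change of base point\<close>

lemma generic_immersion_shift:
  assumes g: "generic_immersion X g"
  shows "generic_immersion X (\<lambda>t. g (t + c))"
proof -
  obtain F where F: "F (0::nat) = g" "\<And>n t. (F n has_vector_derivative F (Suc n) t) (at t)"
    using g unfolding generic_immersion_def smooth_def by metis
  have sh: "((\<lambda>t. f (t + c)) has_vector_derivative f') (at t)" if "(f has_vector_derivative f') (at (t + c))"
    for f :: "real \<Rightarrow> 'a" and f' t
  proof -
    have "((\<lambda>x. x + c) has_vector_derivative 1) (at t)" by (auto intro!: derivative_eq_intros)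
    from vector_diff_chain_at[OF this that] show ?thesis by (simp add: o_def)
  qed
  have "smooth (\<lambda>t. g (t + c))"
    unfolding smooth_def using F sh by (intro exI[of _ "\<lambda>n t. F n (t + c)"]) auto
  moreover have vd: "vector_derivative (\<lambda>t. g (t + c)) (at t) = vector_derivative g (at (t + c))" for t
    using sh[of g "F 1 (t + c)" t] F(2)[of 0 "t + c"] F(1) by (simp add: vector_derivative_at)
  moreover have fr: "g (frac (x + c)) = g (x + c)" for x by (rule generic_frac[OF g])
  have bij: "bij_betw (\<lambda>t. frac (t + c)) {t\<in>{0..<1}. g (t + c) = p} {t\<in>{0..<1}. g t = p}" for p
  proof (rule bij_betw_byWitness[where f'="\<lambda>t. frac (t - c)"])
    have "frac (frac (t + c) - c) = frac t" for t :: real and c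
      using frac_add_simps(1)[of "t + c" "- c"] by simp
    then show "\<forall>t\<in>{t\<in>{0..<1}. g (t + c) = p}. frac (frac (t + c) - c) = t" by (simp add: frac_eq)
    have "frac (frac (t - c) + c) = frac t" for t :: real and c
      using frac_add_simps(1)[of "t - c" c] by simp
    then show "\<forall>t\<in>{t\<in>{0..<1}. g t = p}. frac (frac (t - c) + c) = t" by (simp add: frac_eq)
    show "(\<lambda>t. frac (t + c)) ` {t\<in>{0..<1}. g (t + c) = p} \<subseteq> {t\<in>{0..<1}. g t = p}"
      using fr by (auto simp: frac_lt_1)
    show "(\<lambda>t. frac (t - c)) ` {t\<in>{0..<1}. g t = p} \<subseteq> {t\<in>{0..<1}. g (t + c) = p}"
    proof clarify
      fix t assume t: "t \<in> {0..<1::real}" "p = g t"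
      have "g (frac (t - c) + c) = g (frac (frac (t - c) + c))" by (rule generic_frac[OF g, symmetric])
      also have "frac (frac (t - c) + c) = frac t" using frac_add_simps(1)[of "t - c" c] by simp
      finally show "frac (t - c) \<in> {0..<1} \<and> g (frac (t - c) + c) = g t"
        using generic_frac[OF g] by (simp add: frac_lt_1)
    qed
  qed
  have card_eq: "card {t\<in>{0..<1}. g (t + c) = p} = card {t\<in>{0..<1}. g t = p}" for p
    using bij_betw_same_card[OF bij] .
  have inj: "s = t" if "s \<in> {0..<1}" "t \<in> {0..<1}" "frac (s + c) = frac (t + c)" for s t :: real
  proof -
    have "s - t = of_int (\<lfloor>s + c\<rfloor> - \<lfloor>t + c\<rfloor>)" using that(3) by (simp add: frac_def)
    moreover define k where "k = \<lfloor>s + c\<rfloor> - \<lfloor>t + c\<rfloor>"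
    ultimately have "s - t = of_int k" "\<bar>of_int k :: real\<bar> < 1" using that(1,2) by auto
    then have "\<bar>k\<bar> < 1" by (metis of_int_abs of_int_less_1_iff)
    then show "s = t" using \<open>s - t = of_int k\<close> by simp
  qed
  have dp: "double_points (\<lambda>t. g (t + c)) \<subseteq> double_points g"
  proof
    fix p assume "p \<in> double_points (\<lambda>t. g (t + c))"
    then obtain s t where st: "s \<in> {0..<1}" "t \<in> {0..<1}" "s \<noteq> t" "g (s + c) = p" "g (t + c) = p"
      by (auto simp: double_points_def)
    then have "frac (s + c) \<noteq> frac (t + c)" using inj by blast
    moreover have "frac (s + c) \<in> {0..<1}" "frac (t + c) \<in> {0..<1}" by (auto simp: frac_lt_1)
    moreover have "g (frac (s + c)) = p" "g (frac (t + c)) = p" using st(4,5) fr by simp_all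
    ultimately show "p \<in> double_points g"
      unfolding double_points_def
      by (intro CollectI bexI[of _ "frac (s + c)"] bexI[of _ "frac (t + c)"] conjI)
  qed
  have vfr: "vector_derivative g (at (frac x)) = vector_derivative g (at x)" for x
  proof -
    have vF: "(g has_vector_derivative F 1 y) (at y)" for y using F(2)[of 0 y] F(1) by simp
    have "F 1 (frac x + of_int \<lfloor>x\<rfloor>) = F 1 (frac x)" by (rule velocity_shift[OF g vF])
    then have "F 1 x = F 1 (frac x)" by (simp add: frac_def)
    then show ?thesis using vector_derivative_at[OF vF] by metis
  qed
  have tr: "\<not> collinear {0, vector_derivative g (at (s + c)), vector_derivative g (at (t + c))}"
    if st: "s \<in> {0..<1}" "t \<in> {0..<1}" "s \<noteq> t" "g (s + c) = g (t + c)" for s t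
  proof -
    have "frac (s + c) \<noteq> frac (t + c)" using inj st by blast
    moreover have "frac (s + c) \<in> {0..<1}" "frac (t + c) \<in> {0..<1}" by (auto simp: frac_lt_1)
    moreover have "g (frac (s + c)) = g (frac (t + c))" using fr st(4) by simp
    ultimately have "\<not> collinear {0, vector_derivative g (at (frac (s + c))), vector_derivative g (at (frac (t + c)))}"
      using g unfolding generic_immersion_def by blast
    then show ?thesis by (simp add: vfr)
  qed
  show ?thesis
    unfolding generic_immersion_def vd card_eq
  proof (intro conjI ballI allI impI)
    show "range (\<lambda>t. g (t + c)) \<subseteq> X" using generic_range[OF g] by blast
    show "g (t + 1 + c) = g (t + c)" for t using generic_periodic[OF g, of "t + c"] by (simp add: add_ac)
    show "smooth (\<lambda>t. g (t + c))" by fact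
    show "vector_derivative g (at (t + c)) \<noteq> 0" for t using g by (simp add: generic_immersion_def)
    show "finite (double_points (\<lambda>t. g (t + c)))"
      using dp g unfolding generic_immersion_def by (blast intro: finite_subset)
    show "card {t\<in>{0..<1}. g t = p} = 2" if "p \<in> double_points (\<lambda>t. g (t + c))" for p
      using dp that g unfolding generic_immersion_def by blast
    show "\<not> collinear {0, vector_derivative g (at (s + c)), vector_derivative g (at (t + c))}"
      if "s \<in> {0..<1}" "t \<in> {0..<1}" "s \<noteq> t \<and> g (s + c) = g (t + c)" for s t
      using tr that by blast
  qed
qed

text \<open>With the base point at the start of the first arc of a move, all arcs that are altered
  become intervals within one fundamental domain.\<close>

lemma lambda4_shift:
  assumes "surface X" "generic_immersion X g"
  shows "lambda4 (\<lambda>t. g (t + c)) = lambda4 g"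
proof (rule lambda4_same_range[OF assms(1) generic_immersion_shift[OF assms(2)] assms(2)])
  have "range (\<lambda>t. g (t + c)) = g ` range (\<lambda>t. t + c)" by blast
  also have "range (\<lambda>t. t + c) = UNIV" by (rule surjI[of _ "\<lambda>t. t - c"]) simp
  finally show "range (\<lambda>t. g (t + c)) = range g" .
qed

lemma chord_diagram_shift:
  assumes g: "generic_immersion X g"
  shows "chord_diagram (\<lambda>t. g (t + c)) = {{u, v} | u v. 0 \<le> u \<and> u < v \<and> v < 1 \<and> g (u + c) = g (v + c)}"
  using chord_diagram_eq[OF generic_immersion_shift[OF g]] by simp

lemma finite_chord_diagram:
  assumes "generic_immersion X g"
  shows "finite (chord_diagram g)"
  using chord_set_chord_diagram[OF assms] by (simp add: chord_set_def)

text \<open>With base point \<open>a\<close> the new chord has both ends in the closed interval from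
  0 to \<open>b - a\<close>, and every other chord lies beyond it, because the curve outside the
  disc does not meet the arc inside. Hence the new chord crosses nothing.\<close>

lemma kink_lambda4:
  assumes X: "surface X" and g: "generic_immersion X g" and g': "generic_immersion X g'" and k: "adds_kink X g g'"
  shows "lambda4 g' = lambda4 g"
proof -
  obtain \<psi> a b s t where disc: "disc_in X \<psi>" and ab: "a < b" "b < a + 1"
    and agree: "\<forall>x\<in>{b..a + 1}. g' x = g x"
    and out: "\<forall>x\<in>{b<..<a + 1}. g x \<notin> \<psi> ` cball 0 1"
    and str: "strand \<psi> g a b" "strand \<psi> g' a b" and inj: "inj_on g {a..b}"
    and kink: "{(u, v). u \<in> {a..b} \<and> v \<in> {a..b} \<and> u < v \<and> g' u = g' v} = {(s, t)}"
    using k unfolding adds_kink_def by (elim exE conjE)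
  have pin: "\<psi> ` ball 0 1 \<inter> \<psi> ` sphere 0 1 = {}"
  proof -
    have "inj_on \<psi> (cball 0 1)" using disc by (simp add: disc_in_def)
    moreover have "ball (0::complex) 1 \<inter> sphere 0 1 = {}" "ball (0::complex) 1 \<subseteq> cball 0 1" "sphere (0::complex) 1 \<subseteq> cball 0 1"
      by auto
    ultimately show ?thesis using inj_on_image_Int by (metis image_empty)
  qed
  have wrap: "f (x + 1) = f x" if "generic_immersion X f" for f x using generic_periodic that by blast
  have ends: "g' a = g a" "g' b = g b" using agree ab wrap[OF g, of a] wrap[OF g', of a] by auto
  \<comment> \<open>The inner part of an arc lies in the open disc. The remaining parameters give
    points off the closed disc, except for the two ends, which are on its boundary.\<close>
  have sep: "f x \<noteq> f' y" if fstr: "strand \<psi> f a b" and xy: "a < x" "x < b" "b \<le> y" "y \<le> a + 1" and f': "f' \<in> {g, g'}"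
    for f f' x y
  proof -
    have fx: "f x \<in> \<psi> ` ball 0 1" using fstr xy by (auto simp: strand_def)
    have ab_sphere: "g a \<in> \<psi> ` sphere 0 1" "g b \<in> \<psi> ` sphere 0 1" using str by (auto simp: strand_def)
    have f'y: "f' y = g y" using xy f' agree by auto
    consider "y = b" | "y = a + 1" | "y \<in> {b<..<a + 1}" using xy by fastforce
    then have "g y \<notin> \<psi> ` ball 0 1"
    proof cases
      case 1 then show ?thesis using ab_sphere(2) pin by blast
    next
      case 2
      then have "g y = g a" using wrap[OF g, of a] by simp
      then show ?thesis using ab_sphere(1) pin by auto
    next
      case 3
      then have "g y \<notin> \<psi> ` cball 0 1" using out by blast
      moreover have "\<psi> ` ball 0 1 \<subseteq> \<psi> ` cball 0 1" by (intro image_mono) auto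
      ultimately show ?thesis by blast
    qed
    then show ?thesis using fx f'y by metis
  qed
  have "(s, t) \<in> {(u, v). u \<in> {a..b} \<and> v \<in> {a..b} \<and> u < v \<and> g' u = g' v}" unfolding kink by simp
  then have st: "a \<le> s" "s < t" "t \<le> b" "g' s = g' t" by auto
  have gab: "g a \<noteq> g b" using inj ab by (auto dest: inj_onD)
  define G where "G x = g (x + a)" for x
  define G' where "G' x = g' (x + a)" for x
  have GG: "generic_immersion X G" "generic_immersion X G'"
    unfolding G_def G'_def by (rule generic_immersion_shift[OF g], rule generic_immersion_shift[OF g'])
  define c where "c = {s - a, t - a}"
  have only: "u + a = s \<and> v + a = t" if "0 \<le> u" "u < v" "v + a \<le> b" "G' u = G' v" for u v
  proof -
    have "(u + a, v + a) \<in> {(u, v). u \<in> {a..b} \<and> v \<in> {a..b} \<and> u < v \<and> g' u = g' v}"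
      using that by (auto simp: G'_def)
    then show ?thesis unfolding kink by simp
  qed
  have outer: "b < u + a" if "0 \<le> u" "u < v" "v < 1" "G u = G v" for u v
  proof (rule ccontr)
    note uv = that
    assume nb: "\<not> b < u + a"
    show False
    proof (cases "v + a \<le> b")
      case True
      then show False using inj that nb by (auto simp: G_def dest: inj_onD)
    next
      case False
      consider "u = 0" | "a < u + a" "u + a < b" | "u + a = b" using uv(1) nb by linarith
      then show False
      proof cases
        case 1
        then have "g a = g (v + a)" using that by (simp add: G_def)
        moreover have "g a \<in> \<psi> ` cball 0 1" using str(1) by (auto simp: strand_def)
        ultimately show False using out that False by auto
      next
        case 2
        then show False using sep[OF str(1), of "u + a" "v + a" g] that False by (auto simp: G_def)
      next
        case 3
        then have "g b = g (v + a)" using that by (simp add: G_def)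
        moreover have "g b \<in> \<psi> ` cball 0 1" using str(1) by (auto simp: strand_def)
        ultimately show False using out that False by auto
      qed
    qed
  qed
  have outer': "b < u + a" if "0 \<le> u" "u < v" "v < 1" "G' u = G' v" "\<not> v + a \<le> b" for u v
  proof (rule ccontr)
    note uv = that
    assume nb: "\<not> b < u + a"
    have gv: "g' (v + a) = g (v + a)" using agree that by auto
    consider "u = 0" | "a < u + a" "u + a < b" | "u + a = b" using uv(1) nb by linarith
    then show False
    proof cases
      case 1
      then have "g a = g (v + a)" using that gv ends by (simp add: G'_def)
      moreover have "g a \<in> \<psi> ` cball 0 1" using str(1) by (auto simp: strand_def)
      ultimately show False using out that by auto
    next
      case 2
      then show False using sep[OF str(2), of "u + a" "v + a" g'] that by (auto simp: G'_def)
    next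
      case 3
      then have "g b = g (v + a)" using that gv ends by (simp add: G'_def)
      moreover have "g b \<in> \<psi> ` cball 0 1" using str(1) by (auto simp: strand_def)
      ultimately show False using out that by auto
    qed
  qed
  have eq_out: "G u = G' u" if "b < u + a" "u < 1" for u
    using agree that by (auto simp: G_def G'_def)
  have cd: "chord_diagram G = {{u, v} | u v. 0 \<le> u \<and> u < v \<and> v < 1 \<and> G u = G v}"
    "chord_diagram G' = {{u, v} | u v. 0 \<le> u \<and> u < v \<and> v < 1 \<and> G' u = G' v}"
    using chord_diagram_eq GG by blast+
  have far: "x > b - a" if "d \<in> chord_diagram G" "x \<in> d" for d x
    using that outer unfolding cd by force
  have c_in: "x \<le> b - a" if "x \<in> c" for x using that st by (auto simp: c_def)
  have "c \<notin> chord_diagram G" using far c_in by (force simp: c_def)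
  moreover have "chord_diagram G' = insert c (chord_diagram G)"
  proof (intro equalityI subsetI)
    fix d assume "d \<in> chord_diagram G'"
    then obtain u v where uv: "d = {u, v}" "0 \<le> u" "u < v" "v < 1" "G' u = G' v" unfolding cd by blast
    show "d \<in> insert c (chord_diagram G)"
    proof (cases "v + a \<le> b")
      case True
      then have "u = s - a" "v = t - a" using only[OF uv(2,3) True uv(5)] by auto
      then show ?thesis using uv(1) by (simp add: c_def)
    next
      case False
      then have "b < u + a" using outer' uv by blast
      then have "G u = G v" using eq_out[of u] eq_out[of v] uv by auto
      then show ?thesis using uv unfolding cd by blast
    qed
  next
    fix d assume "d \<in> insert c (chord_diagram G)"
    then consider "d = c" | "d \<in> chord_diagram G" by blast
    then show "d \<in> chord_diagram G'"
    proof cases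
      case 1
      have "0 \<le> s - a" "s - a < t - a" "t - a < 1" "G' (s - a) = G' (t - a)"
        using st ab by (auto simp: G'_def)
      then show ?thesis using 1 unfolding cd c_def by blast
    next
      case 2
      then obtain u v where uv: "d = {u, v}" "0 \<le> u" "u < v" "v < 1" "G u = G v" unfolding cd by blast
      have "b < u + a" using outer uv by blast
      then have "G' u = G' v" using eq_out[of u] eq_out[of v] uv by auto
      then show ?thesis using uv unfolding cd by blast
    qed
  qed
  moreover have "\<not> crosses c d" if "d \<in> insert c (chord_diagram G)" for d
  proof (cases "d = c")
    case True
    have "card c = 2" using st by (simp add: c_def)
    then show ?thesis using crosses_irrefl True by blast
  next
    case False
    then have "d \<in> chord_diagram G" using that by blast
    then have "x < y" if "x \<in> c" "y \<in> d" for x y using far c_in that by (meson le_less_trans)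
    then show ?thesis unfolding crosses_def by (meson less_asym)
  qed
  ultimately have "graph_sum weight4 crosses (chord_diagram G') = graph_sum weight4 crosses (chord_diagram G)"
    using graph_sum_insert_isolated[OF finite_chord_diagram[OF GG(1)]] by simp
  then have "lambda4 G' = lambda4 G" using lambda4_eq_graph_sum GG by metis
  moreover have "G = (\<lambda>t. g (t + a))" "G' = (\<lambda>t. g' (t + a))" by (auto simp: G_def G'_def)
  ultimately show ?thesis
    using lambda4_shift[OF X g, of a] lambda4_shift[OF X g', of a] by simp
qed

lemma RI_invariant:
  assumes X: "surface X"
  shows "invariant_under X (RI X) lambda4"
  unfolding invariant_under_def
proof (intro allI impI, elim conjE)
  fix f f' assume f: "generic_immersion X f" "generic_immersion X f'" and "RI X (range f) (range f')"
  then obtain g g' where g: "generic_immersion X g" "generic_immersion X g'" "range g = range f" "range g' = range f'"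
    and k: "adds_kink X g g' \<or> adds_kink X g' g"
    unfolding RI_def by (elim exE conjE)
  have "lambda4 g = lambda4 g'" using k kink_lambda4[OF X g(1,2)] kink_lambda4[OF X g(2,1)] by auto
  then show "lambda4 f = lambda4 f'"
    using lambda4_same_range[OF X g(1) f(1) g(3)] lambda4_same_range[OF X g(2) f(2) g(4)] by simp
qed

section \<open>Triangle moves\<close>

lemma all_less_3: "(\<forall>i<3::nat. P i) \<longleftrightarrow> P 0 \<and> P 1 \<and> P 2"
proof
  assume P: "P 0 \<and> P 1 \<and> P 2"
  show "\<forall>i<3. P i"
  proof (intro allI impI)
    fix i :: nat assume "i < 3"
    then have "i = 0 \<or> i = 1 \<or> i = 2" by linarith
    then show "P i" using P by blast
  qed
qed simp

text \<open>A chord with no end inside an arc has the whole arc on one of its sides.\<close>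

lemma separates_arc:
  fixes x x' u v :: real
  assumes "a < x" "x < b" "a < x'" "x' < b" "\<not> (a < u \<and> u < b)" "\<not> (a < v \<and> v < b)"
  shows "(u < x \<and> x < v) = (u < x' \<and> x' < v)"
  using assms by linarith

locale triangle_arcs =
  fixes X :: "'a::euclidean_space set" and f :: "real \<Rightarrow> 'a" and \<psi> a b \<sigma>
  assumes f: "generic_immersion X f" and disc: "disc_in X \<psi>"
    and order: "a 0 < b 0" "b 0 < a 1" "a 1 < b 1" "b 1 < a 2" "a 2 < b 2" "b 2 < a 0 + 1"
    and outside: "\<forall>t\<in>{a 0..<a 0 + 1} - (\<Union>i<3. {a i..b i}). f t \<notin> \<psi> ` cball 0 1"
    and triangle: "triangle_in \<psi> f a b \<sigma>"
begin

definition arc :: "real \<Rightarrow> bool" where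
  "arc x \<longleftrightarrow> (a 0 < x \<and> x < b 0) \<or> (a 1 < x \<and> x < b 1) \<or> (a 2 < x \<and> x < b 2)"

definition outer_chords :: "real set set" where
  "outer_chords = {{u, v} | u v. 0 \<le> u \<and> u < v \<and> v < 1 \<and> \<not> arc (u + a 0) \<and> \<not> arc (v + a 0) \<and>
     f (u + a 0) = f (v + a 0)}"

definition inner_chord :: "nat \<Rightarrow> nat \<Rightarrow> real set" where
  "inner_chord i j = {\<sigma> i j - a 0, \<sigma> j i - a 0}"

lemma strands: "strand \<psi> f (a 0) (b 0)" "strand \<psi> f (a 1) (b 1)" "strand \<psi> f (a 2) (b 2)"
  and injective: "inj_on f {a 0..b 0}" "inj_on f {a 1..b 1}" "inj_on f {a 2..b 2}"
  using triangle unfolding triangle_in_def all_less_3 by blast+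

lemma sigma_range:
  "a 0 < \<sigma> 0 1" "\<sigma> 0 1 < b 0" "a 0 < \<sigma> 0 2" "\<sigma> 0 2 < b 0" "a 1 < \<sigma> 1 0" "\<sigma> 1 0 < b 1"
  "a 1 < \<sigma> 1 2" "\<sigma> 1 2 < b 1" "a 2 < \<sigma> 2 0" "\<sigma> 2 0 < b 2" "a 2 < \<sigma> 2 1" "\<sigma> 2 1 < b 2"
  using triangle unfolding triangle_in_def all_less_3 by simp_all

lemma crossings:
  "{(u, v). u \<in> {a 0..b 0} \<and> v \<in> {a 1..b 1} \<and> f u = f v} = {(\<sigma> 0 1, \<sigma> 1 0)}"
  "{(u, v). u \<in> {a 0..b 0} \<and> v \<in> {a 2..b 2} \<and> f u = f v} = {(\<sigma> 0 2, \<sigma> 2 0)}"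
  "{(u, v). u \<in> {a 1..b 1} \<and> v \<in> {a 2..b 2} \<and> f u = f v} = {(\<sigma> 1 2, \<sigma> 2 1)}"
  using triangle unfolding triangle_in_def all_less_3 by (simp_all del: atLeastAtMost_iff)

lemma crossing_unique:
  "a 0 \<le> u \<Longrightarrow> u \<le> b 0 \<Longrightarrow> a 1 \<le> v \<Longrightarrow> v \<le> b 1 \<Longrightarrow> f u = f v \<Longrightarrow> u = \<sigma> 0 1 \<and> v = \<sigma> 1 0"
  "a 0 \<le> u \<Longrightarrow> u \<le> b 0 \<Longrightarrow> a 2 \<le> v \<Longrightarrow> v \<le> b 2 \<Longrightarrow> f u = f v \<Longrightarrow> u = \<sigma> 0 2 \<and> v = \<sigma> 2 0"
  "a 1 \<le> u \<Longrightarrow> u \<le> b 1 \<Longrightarrow> a 2 \<le> v \<Longrightarrow> v \<le> b 2 \<Longrightarrow> f u = f v \<Longrightarrow> u = \<sigma> 1 2 \<and> v = \<sigma> 2 1"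
  using crossings by (auto simp: set_eq_iff)

lemma crossing_eq: "f (\<sigma> 0 1) = f (\<sigma> 1 0)" "f (\<sigma> 0 2) = f (\<sigma> 2 0)" "f (\<sigma> 1 2) = f (\<sigma> 2 1)"
proof -
  have "(\<sigma> 0 1, \<sigma> 1 0) \<in> {(u, v). u \<in> {a 0..b 0} \<and> v \<in> {a 1..b 1} \<and> f u = f v}" unfolding crossings by simp
  then show "f (\<sigma> 0 1) = f (\<sigma> 1 0)" by simp
  have "(\<sigma> 0 2, \<sigma> 2 0) \<in> {(u, v). u \<in> {a 0..b 0} \<and> v \<in> {a 2..b 2} \<and> f u = f v}" unfolding crossings by simp
  then show "f (\<sigma> 0 2) = f (\<sigma> 2 0)" by simp
  have "(\<sigma> 1 2, \<sigma> 2 1) \<in> {(u, v). u \<in> {a 1..b 1} \<and> v \<in> {a 2..b 2} \<and> f u = f v}" unfolding crossings by simp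
  then show "f (\<sigma> 1 2) = f (\<sigma> 2 1)" by simp
qed

text \<open>Being on one of the three arcs is thereby a property of the point and not of the
  parameter, so a double point has both its parameters on the arcs or neither.\<close>

lemma arc_iff:
  assumes "a 0 \<le> x" "x < a 0 + 1"
  shows "arc x \<longleftrightarrow> f x \<in> \<psi> ` ball 0 1"
proof
  assume "arc x"
  then show "f x \<in> \<psi> ` ball 0 1" using strands unfolding strand_def arc_def by (elim disjE) auto
next
  have disj: "\<psi> ` ball 0 1 \<inter> \<psi> ` sphere 0 1 = {}"
  proof -
    have "inj_on \<psi> (cball 0 1)" using disc by (simp add: disc_in_def)
    moreover have "ball (0::complex) 1 \<inter> sphere 0 1 = {}" "ball (0::complex) 1 \<subseteq> cball 0 1" "sphere (0::complex) 1 \<subseteq> cball 0 1"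
      by auto
    ultimately show ?thesis using inj_on_image_Int by (metis image_empty)
  qed
  assume ball: "f x \<in> \<psi> ` ball 0 1"
  show "arc x"
  proof (rule ccontr)
    assume "\<not> arc x"
    then have "x \<in> {a 0, b 0, a 1, b 1, a 2, b 2} \<or>
        \<not> (a 0 \<le> x \<and> x \<le> b 0) \<and> \<not> (a 1 \<le> x \<and> x \<le> b 1) \<and> \<not> (a 2 \<le> x \<and> x \<le> b 2)"
      unfolding arc_def by auto
    then consider "x \<in> {a 0, b 0, a 1, b 1, a 2, b 2}" | "\<forall>i<3. \<not> (a i \<le> x \<and> x \<le> b i)"
      unfolding all_less_3 by blast
    then show False
    proof cases
      case 1
      then have "f x \<in> \<psi> ` sphere 0 1" using strands unfolding strand_def by blast
      then show False using ball disj by blast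
    next
      case 2
      then have "f x \<notin> \<psi> ` cball 0 1" using outside assms by auto
      moreover have "\<psi> ` ball 0 1 \<subseteq> \<psi> ` cball 0 1" by (intro image_mono) auto
      ultimately show False using ball by blast
    qed
  qed
qed

lemma double_pair:
  assumes uv: "a 0 \<le> u" "u < v" "v < a 0 + 1" "f u = f v" "arc u"
  shows "(u, v) \<in> {(\<sigma> 0 1, \<sigma> 1 0), (\<sigma> 0 2, \<sigma> 2 0), (\<sigma> 1 2, \<sigma> 2 1)}"
proof -
  have "arc v" using arc_iff[of u] arc_iff[of v] uv by simp
  have inj: "\<not> (l < u \<and> u < r \<and> l < v \<and> v < r)" if "inj_on f {l..r}" for l r
    using that uv(2,4) by (auto dest: inj_onD)
  consider "a 0 < u" "u < b 0" "a 1 < v" "v < b 1" | "a 0 < u" "u < b 0" "a 2 < v" "v < b 2"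
    | "a 1 < u" "u < b 1" "a 2 < v" "v < b 2"
  proof -
    have "\<not> (a 1 < u \<and> v < b 0)" "\<not> (a 2 < u \<and> v < b 0)" "\<not> (a 2 < u \<and> v < b 1)"
      using order uv(2) by linarith+
    then show ?thesis
      using uv(5) \<open>arc v\<close> inj[OF injective(1)] inj[OF injective(2)] inj[OF injective(3)] that
      unfolding arc_def by blast
  qed
  then show ?thesis
  proof cases
    case 1 then show ?thesis using crossing_unique(1)[of u v] uv(4) by simp
  next
    case 2 then show ?thesis using crossing_unique(2)[of u v] uv(4) by simp
  next
    case 3 then show ?thesis using crossing_unique(3)[of u v] uv(4) by simp
  qed
qed

lemma chord_diagram_triangle:
  "chord_diagram (\<lambda>t. f (t + a 0)) = outer_chords \<union> {inner_chord 0 1, inner_chord 0 2, inner_chord 1 2}"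
  unfolding chord_diagram_shift[OF f]
proof (intro equalityI subsetI)
  fix d assume "d \<in> {{u, v} | u v. 0 \<le> u \<and> u < v \<and> v < 1 \<and> f (u + a 0) = f (v + a 0)}"
  then obtain u v where uv: "d = {u, v}" "0 \<le> u" "u < v" "v < 1" "f (u + a 0) = f (v + a 0)" by blast
  have same: "arc (u + a 0) \<longleftrightarrow> arc (v + a 0)"
    using arc_iff[of "u + a 0"] arc_iff[of "v + a 0"] uv by simp
  show "d \<in> outer_chords \<union> {inner_chord 0 1, inner_chord 0 2, inner_chord 1 2}"
  proof (cases "arc (u + a 0)")
    case True
    have "(u + a 0, v + a 0) \<in> {(\<sigma> 0 1, \<sigma> 1 0), (\<sigma> 0 2, \<sigma> 2 0), (\<sigma> 1 2, \<sigma> 2 1)}"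
      by (rule double_pair) (use uv True in auto)
    then have "(u, v) \<in> {(\<sigma> 0 1 - a 0, \<sigma> 1 0 - a 0), (\<sigma> 0 2 - a 0, \<sigma> 2 0 - a 0), (\<sigma> 1 2 - a 0, \<sigma> 2 1 - a 0)}"
      by (auto simp: eq_diff_eq)
    then show ?thesis using uv(1) unfolding inner_chord_def by auto
  next
    case False
    then show ?thesis using uv same unfolding outer_chords_def by blast
  qed
next
  fix d assume "d \<in> outer_chords \<union> {inner_chord 0 1, inner_chord 0 2, inner_chord 1 2}"
  then consider "d \<in> outer_chords" | "d = inner_chord 0 1" | "d = inner_chord 0 2" | "d = inner_chord 1 2" by blast
  then show "d \<in> {{u, v} | u v. 0 \<le> u \<and> u < v \<and> v < 1 \<and> f (u + a 0) = f (v + a 0)}"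
  proof cases
    case 1
    then show ?thesis unfolding outer_chords_def by blast
  next
    case 2
    have "0 \<le> \<sigma> 0 1 - a 0" "\<sigma> 0 1 - a 0 < \<sigma> 1 0 - a 0" "\<sigma> 1 0 - a 0 < 1"
      "f (\<sigma> 0 1 - a 0 + a 0) = f (\<sigma> 1 0 - a 0 + a 0)"
      using sigma_range order crossing_eq by simp_all
    then show ?thesis using 2 unfolding inner_chord_def by blast
  next
    case 3
    have "0 \<le> \<sigma> 0 2 - a 0" "\<sigma> 0 2 - a 0 < \<sigma> 2 0 - a 0" "\<sigma> 2 0 - a 0 < 1"
      "f (\<sigma> 0 2 - a 0 + a 0) = f (\<sigma> 2 0 - a 0 + a 0)"
      using sigma_range order crossing_eq by simp_all
    then show ?thesis using 3 unfolding inner_chord_def by blast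
  next
    case 4
    have "0 \<le> \<sigma> 1 2 - a 0" "\<sigma> 1 2 - a 0 < \<sigma> 2 1 - a 0" "\<sigma> 2 1 - a 0 < 1"
      "f (\<sigma> 1 2 - a 0 + a 0) = f (\<sigma> 2 1 - a 0 + a 0)"
      using sigma_range order crossing_eq by simp_all
    then show ?thesis using 4 unfolding inner_chord_def by blast
  qed
qed

lemma inner_arcs: "arc (\<sigma> 0 1)" "arc (\<sigma> 1 0)" "arc (\<sigma> 0 2)" "arc (\<sigma> 2 0)" "arc (\<sigma> 1 2)" "arc (\<sigma> 2 1)"
  unfolding arc_def using sigma_range by blast+

lemma inner_not_outer: "inner_chord 0 1 \<notin> outer_chords" "inner_chord 0 2 \<notin> outer_chords" "inner_chord 1 2 \<notin> outer_chords"
proof -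
  have na: "\<not> arc (x + a 0)" if "d \<in> outer_chords" "x \<in> d" for d x using that unfolding outer_chords_def by blast
  have "\<sigma> i j - a 0 \<in> inner_chord i j" for i j by (simp add: inner_chord_def)
  from na[OF _ this] inner_arcs
  show "inner_chord 0 1 \<notin> outer_chords" "inner_chord 0 2 \<notin> outer_chords" "inner_chord 1 2 \<notin> outer_chords"
    by force+
qed

lemma inner_distinct: "distinct [inner_chord 0 1, inner_chord 0 2, inner_chord 1 2]"
  using sigma_range order unfolding inner_chord_def by (auto simp: doubleton_eq_iff)

text \<open>The truth values record which arcs lie between the ends of \<open>d\<close>; sample
  points on the arcs determine them. A chord that joins two arcs crosses \<open>d\<close> when their
  values differ, so \<open>d\<close> crosses an even number of the three. The exact ends of the
  joining chords do not enter, and the same values therefore serve before and after the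
  move.\<close>

lemma outer_crosses:
  assumes d: "d \<in> outer_chords"
    and x: "a 0 < x0" "x0 < b 0" "a 1 < x1" "x1 < b 1" "a 2 < x2" "x2 < b 2"
  shows "\<exists>p q r :: bool.
      (\<forall>x\<in>{a 0<..<b 0}. \<forall>y\<in>{a 1<..<b 1}. crosses {x - a 0, y - a 0} d \<longleftrightarrow> p \<noteq> q) \<and>
      (\<forall>x\<in>{a 0<..<b 0}. \<forall>y\<in>{a 2<..<b 2}. crosses {x - a 0, y - a 0} d \<longleftrightarrow> p \<noteq> r) \<and>
      (\<forall>x\<in>{a 1<..<b 1}. \<forall>y\<in>{a 2<..<b 2}. crosses {x - a 0, y - a 0} d \<longleftrightarrow> q \<noteq> r)"
proof -
  obtain u v where uv: "d = {u, v}" "u < v" "\<not> arc (u + a 0)" "\<not> arc (v + a 0)"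
    using d unfolding outer_chords_def by blast
  define S where "S x \<longleftrightarrow> u + a 0 < x \<and> x < v + a 0" for x
  have cr: "crosses {x - a 0, y - a 0} d \<longleftrightarrow> S x \<noteq> S y" if xy: "x < y" "arc x" "arc y" for x y
  proof -
    have "{u, v} \<inter> {x - a 0, y - a 0} = {}" using uv(3,4) xy(2,3) by (auto simp: diff_add_cancel)
    from crosses_iff_separates[OF uv(2) _ this] xy(1)
    have "crosses {u, v} {x - a 0, y - a 0} \<longleftrightarrow> (u < x - a 0 \<and> x - a 0 < v) \<noteq> (u < y - a 0 \<and> y - a 0 < v)"
      by simp
    then show ?thesis unfolding uv(1) S_def crosses_sym[of "{x - a 0, y - a 0}"] by (simp add: less_diff_eq diff_less_eq)
  qed
  have S0: "S x = S x0" if "a 0 < x" "x < b 0" for x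
    unfolding S_def by (rule separates_arc[OF that x(1,2)]) (use uv(3,4) in \<open>auto simp: arc_def\<close>)
  have S1: "S x = S x1" if "a 1 < x" "x < b 1" for x
    unfolding S_def by (rule separates_arc[OF that x(3,4)]) (use uv(3,4) in \<open>auto simp: arc_def\<close>)
  have S2: "S x = S x2" if "a 2 < x" "x < b 2" for x
    unfolding S_def by (rule separates_arc[OF that x(5,6)]) (use uv(3,4) in \<open>auto simp: arc_def\<close>)
  show ?thesis
  proof (rule exI[of _ "S x0"], rule exI[of _ "S x1"], rule exI[of _ "S x2"], intro conjI ballI)
    show "crosses {x - a 0, y - a 0} d \<longleftrightarrow> S x0 \<noteq> S x1" if "x \<in> {a 0<..<b 0}" "y \<in> {a 1<..<b 1}" for x y
      using cr[of x y] S0[of x] S1[of y] that order unfolding arc_def by simp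
    show "crosses {x - a 0, y - a 0} d \<longleftrightarrow> S x0 \<noteq> S x2" if "x \<in> {a 0<..<b 0}" "y \<in> {a 2<..<b 2}" for x y
      using cr[of x y] S0[of x] S2[of y] that order unfolding arc_def by simp
    show "crosses {x - a 0, y - a 0} d \<longleftrightarrow> S x1 \<noteq> S x2" if "x \<in> {a 1<..<b 1}" "y \<in> {a 2<..<b 2}" for x y
      using cr[of x y] S1[of x] S2[of y] that order unfolding arc_def by simp
  qed
qed

text \<open>Two of the three chords have one arc in common, and their other ends lie on different
  arcs in a fixed order. So only the order of the two crossings on the common arc decides.\<close>

lemma inner_crosses:
  "crosses (inner_chord 0 1) (inner_chord 0 2) \<longleftrightarrow> \<sigma> 0 1 < \<sigma> 0 2"
  "crosses (inner_chord 0 1) (inner_chord 1 2) \<longleftrightarrow> \<sigma> 1 2 < \<sigma> 1 0"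
  "crosses (inner_chord 0 2) (inner_chord 1 2) \<longleftrightarrow> \<sigma> 2 0 < \<sigma> 2 1"
  unfolding inner_chord_def using sigma_range order by (subst crosses_doubleton; linarith)+

end

text \<open>Coherence of the triangle means that the three order conditions in
  \<open>inner_crosses\<close> hold together or fail together. The three chords are thus pairwise
  disjoint in position on one side of the move and pairwise crossing on the other.\<close>

lemma triangle_flip_lambda4:
  assumes X: "surface X" and T: "triangle_arcs X g \<psi> a b \<sigma>" and T': "triangle_arcs X g' \<psi> a b \<tau>"
    and agree: "\<forall>t\<in>{a 0..a 0 + 1} - (\<Union>i<3. {a i<..<b i}). g' t = g t"
    and nested: "\<sigma> 0 2 < \<sigma> 0 1" "\<sigma> 1 0 < \<sigma> 1 2" "\<sigma> 2 1 < \<sigma> 2 0"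
    and crossed: "\<tau> 0 1 < \<tau> 0 2" "\<tau> 1 2 < \<tau> 1 0" "\<tau> 2 0 < \<tau> 2 1"
  shows "lambda4 g = lambda4 g'"
proof -
  interpret T: triangle_arcs X g \<psi> a b \<sigma> by (fact T)
  interpret T': triangle_arcs X g' \<psi> a b \<tau> by (fact T')
  have agree': "g' (u + a 0) = g (u + a 0)" if "\<not> T.arc (u + a 0)" "0 \<le> u" "u < 1" for u
  proof -
    have "\<forall>i<3. \<not> (a i < u + a 0 \<and> u + a 0 < b i)" unfolding all_less_3 using that(1) by (simp add: T.arc_def)
    then show ?thesis using agree that(2,3) by auto
  qed
  have "(0 \<le> u \<and> u < v \<and> v < 1 \<and> \<not> T.arc (u + a 0) \<and> \<not> T.arc (v + a 0) \<and> g' (u + a 0) = g' (v + a 0)) \<longleftrightarrow>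
      (0 \<le> u \<and> u < v \<and> v < 1 \<and> \<not> T.arc (u + a 0) \<and> \<not> T.arc (v + a 0) \<and> g (u + a 0) = g (v + a 0))" for u v
    using agree'[of u] agree'[of v] by auto
  then have outer_eq: "T'.outer_chords = T.outer_chords"
    unfolding T.outer_chords_def T'.outer_chords_def by (simp only:)
  let ?A = "T.inner_chord 0 1" and ?B = "T.inner_chord 0 2" and ?C = "T.inner_chord 1 2"
  let ?A' = "T'.inner_chord 0 1" and ?B' = "T'.inner_chord 0 2" and ?C' = "T'.inner_chord 1 2"
  let ?V = "T.outer_chords"
  \<comment> \<open>\<open>F\<close> replaces the chords of the triangle and fixes all others;
    \<open>E'\<close> is the crossing relation after the move, pulled back to the chords before
    it.\<close>
  define F where "F x = (if x = ?A then ?A' else if x = ?B then ?B' else if x = ?C then ?C' else x)" for x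
  have F: "F ?A = ?A'" "F ?B = ?B'" "F ?C = ?C'" using T.inner_distinct by (auto simp: F_def)
  have FV: "F d = d" if "d \<in> ?V" for d using that T.inner_not_outer by (auto simp: F_def)
  \<comment> \<open>The clause \<open>x \<noteq> y\<close> makes both relations irreflexive on all
    sets, as \<open>graph_sum_strong_RIII\<close> asks; on chords it changes nothing.\<close>
  define E E' where "E x y \<longleftrightarrow> x \<noteq> y \<and> crosses x y" and "E' x y \<longleftrightarrow> x \<noteq> y \<and> crosses (F x) (F y)" for x y
  have cs: "chord_set (?V \<union> {?A, ?B, ?C})" "chord_set (?V \<union> {?A', ?B', ?C'})"
    using chord_set_chord_diagram[OF generic_immersion_shift[OF T.f, of "a 0"]]
      chord_set_chord_diagram[OF generic_immersion_shift[OF T'.f, of "a 0"]]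
    unfolding T.chord_diagram_triangle T'.chord_diagram_triangle outer_eq by simp_all
  have irr: "\<not> crosses x x" if "x \<in> ?V \<union> {?A, ?B, ?C} \<or> x \<in> ?V \<union> {?A', ?B', ?C'}" for x
    using that cs crosses_irrefl unfolding chord_set_def by blast
  have FM: "F x \<in> ?V \<union> {?A', ?B', ?C'}" if "x \<in> ?V \<union> {?A, ?B, ?C}" for x
    using that F FV by auto
  have "graph_sum weight4 E (?V \<union> {?A, ?B, ?C}) = graph_sum weight4 crosses (?V \<union> {?A, ?B, ?C})"
    using graph_sum_bij[of id "?V \<union> {?A, ?B, ?C}" "?V \<union> {?A, ?B, ?C}" E crosses] irr by (auto simp: E_def)
  moreover have "graph_sum weight4 crosses (?V \<union> {?A', ?B', ?C'}) = graph_sum weight4 E' (?V \<union> {?A, ?B, ?C})"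
  proof (rule graph_sum_bij)
    show "bij_betw F (?V \<union> {?A, ?B, ?C}) (?V \<union> {?A', ?B', ?C'})"
    proof (rule bij_betw_imageI)
      have "F ` ?V = ?V" using FV by simp
      then show "F ` (?V \<union> {?A, ?B, ?C}) = ?V \<union> {?A', ?B', ?C'}" using F by (simp add: image_Un)
      have i1: "x = y" if "x \<in> ?V" "y \<in> ?V" "F x = F y" for x y using FV that by metis
      have i2: "x = y" if "x \<in> {?A, ?B, ?C}" "y \<in> {?A, ?B, ?C}" "F x = F y" for x y
        using that F T'.inner_distinct by auto
      have i3: "F x \<noteq> F y" if "x \<in> ?V" "y \<in> {?A, ?B, ?C}" for x y
        using that F FV[OF that(1)] T'.inner_not_outer unfolding outer_eq by auto
      show "inj_on F (?V \<union> {?A, ?B, ?C})"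
      proof (rule inj_onI)
        fix x y assume xy: "x \<in> ?V \<union> {?A, ?B, ?C}" "y \<in> ?V \<union> {?A, ?B, ?C}" and eq: "F x = F y"
        show "x = y"
        proof (cases "x \<in> ?V")
          case True
          then have "y \<in> ?V" using i3[OF True] xy(2) eq by blast
          then show ?thesis using i1[OF True _ eq] by blast
        next
          case False
          then have x: "x \<in> {?A, ?B, ?C}" using xy(1) by blast
          then have "y \<in> {?A, ?B, ?C}" using i3[OF _ x] xy(2) eq by (metis UnE)
          then show ?thesis using i2[OF x _ eq] by blast
        qed
      qed
    qed
    show "crosses (F x) (F y) = E' x y" if "x \<in> ?V \<union> {?A, ?B, ?C}" "y \<in> ?V \<union> {?A, ?B, ?C}" for x y
      using irr FM[OF that(1)] by (auto simp: E'_def)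
  qed
  moreover have "graph_sum weight4 E' (?V \<union> {?A, ?B, ?C}) = graph_sum weight4 E (?V \<union> {?A, ?B, ?C})"
  proof (rule graph_sum_strong_RIII)
    show "finite ?V" using cs(1) by (simp add: chord_set_def)
    show "distinct [?A, ?B, ?C]" by (rule T.inner_distinct)
    show "?A \<notin> ?V" "?B \<notin> ?V" "?C \<notin> ?V" by (rule T.inner_not_outer)+
    show "E x y = E y x" "E' x y = E' y x" for x y using crosses_sym by (auto simp: E_def E'_def)
    show "\<not> E x x" "\<not> E' x x" for x by (simp_all add: E_def E'_def)
    show "\<not> E ?A ?B" "\<not> E ?A ?C" "\<not> E ?B ?C"
      unfolding E_def T.inner_crosses using nested by auto
    show "E' ?A ?B" "E' ?A ?C" "E' ?B ?C"
      unfolding E'_def F T'.inner_crosses using crossed T.inner_distinct by auto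
    fix d assume d: "d \<in> ?V"
    from T.outer_crosses[OF d T.sigma_range(1,2,5,6,9,10)] obtain p q r :: bool where pqr:
      "\<forall>x\<in>{a 0<..<b 0}. \<forall>y\<in>{a 1<..<b 1}. crosses {x - a 0, y - a 0} d \<longleftrightarrow> p \<noteq> q"
      "\<forall>x\<in>{a 0<..<b 0}. \<forall>y\<in>{a 2<..<b 2}. crosses {x - a 0, y - a 0} d \<longleftrightarrow> p \<noteq> r"
      "\<forall>x\<in>{a 1<..<b 1}. \<forall>y\<in>{a 2<..<b 2}. crosses {x - a 0, y - a 0} d \<longleftrightarrow> q \<noteq> r"
      by (elim exE conjE)
    have c: "crosses ?A d \<longleftrightarrow> p \<noteq> q" "crosses ?B d \<longleftrightarrow> p \<noteq> r" "crosses ?C d \<longleftrightarrow> q \<noteq> r"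
      unfolding T.inner_chord_def
      by (rule pqr[rule_format]; use T.sigma_range in simp)+
    have c': "crosses ?A' d \<longleftrightarrow> p \<noteq> q" "crosses ?B' d \<longleftrightarrow> p \<noteq> r" "crosses ?C' d \<longleftrightarrow> q \<noteq> r"
      unfolding T'.inner_chord_def
      by (rule pqr[rule_format]; use T'.sigma_range in simp)+
    have neq: "?A \<noteq> d" "?B \<noteq> d" "?C \<noteq> d" using d T.inner_not_outer by auto
    show "two_or_none (E ?A d) (E ?B d) (E ?C d)"
      unfolding E_def c two_or_none_def using neq by blast
    have "E' ?A d = E ?A d" "E' ?B d = E ?B d" "E' ?C d = E ?C d"
      unfolding E_def E'_def F FV[OF d] c c' by (rule refl)+
    moreover have "E' x d = E x d" if "x \<in> ?V" for x
      unfolding E_def E'_def FV[OF d] FV[OF that] by (rule refl)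
    ultimately show "E' x d = E x d" if "x \<in> ?V \<union> {?A, ?B, ?C}" for x
      using that by blast
  qed
  ultimately have "graph_sum weight4 crosses (?V \<union> {?A', ?B', ?C'}) = graph_sum weight4 crosses (?V \<union> {?A, ?B, ?C})"
    by simp
  then have "lambda4 (\<lambda>t. g' (t + a 0)) = lambda4 (\<lambda>t. g (t + a 0))"
    unfolding lambda4_eq_graph_sum[OF generic_immersion_shift[OF T.f]]
      lambda4_eq_graph_sum[OF generic_immersion_shift[OF T'.f]]
      T.chord_diagram_triangle T'.chord_diagram_triangle outer_eq .
  then show ?thesis using lambda4_shift[OF X T.f] lambda4_shift[OF X T'.f] by simp
qed

lemma strong_RIII_invariant:
  assumes X: "surface X"
  shows "invariant_under X (strong_RIII X) lambda4"
  unfolding invariant_under_def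
proof (intro allI impI, elim conjE)
  fix f f' assume f: "generic_immersion X f" "generic_immersion X f'" and "strong_RIII X (range f) (range f')"
  then obtain g g' \<psi> a b \<sigma> \<tau> where g: "generic_immersion X g" "generic_immersion X g'" "range g = range f" "range g' = range f'"
    and disc: "disc_in X \<psi>"
    and order: "a 0 < b 0" "b 0 < a 1" "a 1 < b 1" "b 1 < a 2" "a 2 < b 2" "b 2 < a 0 + 1"
    and agree: "\<forall>t\<in>{a 0..a 0 + 1} - (\<Union>i<3. {a i<..<b i}). g' t = g t"
    and out: "\<forall>t\<in>{a 0..<a 0 + 1} - (\<Union>i<3. {a i..b i}). g t \<notin> \<psi> ` cball 0 1"
    and tri: "triangle_in \<psi> g a b \<sigma>" "triangle_in \<psi> g' a b \<tau>"
    and flip: "\<forall>i<3. \<forall>j<3. \<forall>k<3. i \<noteq> j \<and> j \<noteq> k \<and> i \<noteq> k \<longrightarrow> (\<sigma> i j < \<sigma> i k \<longleftrightarrow> \<tau> i k < \<tau> i j)"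
    and coh: "coherent \<sigma>"
    unfolding strong_RIII_def by (elim exE conjE)
  have out': "\<forall>t\<in>{a 0..<a 0 + 1} - (\<Union>i<3. {a i..b i}). g' t \<notin> \<psi> ` cball 0 1"
  proof
    fix t assume t: "t \<in> {a 0..<a 0 + 1} - (\<Union>i<3. {a i..b i})"
    then have "t \<in> {a 0..a 0 + 1} - (\<Union>i<3. {a i<..<b i})" by fastforce
    then have "g' t = g t" using agree by blast
    then show "g' t \<notin> \<psi> ` cball 0 1" using out t by simp
  qed
  have agree': "\<forall>t\<in>{a 0..a 0 + 1} - (\<Union>i<3. {a i<..<b i}). g t = g' t" using agree by simp
  have T: "triangle_arcs X g \<psi> a b \<sigma>" using g disc order out tri by unfold_locales
  have T': "triangle_arcs X g' \<psi> a b \<tau>" using g disc order out' tri by unfold_locales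
  have fl: "\<sigma> 0 1 < \<sigma> 0 2 \<longleftrightarrow> \<tau> 0 2 < \<tau> 0 1" "\<sigma> 0 2 < \<sigma> 0 1 \<longleftrightarrow> \<tau> 0 1 < \<tau> 0 2"
    "\<sigma> 1 0 < \<sigma> 1 2 \<longleftrightarrow> \<tau> 1 2 < \<tau> 1 0" "\<sigma> 1 2 < \<sigma> 1 0 \<longleftrightarrow> \<tau> 1 0 < \<tau> 1 2"
    "\<sigma> 2 0 < \<sigma> 2 1 \<longleftrightarrow> \<tau> 2 1 < \<tau> 2 0" "\<sigma> 2 1 < \<sigma> 2 0 \<longleftrightarrow> \<tau> 2 0 < \<tau> 2 1"
    using flip unfolding all_less_3 by simp_all
  have "lambda4 g = lambda4 g'"
    using coh unfolding coherent_def
  proof (elim disjE conjE)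
    assume "\<sigma> 0 2 < \<sigma> 0 1" "\<sigma> 1 0 < \<sigma> 1 2" "\<sigma> 2 1 < \<sigma> 2 0"
    then show ?thesis using triangle_flip_lambda4[OF X T T' agree] fl by blast
  next
    \<comment> \<open>The second coherent orientation is the inverse move, with the crossing triple
      before it.\<close>
    assume "\<sigma> 0 1 < \<sigma> 0 2" "\<sigma> 1 2 < \<sigma> 1 0" "\<sigma> 2 0 < \<sigma> 2 1"
    then have "lambda4 g' = lambda4 g" using triangle_flip_lambda4[OF X T' T agree'] fl by blast
    then show ?thesis ..
  qed
  then show "lambda4 f = lambda4 f'"
    using lambda4_same_range[OF X g(1) f(1) g(3)] lambda4_same_range[OF X g(2) f(2) g(4)] by simp
qed

section \<open>Closed braids on the sphere\<close>

text \<open>A class of functions that is closed under differentiation, so that derivatives of all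
  orders are obtained by iteration.\<close>

inductive elementary :: "(real \<Rightarrow> real) \<Rightarrow> bool" where
  "elementary (\<lambda>t. c)"
| "elementary (\<lambda>t. t)"
| "elementary u \<Longrightarrow> elementary v \<Longrightarrow> elementary (\<lambda>t. u t + v t)"
| "elementary u \<Longrightarrow> elementary v \<Longrightarrow> elementary (\<lambda>t. u t * v t)"
| "elementary u \<Longrightarrow> elementary (\<lambda>t. sin (u t))"
| "elementary u \<Longrightarrow> elementary (\<lambda>t. cos (u t))"

lemma elementary_derivative:
  assumes "elementary u"
  shows "\<exists>u'. elementary u' \<and> (\<forall>t. (u has_real_derivative u' t) (at t))"
  using assms
proof induction
  case (1 c)
  have "((\<lambda>t. c) has_real_derivative 0) (at t)" for t by simp
  then show ?case using elementary.intros(1)[of 0] by blast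
next
  case 2
  have "((\<lambda>t. t) has_real_derivative 1) (at t)" for t by simp
  then show ?case using elementary.intros(1)[of 1] by blast
next
  case (3 u v)
  then obtain u' v' where d: "elementary u'" "elementary v'" "\<And>t. (u has_real_derivative u' t) (at t)"
    "\<And>t. (v has_real_derivative v' t) (at t)" by blast
  have "((\<lambda>t. u t + v t) has_real_derivative u' t + v' t) (at t)" for t by (intro DERIV_add d)
  then show ?case using elementary.intros(3)[OF d(1,2)] by blast
next
  case (4 u v)
  then obtain u' v' where d: "elementary u'" "elementary v'" "\<And>t. (u has_real_derivative u' t) (at t)"
    "\<And>t. (v has_real_derivative v' t) (at t)" by blast
  have "((\<lambda>t. u t * v t) has_real_derivative u' t * v t + v' t * u t) (at t)" for t by (intro DERIV_mult d)
  moreover have "elementary (\<lambda>t. u' t * v t + v' t * u t)" by (intro elementary.intros d 4)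
  ultimately show ?case by blast
next
  case (5 u)
  then obtain u' where d: "elementary u'" "\<And>t. (u has_real_derivative u' t) (at t)" by blast
  have "((\<lambda>t. sin (u t)) has_real_derivative cos (u t) * u' t) (at t)" for t
    by (rule DERIV_chain2[OF DERIV_sin d(2)])
  moreover have "elementary (\<lambda>t. cos (u t) * u' t)" by (intro elementary.intros d 5)
  ultimately show ?case by blast
next
  case (6 u)
  then obtain u' where d: "elementary u'" "\<And>t. (u has_real_derivative u' t) (at t)" by blast
  have "((\<lambda>t. cos (u t)) has_real_derivative - sin (u t) * u' t) (at t)" for t
    by (rule DERIV_chain2[OF DERIV_cos d(2)])
  moreover have "elementary (\<lambda>t. (-1) * sin (u t) * u' t)" by (intro elementary.intros d 6)
  ultimately show ?case by (intro exI[of _ "\<lambda>t. (-1) * sin (u t) * u' t"]) simp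
qed

lemma elementary_power: "elementary u \<Longrightarrow> elementary (\<lambda>t. u t ^ n)"
proof (induction n)
  case (Suc n)
  then show ?case using elementary.intros(4)[of u "\<lambda>t. u t ^ n"] by simp
qed (simp add: elementary.intros(1))

lemma smooth_elementary:
  fixes e1 e2 e3 :: "'a::real_normed_vector"
  assumes "elementary x" "elementary y" "elementary z"
  shows "smooth (\<lambda>t. x t *\<^sub>R e1 + y t *\<^sub>R e2 + z t *\<^sub>R e3)"
proof -
  obtain d where d: "\<And>u. elementary u \<Longrightarrow> elementary (d u) \<and> (\<forall>t. (u has_real_derivative d u t) (at t))"
    using elementary_derivative by metis
  have el: "elementary ((d ^^ n) u)" if "elementary u" for u n
    by (induction n) (use that d in auto)
  have der: "((d ^^ n) u has_vector_derivative (d ^^ Suc n) u t) (at t)" if "elementary u" for u n t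
    using d[OF el[OF that, of n]] by (simp add: has_real_derivative_iff_has_vector_derivative)
  show ?thesis
    unfolding smooth_def
  proof (intro exI conjI allI)
    show "((\<lambda>t. (d ^^ n) x t *\<^sub>R e1 + (d ^^ n) y t *\<^sub>R e2 + (d ^^ n) z t *\<^sub>R e3) has_vector_derivative
      (\<lambda>n t. (d ^^ n) x t *\<^sub>R e1 + (d ^^ n) y t *\<^sub>R e2 + (d ^^ n) z t *\<^sub>R e3) (Suc n) t) (at t)" for n t
      using der[OF assms(1), of n t] der[OF assms(2), of n t] der[OF assms(3), of n t]
      by (intro has_vector_derivative_add bounded_linear.has_vector_derivative[OF bounded_linear_scaleR_left])
  qed simp
qed

text \<open>A closed braid of \<open>p\<close> strands winding around the axis of the sphere, of latitude \<open>f\<close>.\<close>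

definition braid_curve :: "nat \<Rightarrow> (real \<Rightarrow> real) \<Rightarrow> real \<Rightarrow> real^3" where
  "braid_curve p f t = (cos (f t) * cos (2 * pi * p * t)) *\<^sub>R axis 1 1
     + (cos (f t) * sin (2 * pi * p * t)) *\<^sub>R axis 2 1 + sin (f t) *\<^sub>R axis 3 1"

lemma braid_curve_components:
  "braid_curve p f t $ 1 = cos (f t) * cos (2 * pi * p * t)"
  "braid_curve p f t $ 2 = cos (f t) * sin (2 * pi * p * t)"
  "braid_curve p f t $ 3 = sin (f t)"
  by (simp_all add: braid_curve_def axis_def)

section \<open>Coincidences and transversality of closed braids\<close>

lemma norm_aux:
  fixes c x y s :: real
  shows "(c * x) * (c * x) + (c * y) * (c * y) + s * s = c\<^sup>2 * (x\<^sup>2 + y\<^sup>2) + s\<^sup>2"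
  by algebra

lemma tangent_aux:
  fixes S C a d k w :: real
  shows "- S * (- a * d * C - k * S * w) + C * (- a * d * S + k * C * w) = k * w * (S\<^sup>2 + C\<^sup>2)"
  by algebra

lemma braid_curve_S2: "braid_curve p f t \<in> S2"
proof -
  have "braid_curve p f t \<bullet> braid_curve p f t =
      (cos (f t))\<^sup>2 * ((cos (2 * pi * p * t))\<^sup>2 + (sin (2 * pi * p * t))\<^sup>2) + (sin (f t))\<^sup>2"
    unfolding inner_vec_def sum_3 braid_curve_components inner_real_def by (rule norm_aux)
  also have "\<dots> = 1" by simp
  finally show ?thesis by (simp add: norm_eq_1)
qed

lemma braid_curve_periodic:
  assumes "f (t + 1) = f t"
  shows "braid_curve p f (t + 1) = braid_curve p f t"
proof -
  have "2 * pi * real p * (t + 1) = 2 * pi * real p * t + 2 * real p * pi" by (simp add: algebra_simps)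
  then have "cos (2 * pi * real p * (t + 1)) = cos (2 * pi * real p * t)"
    "sin (2 * pi * real p * (t + 1)) = sin (2 * pi * real p * t)"
    by (simp_all add: cos_add sin_add)
  then show ?thesis by (simp add: braid_curve_def assms)
qed

text \<open>As 1 < pi / 2, the third coordinate determines the latitude and the curve stays away
  from the poles; what remains is equality of longitudes modulo a full turn.\<close>

lemma braid_curve_eq_iff:
  assumes bd: "\<And>t. \<bar>f t\<bar> \<le> 1" and p: "p > 0"
  shows "braid_curve p f s = braid_curve p f t \<longleftrightarrow> f s = f t \<and> (\<exists>k::int. real p * (t - s) = of_int k)"
proof
  have pi2: "1 < pi / 2" using pi_gt3 by simp
  have cpos: "cos (f t) > 0" for t
    using bd[of t] pi2 by (intro cos_gt_zero_pi) auto
  {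
    assume eq: "braid_curve p f s = braid_curve p f t"
    then have "sin (f s) = sin (f t)" using braid_curve_components(3) by metis
    then have ff: "f s = f t"
    proof -
      have "- (pi / 2) \<le> f x" "f x \<le> pi / 2" for x using bd[of x] pi2 by linarith+
      then show ?thesis using sin_inj_pi \<open>sin (f s) = sin (f t)\<close> by blast
    qed
    have "cos (2 * pi * p * s) = cos (2 * pi * p * t)" "sin (2 * pi * p * s) = sin (2 * pi * p * t)"
      using arg_cong[OF eq, of "\<lambda>v. v $ 1"] arg_cong[OF eq, of "\<lambda>v. v $ 2"] cpos[of t]
      unfolding braid_curve_components ff by simp_all
    then obtain n :: int where "2 * pi * p * t = 2 * pi * p * s + 2 * pi * of_int n"
      using sin_cos_eq_iff[of "2 * pi * p * t" "2 * pi * p * s"] by metis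
    then have "2 * pi * (real p * (t - s) - of_int n) = 0" by (simp add: algebra_simps)
    then have "real p * (t - s) = of_int n" by simp
    then show "f s = f t \<and> (\<exists>k::int. real p * (t - s) = of_int k)" using ff by blast
  }
  assume "f s = f t \<and> (\<exists>k::int. real p * (t - s) = of_int k)"
  then obtain k :: int where k: "f s = f t" "real p * (t - s) = of_int k" by blast
  have "2 * pi * p * t = 2 * pi * p * s + 2 * pi * (real p * (t - s))" by (simp add: algebra_simps)
  then have "2 * pi * p * t = 2 * pi * p * s + 2 * pi * of_int k" using k(2) by simp
  then have "sin (2 * pi * p * t) = sin (2 * pi * p * s) \<and> cos (2 * pi * p * t) = cos (2 * pi * p * s)"
    using sin_cos_eq_iff by blast
  then show "braid_curve p f s = braid_curve p f t" using k(1) by (simp add: braid_curve_def)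
qed

text \<open>\<open>L\<close> lists the coincidences of strands, and every clause of
  \<open>generic_immersion\<close> becomes a condition on the pairs in it: disjointness gives double
  points with exactly two parameters, and different slopes of the latitude give
  transversality.\<close>

lemma braid_curve_generic:
  assumes p: "p > 0" and el: "elementary f" and per: "\<And>t. f (t + 1) = f t" and bd: "\<And>t. \<bar>f t\<bar> \<le> 1"
    and der: "\<And>t. (f has_real_derivative f' t) (at t)" and fin: "finite L"
    and L: "\<And>s t. 0 \<le> s \<Longrightarrow> s < t \<Longrightarrow> t < 1 \<Longrightarrow>
      f s = f t \<and> (\<exists>k::int. real p * (t - s) = of_int k) \<longleftrightarrow> (s, t) \<in> L"
    and L_transverse: "\<And>s t. (s, t) \<in> L \<Longrightarrow> 0 \<le> s \<and> s < t \<and> t < 1 \<and> f' s \<noteq> f' t"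
    and L_disjoint: "\<And>s t u v. (s, t) \<in> L \<Longrightarrow> (u, v) \<in> L \<Longrightarrow> {s, t} \<inter> {u, v} \<noteq> {} \<Longrightarrow> s = u \<and> t = v"
  shows "generic_immersion S2 (braid_curve p f)"
    and "chord_diagram (braid_curve p f) = (\<lambda>(s, t). {s, t}) ` L"
proof -
  let ?g = "braid_curve p f"
  let ?\<theta> = "\<lambda>t. 2 * pi * real p * t"
  have cpos: "cos (f t) > 0" for t
    using bd[of t] pi_gt3 by (intro cos_gt_zero_pi) auto
  define V :: "real \<Rightarrow> real^3" where "V t =
      (- sin (f t) * f' t * cos (?\<theta> t) - cos (f t) * sin (?\<theta> t) * (2 * pi * p)) *\<^sub>R axis 1 1 +
      (- sin (f t) * f' t * sin (?\<theta> t) + cos (f t) * cos (?\<theta> t) * (2 * pi * p)) *\<^sub>R axis 2 1 +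
      (cos (f t) * f' t) *\<^sub>R axis 3 1" for t
  have gV: "(?g has_vector_derivative V t) (at t)" for t
  proof -
    have d\<theta>: "(?\<theta> has_real_derivative 2 * pi * p) (at t)" by (auto intro!: derivative_eq_intros)
    have dc: "((\<lambda>t. cos (f t)) has_real_derivative - sin (f t) * f' t) (at t)"
      "((\<lambda>t. sin (f t)) has_real_derivative cos (f t) * f' t) (at t)"
      "((\<lambda>t. cos (?\<theta> t)) has_real_derivative - sin (?\<theta> t) * (2 * pi * p)) (at t)"
      "((\<lambda>t. sin (?\<theta> t)) has_real_derivative cos (?\<theta> t) * (2 * pi * p)) (at t)"
      by (rule DERIV_chain2[OF DERIV_cos der] DERIV_chain2[OF DERIV_sin der]
          DERIV_chain2[OF DERIV_cos d\<theta>] DERIV_chain2[OF DERIV_sin d\<theta>])+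
    have e1: "((\<lambda>t. cos (f t) * cos (?\<theta> t)) has_vector_derivative
        - sin (f t) * f' t * cos (?\<theta> t) - cos (f t) * sin (?\<theta> t) * (2 * pi * p)) (at t)"
      unfolding has_real_derivative_iff_has_vector_derivative[symmetric]
      by (rule DERIV_cong[OF DERIV_mult[OF dc(1) dc(3)]]) (simp add: algebra_simps)
    have e2: "((\<lambda>t. cos (f t) * sin (?\<theta> t)) has_vector_derivative
        - sin (f t) * f' t * sin (?\<theta> t) + cos (f t) * cos (?\<theta> t) * (2 * pi * p)) (at t)"
      unfolding has_real_derivative_iff_has_vector_derivative[symmetric]
      by (rule DERIV_cong[OF DERIV_mult[OF dc(1) dc(4)]]) (simp add: algebra_simps)
    show ?thesis
      unfolding V_def braid_curve_def
      using dc(2) unfolding has_real_derivative_iff_has_vector_derivative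
      by (intro has_vector_derivative_add bounded_linear.has_vector_derivative[OF bounded_linear_scaleR_left] e1 e2)
  qed
  have vd: "vector_derivative ?g (at t) = V t" for t using gV by (rule vector_derivative_at)
  have V3: "V t $ 3 = cos (f t) * f' t" for t by (simp add: V_def axis_def)
  \<comment> \<open>The component of the velocity along the parallel of latitude. It is positive,
    and the same at both parameters of a crossing, so proportional velocities there would have to be
    equal.\<close>
  have VT: "- sin (?\<theta> t) * (V t $ 1) + cos (?\<theta> t) * (V t $ 2) = cos (f t) * (2 * pi * p)" for t
  proof -
    have "V t $ 1 = - sin (f t) * f' t * cos (?\<theta> t) - cos (f t) * sin (?\<theta> t) * (2 * pi * p)"
      "V t $ 2 = - sin (f t) * f' t * sin (?\<theta> t) + cos (f t) * cos (?\<theta> t) * (2 * pi * p)"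
      by (simp_all add: V_def axis_def)
    then have "- sin (?\<theta> t) * (V t $ 1) + cos (?\<theta> t) * (V t $ 2) =
        cos (f t) * (2 * pi * p) * ((sin (?\<theta> t))\<^sup>2 + (cos (?\<theta> t))\<^sup>2)"
      by (simp only: tangent_aux)
    then show ?thesis by simp
  qed
  have kpos: "cos (f t) * (2 * pi * p) > 0" for t using cpos p by simp
  have Vnz: "V t \<noteq> 0" for t
  proof
    assume "V t = 0"
    then have "V t $ 1 = 0" "V t $ 2 = 0" by simp_all
    then have "cos (f t) * (2 * pi * p) = 0"
      using VT[of t] by (simp only: mult_zero_right add_0)
    then show False using kpos[of t] by (metis less_irrefl)
  qed
  have eq_iff: "?g s = ?g t \<longleftrightarrow> (s, t) \<in> L" if "0 \<le> s" "s < t" "t < 1" for s t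
    using braid_curve_eq_iff[OF bd p] L[OF that] by simp
  have only: "{r\<in>{0..<1}. ?g r = ?g s} = {s, t}" if st: "(s, t) \<in> L" for s t
  proof (intro equalityI subsetI)
    have st': "0 \<le> s" "s < t" "t < 1" "?g s = ?g t" using L_transverse[OF st] eq_iff st by auto
    fix r assume r: "r \<in> {r\<in>{0..<1}. ?g r = ?g s}"
    show "r \<in> {s, t}"
    proof (rule ccontr)
      assume "r \<notin> {s, t}"
      then consider "s < r" | "r < s" by fastforce
      then show False
      proof cases
        case 1
        then have sr: "(s, r) \<in> L" using eq_iff[of s r] r st' by auto
        show False using L_disjoint[OF st sr] \<open>r \<notin> {s, t}\<close> by auto
      next
        case 2
        then have rs: "(r, s) \<in> L" using eq_iff[of r s] r st' by auto
        show False using L_disjoint[OF st rs] 2 by auto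
      qed
    qed
  next
    have st': "0 \<le> s" "s < t" "t < 1" "?g s = ?g t" using L_transverse[OF st] eq_iff st by auto
    fix r assume "r \<in> {s, t}"
    then show "r \<in> {r\<in>{0..<1}. ?g r = ?g s}" using st' by auto
  qed
  have dp: "\<exists>s t. (s, t) \<in> L \<and> ?g s = q" if q: "q \<in> double_points ?g" for q
  proof -
    obtain s t where st: "s \<in> {0..<1}" "t \<in> {0..<1}" "s \<noteq> t" "?g s = q" "?g t = q"
      using q unfolding double_points_def by blast
    then consider "s < t" | "t < s" by linarith
    then show ?thesis
    proof cases
      case 1 then have "(s, t) \<in> L" using eq_iff[of s t] st by simp
      then show ?thesis using st(4) by blast
    next
      case 2 then have "(t, s) \<in> L" using eq_iff[of t s] st by simp
      then show ?thesis using st(5) by blast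
    qed
  qed
  have transverse: "\<not> collinear {0, V s, V t}" if st: "(s, t) \<in> L \<or> (t, s) \<in> L" for s t
  proof -
    have d: "f' s \<noteq> f' t" "?g s = ?g t" using st L_transverse eq_iff by metis+
    have k: "f s = f t" "\<exists>k::int. real p * (t - s) = of_int k" using d(2) braid_curve_eq_iff[of f p s t, OF bd p] by blast+
    have same: "cos (?\<theta> s) = cos (?\<theta> t)" "sin (?\<theta> s) = sin (?\<theta> t)"
      using arg_cong[OF d(2), of "\<lambda>v. v $ 1"] arg_cong[OF d(2), of "\<lambda>v. v $ 2"] cpos[of t]
      unfolding braid_curve_components k(1) by simp_all
    show ?thesis
    proof
      assume "collinear {0, V s, V t}"
      then obtain c where c: "V t = c *\<^sub>R V s" using Vnz by (auto simp: collinear_lemma)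
      have "cos (f t) * (2 * pi * p) = c * (- sin (?\<theta> s) * (V s $ 1) + cos (?\<theta> s) * (V s $ 2))"
        unfolding VT[of t, symmetric] c same by (simp add: algebra_simps)
      also have "\<dots> = c * (cos (f t) * (2 * pi * p))" unfolding VT k(1) ..
      finally have "c = 1" using kpos[of t] by (metis less_irrefl mult_cancel_right1)
      then have "V t $ 3 = V s $ 3" using c by simp
      then show False using V3 k(1) cpos[of t] d(1) by simp
    qed
  qed
  show g: "generic_immersion S2 ?g"
    unfolding generic_immersion_def vd
  proof (intro conjI ballI allI impI)
    show "range ?g \<subseteq> S2" using braid_curve_S2 by blast
    show "?g (t + 1) = ?g t" for t using braid_curve_periodic per by blast
    have "elementary (\<lambda>t. cos (f t) * cos (2 * pi * p * t))" "elementary (\<lambda>t. cos (f t) * sin (2 * pi * p * t))"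
      "elementary (\<lambda>t. sin (f t))"
      by (intro elementary.intros el)+
    from smooth_elementary[OF this] show "smooth ?g" unfolding braid_curve_def .
    show "V t \<noteq> 0" for t by (rule Vnz)
    have "double_points ?g \<subseteq> (\<lambda>(s, t). ?g s) ` L" using dp by force
    then show "finite (double_points ?g)" using fin finite_subset by blast
    show "card {t\<in>{0..<1}. ?g t = q} = 2" if q: "q \<in> double_points ?g" for q
    proof -
      obtain s t where st: "(s, t) \<in> L" "?g s = q" using dp[OF q] by blast
      have "{r\<in>{0..<1}. ?g r = q} = {s, t}" using only[OF st(1)] unfolding st(2) .
      then show ?thesis using L_transverse[OF st(1)] by simp
    qed
    show "\<not> collinear {0, V s, V t}" if st: "s \<in> {0..<1}" "t \<in> {0..<1}" "s \<noteq> t \<and> ?g s = ?g t" for s t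
    proof (rule transverse)
      consider "s < t" | "t < s" using st by linarith
      then show "(s, t) \<in> L \<or> (t, s) \<in> L"
      proof cases
        case 1
        then show ?thesis using eq_iff[of s t] st by simp
      next
        case 2
        then show ?thesis using eq_iff[of t s] st by simp
      qed
    qed
  qed
  show "chord_diagram ?g = (\<lambda>(s, t). {s, t}) ` L"
    unfolding chord_diagram_eq[OF g]
  proof (intro equalityI subsetI)
    fix c assume "c \<in> {{u, v} | u v. 0 \<le> u \<and> u < v \<and> v < 1 \<and> ?g u = ?g v}"
    then obtain u v where "c = {u, v}" "(u, v) \<in> L" using eq_iff by blast
    then show "c \<in> (\<lambda>(s, t). {s, t}) ` L" by (intro image_eqI[of _ _ "(u, v)"]) auto
  next
    fix c assume "c \<in> (\<lambda>(s, t). {s, t}) ` L"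
    then obtain u v where uv: "c = {u, v}" "(u, v) \<in> L" by auto
    then show "c \<in> {{u, v} | u v. 0 \<le> u \<and> u < v \<and> v < 1 \<and> ?g u = ?g v}"
      using L_transverse[OF uv(2)] eq_iff[of u v] by blast
  qed
qed

section \<open>Evaluation of the invariants on lists of integer pairs\<close>

definition pair_crosses :: "int \<times> int \<Rightarrow> int \<times> int \<Rightarrow> bool" where
  "pair_crosses c d \<longleftrightarrow> fst c < fst d \<and> fst d < snd c \<and> snd c < snd d \<or>
     fst d < fst c \<and> fst c < snd d \<and> snd d < snd c"

definition list_weight3 :: "nat list \<Rightarrow> int" where
  "list_weight3 l = (if l = [1, 1] then 1 else if l = [2, 2, 2] then -3 else if l = [1, 1, 2] then 3 else 0)"

definition list_weight4 :: "nat list \<Rightarrow> int" where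
  "list_weight4 l = (if l = [1, 1, 2] then 2 else if l = [2, 2, 2, 2] then 8 else if l = [1, 1, 1, 3] then 5
     else if l = [1, 2, 2, 3] then 1 else if l = [3, 3, 3, 3] then -4
     else if l = [1, 1, 2, 2] then 2 else if l = [2, 2, 3, 3] then -2 else 0)"

text \<open>A form of the sum over all subsets that can be evaluated: for distinct \<open>xs\<close>
  the subsequences run through each subset once.\<close>

definition list_sum :: "(nat list \<Rightarrow> int) \<Rightarrow> (int \<times> int) list \<Rightarrow> int" where
  "list_sum w xs = sum_list (map (\<lambda>S. w (sort (map (\<lambda>c. length (filter (pair_crosses c) S)) S))) (subseqs xs))"

lemma weight_mset_list:
  "weight3 (mset l) = list_weight3 (sort l)" "weight4 (mset l) = list_weight4 (sort l)"
proof -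
  show "weight4 (mset l) = list_weight4 (sort l)" by (simp add: weight4_sorted list_weight4_def Let_def)
  show "weight3 (mset l) = list_weight3 (sort l)"
    using eq_mset_iff_sorted[of "[1, 1]" "mset l"] eq_mset_iff_sorted[of "[2, 2, 2]" "mset l"]
      eq_mset_iff_sorted[of "[1, 1, 2]" "mset l"]
    by (simp add: weight3_def list_weight3_def)
qed

lemma graph_sum_list:
  assumes "distinct xs" "\<And>l. W (mset l) = w (sort l)"
  shows "graph_sum W pair_crosses (set xs) = list_sum w xs"
proof -
  have "graph_sum W pair_crosses (set xs) = sum (\<lambda>C. W (profile pair_crosses C)) (set (map set (subseqs xs)))"
    unfolding graph_sum_def using subseqs_powset[of xs] by simp
  also have "\<dots> = sum_list (map (\<lambda>C. W (profile pair_crosses C)) (map set (subseqs xs)))"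
    using distinct_set_subseqs[OF assms(1)] by (rule sum.distinct_set_conv_list)
  also have "\<dots> = sum_list (map (\<lambda>S. W (profile pair_crosses (set S))) (subseqs xs))" by (simp add: comp_def)
  also have "map (\<lambda>S. W (profile pair_crosses (set S))) (subseqs xs) =
      map (\<lambda>S. w (sort (map (\<lambda>c. length (filter (pair_crosses c) S)) S))) (subseqs xs)"
  proof (rule map_cong[OF refl])
    fix S assume "S \<in> set (subseqs xs)"
    then have d: "distinct S" using assms(1) by (rule subseqs_distinctD)
    have "card {u\<in>set S. pair_crosses c u} = length (filter (pair_crosses c) S)" for c
      using d by (metis distinct_card distinct_filter set_filter)
    moreover have "mset_set (set S) = mset S" using d by (rule mset_set_set)
    ultimately have "profile pair_crosses (set S) = mset (map (\<lambda>c. length (filter (pair_crosses c) S)) S)"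
      by (simp add: profile_def)
    then show "W (profile pair_crosses (set S)) = w (sort (map (\<lambda>c. length (filter (pair_crosses c) S)) S))"
      by (simp only: assms(2))
  qed
  finally show ?thesis by (simp add: list_sum_def)
qed

text \<open>Only the order of the endpoints matters for crossings, so they may be scaled by
  \<open>N\<close> to integers.\<close>

lemma lambda_list_sum:
  assumes g: "generic_immersion X g"
    and cd: "chord_diagram g = (\<lambda>(s, t). {s, t}) ` (\<lambda>(m, n). (of_int m / N, of_int n / N)) ` set xs"
    and N: "N > 0" and xs: "distinct xs" "\<And>m n. (m, n) \<in> set xs \<Longrightarrow> m < n"
  shows "lambda3 g = list_sum list_weight3 xs" "lambda4 g = list_sum list_weight4 xs"
proof -
  define f where "f c = {of_int (fst c) / N, of_int (snd c) / N}" for c :: "int \<times> int"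
  have cd': "chord_diagram g = f ` set xs" unfolding cd image_image f_def by (rule image_cong) auto
  have mono: "of_int m / N < of_int n / N \<longleftrightarrow> m < n" for m n using N by (simp add: divide_less_cancel)
  have "inj_on f (set xs)"
  proof (rule inj_onI)
    fix c d assume c: "c \<in> set xs" and d: "d \<in> set xs" and eq: "f c = f d"
    have "fst c < snd c" "fst d < snd d" using xs(2)[of "fst c" "snd c"] xs(2)[of "fst d" "snd d"] c d by simp_all
    moreover have "of_int m / N = of_int n / N \<longleftrightarrow> m = n" for m n using N by simp
    ultimately have "fst c = fst d \<and> snd c = snd d"
      using eq unfolding f_def doubleton_eq_iff by auto
    then show "c = d" by (simp add: prod_eq_iff)
  qed
  then have bij: "bij_betw f (set xs) (chord_diagram g)" unfolding cd' bij_betw_def by simp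
  have cr: "crosses (f c) (f d) = pair_crosses c d" if "c \<in> set xs" "d \<in> set xs" for c d
  proof -
    have "fst c < snd c" "fst d < snd d" using xs(2)[of "fst c" "snd c"] xs(2)[of "fst d" "snd d"] that by simp_all
    then show ?thesis unfolding f_def pair_crosses_def by (subst crosses_doubleton) (simp_all only: mono)
  qed
  show "lambda3 g = list_sum list_weight3 xs"
    unfolding lambda3_eq_graph_sum[OF g] graph_sum_list[where W = weight3 and w = list_weight3, OF xs(1) weight_mset_list(1), symmetric]
    by (rule graph_sum_bij[OF bij]) (rule cr)
  show "lambda4 g = list_sum list_weight4 xs"
    unfolding lambda4_eq_graph_sum[OF g] graph_sum_list[where W = weight4 and w = list_weight4, OF xs(1) weight_mset_list(2), symmetric]
    by (rule graph_sum_bij[OF bij]) (rule cr)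
qed

text \<open>Numerators over 20. The pairs are half a period apart and begin at the zeros of cos (10
  pi t) in the first half of the period.\<close>

definition chords1 :: "(int \<times> int) list" where
  "chords1 = [(1, 11), (3, 13), (5, 15), (7, 17), (9, 19)]"

text \<open>Numerators over 48. The last five chords cross each other and also the first and the
  third; the second crosses only the first and the third, which do not cross each other.\<close>

definition chords2 :: "(int \<times> int) list" where
  "chords2 = [(1, 17), (16, 32), (31, 47), (2, 34), (5, 37), (8, 40), (11, 43), (14, 46)]"

text \<open>In K5 there are 10 edges, 10 triangles and no induced path on three vertices, which
  gives 10 - 30. Of the four-vertex graphs only K4 occurs, five times.\<close>

lemma list_sums:
  "list_sum list_weight3 chords1 = -20"
  "list_sum list_weight4 chords1 = -20"
  by code_simp+

text \<open>The graph has 22 edges, 30 triangles and 16 induced paths on three vertices: 22 - 90 +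
  48.\<close>

lemma list_sums3: "list_sum list_weight3 chords2 = -20" by code_simp

text \<open>Besides the 16 paths there are 5 induced 4-cycles, 20 triangles with a pendant edge, 25
  copies of K4 and 10 of K4 minus an edge: 32 + 40 + 20 - 100 - 20.\<close>

lemma list_sums4: "list_sum list_weight4 chords2 = -28" by code_simp

definition pair_set :: "real \<Rightarrow> (int \<times> int) list \<Rightarrow> (real \<times> real) set" where
  "pair_set N xs = (\<lambda>(m, n). (of_int m / N, of_int n / N)) ` set xs"

lemma pair_set1: "pair_set 20 chords1 = {(1/20, 11/20), (3/20, 13/20), (5/20, 15/20), (7/20, 17/20), (9/20, 19/20)}"
  by (simp add: pair_set_def chords1_def)

lemma pair_set2: "pair_set 48 chords2 = {(1/48, 17/48), (16/48, 32/48), (31/48, 47/48), (2/48, 34/48),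
   (5/48, 37/48), (8/48, 40/48), (11/48, 43/48), (14/48, 46/48)}"
  by (simp add: pair_set_def chords2_def)

section \<open>The closed 2-braid\<close>

definition curve1 :: "real \<Rightarrow> real^3" where
  "curve1 = braid_curve 2 (\<lambda>t. cos (10 * pi * t))"

text \<open>Half a period later the argument has grown by 5 pi and the latitude has changed its
  sign. The two strands therefore meet exactly where the latitude vanishes, and there the slopes are
  opposite and nonzero.\<close>

lemma curve1_generic:
  "generic_immersion S2 curve1" "chord_diagram curve1 = (\<lambda>(s, t). {s, t}) ` pair_set 20 chords1"
proof -
  let ?f = "\<lambda>t. cos (10 * pi * t)" and ?f' = "\<lambda>t. - sin (10 * pi * t) * (10 * pi)"
  have half: "cos (10 * pi * (s + 1/2)) = - cos (10 * pi * s)" "sin (10 * pi * (s + 1/2)) = - sin (10 * pi * s)" for s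
  proof -
    have e: "10 * pi * (s + 1/2) = 10 * pi * s + real 5 * pi" by (simp add: algebra_simps)
    have m: "(-1::real) ^ 5 = -1" by simp
    show "cos (10 * pi * (s + 1/2)) = - cos (10 * pi * s)" "sin (10 * pi * (s + 1/2)) = - sin (10 * pi * s)"
      unfolding e cos_add sin_add cos_npi sin_npi m by simp_all
  qed
  have zero: "cos (10 * pi * s) = 0 \<longleftrightarrow> (\<exists>i::int. odd i \<and> s = of_int i / 20)" for s
  proof -
    have "10 * pi * s = of_int i * (pi / 2) \<longleftrightarrow> s = of_int i / 20" for i :: int
    proof -
      have "10 * pi * s = of_int i * (pi / 2) \<longleftrightarrow> pi * (20 * s) = pi * of_int i" by (auto simp: field_simps)
      also have "\<dots> \<longleftrightarrow> 20 * s = of_int i" by simp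
      finally show ?thesis by (auto simp: field_simps)
    qed
    then show ?thesis unfolding cos_zero_iff_int by simp
  qed
  have zeros: "cos (10 * pi * s) = 0 \<longleftrightarrow> s \<in> {1/20, 3/20, 5/20, 7/20, 9/20}" if s: "0 \<le> s" "s < 1/2" for s
  proof
    assume "cos (10 * pi * s) = 0"
    then obtain i :: int where i: "odd i" "s = of_int i / 20" using zero by blast
    then have "(0::real) \<le> of_int i" "(of_int i::real) < 10" using s by auto
    then have "0 \<le> i" "i < 10" by linarith+
    then have "i = 1 \<or> i = 3 \<or> i = 5 \<or> i = 7 \<or> i = 9" using i(1) by presburger
    then show "s \<in> {1/20, 3/20, 5/20, 7/20, 9/20}" using i(2) by auto
  next
    assume "s \<in> {1/20, 3/20, 5/20, 7/20, 9/20}"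
    moreover have "cos (10 * pi * (of_int i / 20)) = 0" if "odd i" for i :: int using zero that by blast
    from this[of 1] this[of 3] this[of 5] this[of 7] this[of 9]
    have "cos (10 * pi * (1 / 20)) = 0" "cos (10 * pi * (3 / 20)) = 0" "cos (10 * pi * (5 / 20)) = 0"
      "cos (10 * pi * (7 / 20)) = 0" "cos (10 * pi * (9 / 20)) = 0" by simp_all
    ultimately show "cos (10 * pi * s) = 0" by blast
  qed
  have in_L: "(s, t) \<in> pair_set 20 chords1 \<longleftrightarrow> t = s + 1/2 \<and> s \<in> {1/20, 3/20, 5/20, 7/20, 9/20}" for s t
    unfolding pair_set1 by auto
  have el: "elementary ?f" by (intro elementary.intros)
  have per: "cos (10 * pi * (t + 1)) = cos (10 * pi * t)" for t
    using half(1)[of t] half(1)[of "t + 1/2"] by (simp add: add.assoc)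
  have bd: "\<bar>cos (10 * pi * t)\<bar> \<le> 1" for t by simp
  have der: "(?f has_real_derivative ?f' t) (at t)" for t
    by (auto intro!: derivative_eq_intros)
  have fin: "finite (pair_set 20 chords1)" by (simp add: pair_set_def)
  have L: "?f s = ?f t \<and> (\<exists>k::int. real 2 * (t - s) = of_int k) \<longleftrightarrow> (s, t) \<in> pair_set 20 chords1"
    if st: "0 \<le> s" "s < t" "t < 1" for s t
  proof
    assume "?f s = ?f t \<and> (\<exists>k::int. real 2 * (t - s) = of_int k)"
    then obtain k :: int where k: "?f s = ?f t" "real 2 * (t - s) = of_int k" by blast
    then have "(0::real) < of_int k" "(of_int k::real) < 2" using st by auto
    then have "k = 1" by linarith
    then have t: "t = s + 1/2" using k(2) by simp
    then have "cos (10 * pi * s) = 0" using k(1) half(1)[of s] by simp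
    then show "(s, t) \<in> pair_set 20 chords1" using zeros[of s] in_L t st by auto
  next
    assume "(s, t) \<in> pair_set 20 chords1"
    then have t: "t = s + 1/2" and s: "s \<in> {1/20, 3/20, 5/20, 7/20, 9/20}" using in_L by blast+
    have "0 \<le> s" "s < 1/2" using s by auto
    then have "cos (10 * pi * s) = 0" using zeros s by blast
    then have "?f s = ?f t" using half(1)[of s] unfolding t by simp
    moreover have "real 2 * (t - s) = of_int 1" using t by simp
    ultimately show "?f s = ?f t \<and> (\<exists>k::int. real 2 * (t - s) = of_int k)" by blast
  qed
  have T: "0 \<le> s \<and> s < t \<and> t < 1 \<and> ?f' s \<noteq> ?f' t" if "(s, t) \<in> pair_set 20 chords1" for s t
  proof -
    have t: "t = s + 1/2" and s: "s \<in> {1/20, 3/20, 5/20, 7/20, 9/20}" using that in_L by blast+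
    have b: "0 \<le> s" "s < 1/2" using s by auto
    then have "cos (10 * pi * s) = 0" using zeros s by blast
    then have "sin (10 * pi * s) \<noteq> 0" using sin_cos_squared_add[of "10 * pi * s"] by auto
    then show ?thesis using b half(2)[of s] unfolding t by simp
  qed
  have D: "s = u \<and> t = v" if "(s, t) \<in> pair_set 20 chords1" "(u, v) \<in> pair_set 20 chords1" "{s, t} \<inter> {u, v} \<noteq> {}" for s t u v
  proof -
    have "t = s + 1/2" "v = u + 1/2" "s < 1/2" "u < 1/2" "0 \<le> s" "0 \<le> u" using that(1,2) in_L by auto
    then show ?thesis using that(3) by auto
  qed
  show "generic_immersion S2 curve1" "chord_diagram curve1 = (\<lambda>(s, t). {s, t}) ` pair_set 20 chords1"
    unfolding curve1_def by (rule braid_curve_generic[OF _ el per bd der fin L T D]; simp)+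
qed

section \<open>The closed 3-braid\<close>

definition c1 where "c1 = cos (pi / 8)"
definition c2 where "c2 = cos (2 * pi / 8)"
definition c3 where "c3 = cos (3 * pi / 8)"

text \<open>The value of \<open>c4\<close> makes the second elementary symmetric function of \<open>c1, c2, c3, c4\<close> equal to
  \<open>- 3/4\<close>, as needed in \<open>height_diff\<close>.\<close>

definition c4 where "c4 = - (3/4 + c1 * c2 + c1 * c3 + c2 * c3) / (c1 + c2 + c3)"

lemma c_order: "0 < c3" "c3 < c2" "c2 < c1" "c1 < 1"
proof -
  show "0 < c3" unfolding c3_def by (rule cos_gt_zero_pi) (use pi_gt_zero in linarith)+
  show "c3 < c2" unfolding c3_def c2_def by (rule cos_monotone_0_pi) (use pi_gt_zero in linarith)+
  show "c2 < c1" unfolding c2_def c1_def by (rule cos_monotone_0_pi) (use pi_gt_zero in linarith)+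
  have "cos (pi / 8) < cos 0" by (rule cos_monotone_0_pi) (use pi_gt_zero in linarith)+
  then show "c1 < 1" by (simp add: c1_def)
qed

text \<open>This keeps the fourth factor of \<open>quartic\<close> from vanishing at a cosine, so
  that \<open>c4\<close> produces no crossing.\<close>

lemma c4_less: "c4 < -1"
proof -
  \<comment> \<open>Since \<open>c3\<close> is sin (pi / 8), one has \<open>c1 * c3 = w / 4\<close>
    and \<open>\<sigma> * \<sigma> = 1 + w / 2\<close>. In these terms the claim says that
    \<open>(1 - w / 2) * \<sigma>\<close> is less than \<open>3/4 - w / 4\<close>.\<close>
  define w \<sigma> where "w = sqrt 2" and "\<sigma> = c1 + c3"
  have w: "w * w = 2" "0 < w" by (simp_all add: w_def)
  have c2: "c2 = w / 2" using cos_45 by (simp add: c2_def w_def)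
  have s3: "c3 = sin (pi / 8)"
  proof -
    have "3 * pi / 8 = pi / 2 - pi / 8" by simp
    then show ?thesis unfolding c3_def by (simp only: cos_sin_eq[of "pi / 2 - pi / 8"]) simp
  qed
  have "sin (2 * (pi / 8)) = 2 * sin (pi / 8) * cos (pi / 8)" by (rule sin_double)
  moreover have "sin (2 * (pi / 8)) = w / 2" using sin_45 by (simp add: w_def)
  ultimately have "2 * sin (pi / 8) * cos (pi / 8) = w / 2" by (simp only:)
  then have c13: "c1 * c3 = w / 4" unfolding s3 c1_def by (simp only: mult.commute mult.left_commute)
  have "c1\<^sup>2 + c3\<^sup>2 = 1" by (simp add: s3 c1_def)
  then have \<sigma>2: "\<sigma> * \<sigma> = 1 + w / 2" using c13 by (simp add: \<sigma>_def power2_eq_square algebra_simps)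
  have \<sigma>: "0 < \<sigma>" using c_order by (simp add: \<sigma>_def)
  have w32: "w < 3/2"
  proof (rule ccontr)
    assume "\<not> w < 3/2"
    then have "3/2 * (3/2) \<le> w * w" by (intro mult_mono) auto
    then show False using w by simp
  qed
  \<comment> \<open>After squaring and replacing \<open>w * w\<close> by 2 the inequality is just
    \<open>w < 3/2\<close>.\<close>
  have "(1 - w / 2) * \<sigma> < 3/4 - w / 4"
  proof (rule power2_less_imp_less)
    have "((1 - w / 2) * \<sigma>)\<^sup>2 = (1 - w + w * w / 4) * (\<sigma> * \<sigma>)" by (simp add: power2_eq_square algebra_simps)
    also have "\<dots> = 1/2 - w / 4" unfolding \<sigma>2 w(1) using w(1) by (simp add: algebra_simps)
    finally have l: "((1 - w / 2) * \<sigma>)\<^sup>2 = 1/2 - w / 4" .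
    have "(3/4 - w / 4)\<^sup>2 = 9/16 - 3/8 * w + w * w / 16" by (simp add: power2_eq_square algebra_simps)
    then show "((1 - w / 2) * \<sigma>)\<^sup>2 < (3/4 - w / 4)\<^sup>2" unfolding l w(1) using w32 by simp
    show "0 \<le> 3/4 - w / 4" using w32 by simp
  qed
  then have "\<sigma> + w / 2 < 3/4 + w / 4 + w / 2 * \<sigma>" by (simp add: algebra_simps)
  moreover have "c1 + c2 + c3 = \<sigma> + w / 2" "c1 * c2 + c2 * c3 = w / 2 * \<sigma>"
    unfolding c2 \<sigma>_def by (simp_all add: algebra_simps)
  ultimately have "c1 + c2 + c3 < 3/4 + c1 * c2 + c1 * c3 + c2 * c3" using c13 by linarith
  then show ?thesis
    using c_order unfolding c4_def by (simp add: divide_less_eq)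
qed

text \<open>The roots \<open>c1\<close>, \<open>c2\<close>, \<open>c3\<close> prescribe where
  strands cross. Being cosines of multiples of pi / 8 they give parameters that are multiples of
  1/16, hence of 1/48.\<close>

definition quartic :: "real \<Rightarrow> real" where
  "quartic y = (y - c1) * (y - c2) * (y - c3) * (y - c4)"

definition e1 where "e1 = c1 + c2 + c3 + c4"
definition e3 where "e3 = c1 * c2 * c3 + c4 * (c1 * c2 + c1 * c3 + c2 * c3)"
definition e4 where "e4 = c1 * c2 * c3 * c4"

lemma quartic_expand: "quartic y = y ^ 4 - e1 * y ^ 3 - 3/4 * y ^ 2 - e3 * y + e4"
proof -
  have "c4 * (c1 + c2 + c3) = - (3/4 + c1 * c2 + c1 * c3 + c2 * c3)"
    using c_order by (simp add: c4_def)
  then have e2: "c1 * c2 + c1 * c3 + c2 * c3 + c4 * (c1 + c2 + c3) = - 3/4" by simp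
  have "quartic y = y ^ 4 - e1 * y ^ 3 + (c1 * c2 + c1 * c3 + c2 * c3 + c4 * (c1 + c2 + c3)) * y ^ 2 - e3 * y + e4"
    unfolding quartic_def e1_def e3_def e4_def by algebra
  then show ?thesis unfolding e2 by simp
qed

text \<open>Found by comparing coefficients in \<open>height_diff\<close>. The first, second, fourth
  and fifth powers have as differences \<open>- S\<close> times 1, \<open>c\<close>,
  \<open>3/2 * c - c ^ 3\<close> and \<open>9/16 + 3/4 * c ^ 2 - c ^ 4\<close>; the third power
  would only repeat the first. The square of \<open>c\<close> is thus available through the fifth
  power alone, which forces the coefficient \<open>- 3/4\<close> in the quartic.\<close>

definition height :: "real \<Rightarrow> real" where
  "height y = (e4 + 9/16) * y - (e3 + 3/2 * e1) * y ^ 2 + e1 * y ^ 4 - y ^ 5"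

text \<open>The arguments on the left are \<open>cos (x + pi / 3)\<close> and \<open>cos (x - pi / 3)\<close>
  for \<open>c = cos x\<close>, \<open>S = sqrt 3 * sin x\<close>.\<close>

lemma height_diff:
  assumes "S\<^sup>2 = 3 - 3 * c\<^sup>2"
  shows "height ((c - S) / 2) - height ((c + S) / 2) = - S * quartic c"
proof -
  have S: "S * S = 3 - 3 * (c * c)" using assms by (simp add: power2_eq_square)
  have p2: "((c - S) / 2) ^ 2 - ((c + S) / 2) ^ 2 = - S * c" by (simp add: power2_eq_square field_simps)
  have p4: "((c - S) / 2) ^ 4 - ((c + S) / 2) ^ 4 = - S * (3/2 * c - c ^ 3)"
  proof -
    have "((c - S) / 2) ^ 4 - ((c + S) / 2) ^ 4 = - S * (c * (c * c + S * S) / 2)"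
      by (simp add: power4_eq_xxxx field_simps)
    also have "\<dots> = - S * (3/2 * c - c ^ 3)" unfolding S by (simp add: power3_eq_cube field_simps)
    finally show ?thesis .
  qed
  have p5: "((c - S) / 2) ^ 5 - ((c + S) / 2) ^ 5 = - S * (9/16 + 3/4 * c ^ 2 - c ^ 4)"
  proof -
    have "((c - S) / 2) ^ 5 - ((c + S) / 2) ^ 5 =
        - S * ((5 * (c * c) * (c * c) + 10 * (c * c) * (S * S) + (S * S) * (S * S)) / 16)"
      by (simp add: eval_nat_numeral field_simps)
    also have "\<dots> = - S * (9/16 + 3/4 * c ^ 2 - c ^ 4)" unfolding S by (simp add: eval_nat_numeral field_simps)
    finally show ?thesis .
  qed
  have "height x - height y = (e4 + 9/16) * (x - y) - (e3 + 3/2 * e1) * (x ^ 2 - y ^ 2)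
      + e1 * (x ^ 4 - y ^ 4) - (x ^ 5 - y ^ 5)" for x y
    unfolding height_def by algebra
  then have "height ((c - S) / 2) - height ((c + S) / 2) =
      (e4 + 9/16) * ((c - S) / 2 - (c + S) / 2) - (e3 + 3/2 * e1) * (((c - S) / 2) ^ 2 - ((c + S) / 2) ^ 2)
      + e1 * (((c - S) / 2) ^ 4 - ((c + S) / 2) ^ 4) - (((c - S) / 2) ^ 5 - ((c + S) / 2) ^ 5)"
    by blast
  also have "(c - S) / 2 - (c + S) / 2 = - S" by (simp add: field_simps)
  also have "(e4 + 9/16) * (- S) - (e3 + 3/2 * e1) * (((c - S) / 2) ^ 2 - ((c + S) / 2) ^ 2)
      + e1 * (((c - S) / 2) ^ 4 - ((c + S) / 2) ^ 4) - (((c - S) / 2) ^ 5 - ((c + S) / 2) ^ 5) = - S * quartic c"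
    unfolding p2 p4 p5 quartic_expand by (simp add: algebra_simps)
  finally show ?thesis .
qed

text \<open>The denominator is the sum of the absolute values of the coefficients of
  \<open>height\<close>, so the scaled latitude stays within [-1, 1].\<close>

definition height_scale where
  "height_scale = 1 / (\<bar>e4 + 9/16\<bar> + \<bar>e3 + 3/2 * e1\<bar> + \<bar>e1\<bar> + 1)"

definition latitude :: "real \<Rightarrow> real" where
  "latitude t = height_scale * height (cos (2 * pi * t))"

definition latitude' :: "real \<Rightarrow> real" where
  "latitude' t = height_scale * (((e4 + 9/16) - (e3 + 3/2 * e1) * 2 * cos (2 * pi * t)
     + e1 * 4 * cos (2 * pi * t) ^ 3 - 5 * cos (2 * pi * t) ^ 4) * (- sin (2 * pi * t) * (2 * pi)))"

lemma scale_pos: "0 < height_scale"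
  unfolding height_scale_def by (intro divide_pos_pos add_nonneg_pos add_nonneg_nonneg) auto

lemma latitude_bound: "\<bar>latitude t\<bar> \<le> 1"
proof -
  define y where "y = cos (2 * pi * t)"
  have y: "\<bar>y\<bar> \<le> 1" by (simp add: y_def)
  have py: "\<bar>y ^ n\<bar> \<le> 1" for n using power_le_one[OF abs_ge_zero y, of n] by (simp add: power_abs)
  have m: "\<bar>a * y ^ n\<bar> \<le> \<bar>a\<bar>" for a n
    using mult_left_mono[OF py[of n], of "\<bar>a\<bar>"] by (simp add: abs_mult)
  define D where "D = \<bar>e4 + 9/16\<bar> + \<bar>e3 + 3/2 * e1\<bar> + \<bar>e1\<bar> + 1"
  have D: "0 < D" by (simp add: D_def add_nonneg_pos)
  have "\<bar>height y\<bar> \<le> D"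
    using m[of "e4 + 9/16" 1] m[of "e3 + 3/2 * e1" 2] m[of e1 4] m[of 1 5]
    unfolding height_def D_def power_one_right by (simp only: mult_1) linarith
  then have "\<bar>height y\<bar> / D \<le> 1" using D by simp
  moreover have "\<bar>1 / D * height y\<bar> = \<bar>height y\<bar> / D" using D by (simp add: abs_mult)
  ultimately show ?thesis unfolding latitude_def y_def[symmetric] height_scale_def D_def[symmetric] by (simp only:)
qed

lemma latitude_derivative: "(latitude has_real_derivative latitude' t) (at t)"
proof -
  have d: "((\<lambda>t. cos (2 * pi * t)) has_real_derivative - sin (2 * pi * t) * (2 * pi)) (at t)"
    by (auto intro!: derivative_eq_intros)
  have h: "(height has_real_derivative ((e4 + 9/16) - (e3 + 3/2 * e1) * 2 * y + e1 * 4 * y ^ 3 - 5 * y ^ 4)) (at y)" for y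
    unfolding height_def by (auto intro!: derivative_eq_intros simp: algebra_simps)
  show ?thesis
    unfolding latitude_def latitude'_def by (intro DERIV_cmult DERIV_chain2[OF h d])
qed

lemma trig_periodic: "cos (2 * pi * (t + 1)) = cos (2 * pi * t)" "sin (2 * pi * (t + 1)) = sin (2 * pi * t)" for t :: real
  by (simp_all add: distrib_left cos_add sin_add)

lemma latitude_periodic: "latitude (t + 1) = latitude t" "latitude' (t + 1) = latitude' t"
  unfolding latitude_def latitude'_def trig_periodic by simp_all

lemma elementary_latitude: "elementary latitude"
proof -
  have c: "elementary (\<lambda>t. cos (2 * pi * t))" by (intro elementary.intros)
  have "elementary (\<lambda>t. height_scale * ((e4 + 9/16) * cos (2 * pi * t) + (- (e3 + 3/2 * e1)) * cos (2 * pi * t) ^ 2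
      + e1 * cos (2 * pi * t) ^ 4 + (-1) * cos (2 * pi * t) ^ 5))"
    by (intro elementary.intros(1,3,4) elementary_power c)
  moreover have "latitude = (\<lambda>t. height_scale * ((e4 + 9/16) * cos (2 * pi * t) + (- (e3 + 3/2 * e1)) * cos (2 * pi * t) ^ 2
      + e1 * cos (2 * pi * t) ^ 4 + (-1) * cos (2 * pi * t) ^ 5))"
    unfolding latitude_def height_def by (rule ext) (simp add: algebra_simps)
  ultimately show ?thesis by simp
qed

text \<open>For a closed 3-braid the strands are a third of a period apart, here placed
  symmetrically at \<open>u - 1/6\<close> and \<open>u + 1/6\<close>. The factorization exhibits all
  their coincidences as zeros of the sine or of the quartic.\<close>

lemma latitude_diff:
  "latitude (u + 1/6) - latitude (u - 1/6) =
     - (height_scale * sqrt 3) * (sin (2 * pi * u) * quartic (cos (2 * pi * u)))"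
proof -
  define c S where "c = cos (2 * pi * u)" and "S = sqrt 3 * sin (2 * pi * u)"
  have x: "2 * pi * (u + 1/6) = 2 * pi * u + pi / 3" "2 * pi * (u - 1/6) = 2 * pi * u - pi / 3"
    by (simp_all add: algebra_simps)
  have "cos (2 * pi * (u + 1/6)) = (c - S) / 2" "cos (2 * pi * (u - 1/6)) = (c + S) / 2"
    unfolding x cos_add cos_diff cos_60 sin_60 c_def S_def by (simp_all add: field_simps)
  moreover have "S\<^sup>2 = 3 - 3 * c\<^sup>2"
    unfolding S_def c_def power_mult_distrib sin_squared_eq by simp
  then have "height ((c - S) / 2) - height ((c + S) / 2) = - S * quartic c" by (rule height_diff)
  ultimately have "latitude (u + 1/6) - latitude (u - 1/6) = height_scale * (- S * quartic c)"
    unfolding latitude_def by (simp only: right_diff_distrib[symmetric])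
  then show ?thesis by (simp add: S_def c_def)
qed

definition is_root :: "real \<Rightarrow> bool" where
  "is_root u \<longleftrightarrow> sin (2 * pi * u) = 0 \<or> cos (2 * pi * u) \<in> {c1, c2, c3}"

lemma latitude_eq_iff: "latitude (u + 1/6) = latitude (u - 1/6) \<longleftrightarrow> is_root u"
proof -
  have "c4 \<noteq> cos (2 * pi * u)" using c4_less cos_ge_minus_one[of "2 * pi * u"] by linarith
  then have "quartic (cos (2 * pi * u)) = 0 \<longleftrightarrow> cos (2 * pi * u) \<in> {c1, c2, c3}" by (auto simp: quartic_def)
  moreover have "latitude (u + 1/6) = latitude (u - 1/6) \<longleftrightarrow> latitude (u + 1/6) - latitude (u - 1/6) = 0" by simp
  ultimately show ?thesis unfolding latitude_diff is_root_def using scale_pos by auto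
qed

text \<open>All zeros of the product in \<open>latitude_diff\<close> are simple: where the sine
  vanishes the cosine is 1 or -1, which is no root of the quartic, and elsewhere the cosine is one
  of its simple roots. So the difference of latitudes has nonzero derivative there.\<close>

lemma root_transverse:
  assumes "is_root u"
  shows "latitude' (u + 1/6) \<noteq> latitude' (u - 1/6)"
proof -
  let ?s = "sin (2 * pi * u)" and ?c = "cos (2 * pi * u)"
  define q' where "q' y = (y - c2) * (y - c3) * (y - c4) + (y - c1) * (y - c3) * (y - c4)
     + (y - c1) * (y - c2) * (y - c4) + (y - c1) * (y - c2) * (y - c3)" for y
  have q: "(quartic has_real_derivative q' y) (at y)" for y
    unfolding quartic_def q'_def by (auto intro!: derivative_eq_intros simp: algebra_simps)
  have ds: "((\<lambda>u. sin (2 * pi * u)) has_real_derivative ?c * (2 * pi)) (at u)"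
    "((\<lambda>u. cos (2 * pi * u)) has_real_derivative - ?s * (2 * pi)) (at u)"
    by (auto intro!: derivative_eq_intros)
  have shift: "((\<lambda>u. latitude (u + z)) has_real_derivative latitude' (u + z)) (at u)" for z
    using latitude_derivative[of "u + z"] by (simp only: DERIV_shift)
  have "((\<lambda>u. - (height_scale * sqrt 3) * (sin (2 * pi * u) * quartic (cos (2 * pi * u)))) has_real_derivative
      - (height_scale * sqrt 3) * (?c * (2 * pi) * quartic ?c + q' ?c * (- ?s * (2 * pi)) * ?s)) (at u)"
    by (intro DERIV_cmult DERIV_mult ds DERIV_chain2[OF q ds(2)])
  moreover have "((\<lambda>u. latitude (u + 1/6) - latitude (u - 1/6)) has_real_derivative
      latitude' (u + 1/6) - latitude' (u - 1/6)) (at u)"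
    using DERIV_diff[OF shift[of "1/6"] shift[of "- 1/6"]] by simp
  ultimately have eq: "latitude' (u + 1/6) - latitude' (u - 1/6) =
      - (height_scale * sqrt 3) * (?c * (2 * pi) * quartic ?c + q' ?c * (- ?s * (2 * pi)) * ?s)"
    unfolding latitude_diff by (rule DERIV_unique[symmetric])
  have "?c * (2 * pi) * quartic ?c + q' ?c * (- ?s * (2 * pi)) * ?s \<noteq> 0"
  proof (cases "?s = 0")
    case True
    then have "?c\<^sup>2 = 1" using sin_cos_squared_add[of "2 * pi * u"] by simp
    then have "?c = 1 \<or> ?c = -1" by (simp add: power2_eq_1_iff)
    then have "quartic ?c \<noteq> 0" "?c \<noteq> 0" using c_order c4_less by (auto simp: quartic_def)
    then show ?thesis using True by simp
  next
    case False
    then have c: "?c \<in> {c1, c2, c3}" using assms by (simp add: is_root_def)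
    then have "quartic ?c = 0" by (auto simp: quartic_def)
    moreover have "q' ?c \<noteq> 0" using c c_order c4_less by (auto simp: q'_def)
    ultimately show ?thesis using False by simp
  qed
  then show ?thesis using eq scale_pos by auto
qed

lemma cos_eq_iff_param:
  "cos (2 * pi * u) = cos (k * pi / 8) \<longleftrightarrow> (\<exists>n::int. u = k / 16 + of_int n \<or> u = - k / 16 + of_int n)"
proof -
  have e: "2 * pi * u = k * pi / 8 + 2 * of_int n * pi \<longleftrightarrow> u = k / 16 + of_int n"
    "2 * pi * u = - (k * pi / 8) + 2 * of_int n * pi \<longleftrightarrow> u = - k / 16 + of_int n" for n :: int
  proof -
    have "2 * pi * u = k * pi / 8 + 2 * of_int n * pi \<longleftrightarrow> 2 * pi * u = 2 * pi * (k / 16 + of_int n)"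
      by (simp add: algebra_simps)
    then show "2 * pi * u = k * pi / 8 + 2 * of_int n * pi \<longleftrightarrow> u = k / 16 + of_int n" by simp
    have "2 * pi * u = - (k * pi / 8) + 2 * of_int n * pi \<longleftrightarrow> 2 * pi * u = 2 * pi * (- k / 16 + of_int n)"
      by (simp add: algebra_simps)
    then show "2 * pi * u = - (k * pi / 8) + 2 * of_int n * pi \<longleftrightarrow> u = - k / 16 + of_int n" by simp
  qed
  have "cos (2 * pi * u) = cos (k * pi / 8) \<longleftrightarrow>
      (\<exists>n::int. 2 * pi * u = k * pi / 8 + 2 * of_int n * pi \<or> 2 * pi * u = - (k * pi / 8) + 2 * of_int n * pi)"
    unfolding cos_eq Bex_def Ints_def by auto
  then show ?thesis unfolding e .
qed

text \<open>The window is that of \<open>u = s + 1/6\<close> for \<open>s\<close> in the fundamental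
  domain. The eight roots are the eight crossings.\<close>

lemma roots:
  assumes u: "1/6 \<le> u" "u < 7/6"
  shows "is_root u \<longleftrightarrow> u \<in> {9/48, 24/48, 39/48, 42/48, 45/48, 48/48, 51/48, 54/48}"
proof -
  have sin0: "sin (2 * pi * u) = 0 \<longleftrightarrow> u \<in> {24/48, 48/48}"
  proof -
    have "2 * pi * u = of_int i * pi \<longleftrightarrow> 2 * u = of_int i" for i :: int by (auto simp: algebra_simps)
    then have "sin (2 * pi * u) = 0 \<longleftrightarrow> (\<exists>i::int. 2 * u = of_int i)" unfolding sin_zero_iff_int2 by simp
    also have "\<dots> \<longleftrightarrow> u \<in> {24/48, 48/48}"
    proof
      assume "\<exists>i::int. 2 * u = of_int i"
      then obtain i :: int where i: "2 * u = of_int i" by blast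
      then have "(0::real) < of_int i" "(of_int i::real) < 3" using u by linarith+
      then have "i = 1 \<or> i = 2" by linarith
      then show "u \<in> {24/48, 48/48}" using i by auto
    next
      assume "u \<in> {24/48, 48/48}"
      then have "2 * u = of_int 1 \<or> 2 * u = of_int 2" by auto
      then show "\<exists>i::int. 2 * u = of_int i" by blast
    qed
    finally show ?thesis .
  qed
  have par: "(\<exists>n::int. u = k / 16 + of_int n \<or> u = - k / 16 + of_int n) \<longleftrightarrow>
      u = k / 16 \<or> u = k / 16 + 1 \<or> u = 1 - k / 16" if k: "1 \<le> k" "k \<le> 3" for k :: real
  proof
    assume "\<exists>n::int. u = k / 16 + of_int n \<or> u = - k / 16 + of_int n"
    then obtain n :: int where n: "u = k / 16 + of_int n \<or> u = - k / 16 + of_int n" by blast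
    then have "(-1::real) < of_int n" "(of_int n::real) < 2" using u k by linarith+
    then have "n = 0 \<or> n = 1" by linarith
    then show "u = k / 16 \<or> u = k / 16 + 1 \<or> u = 1 - k / 16" using n u k by auto
  next
    assume "u = k / 16 \<or> u = k / 16 + 1 \<or> u = 1 - k / 16"
    then have "u = k / 16 + of_int 0 \<or> u = k / 16 + of_int 1 \<or> u = - k / 16 + of_int 1" by simp
    then show "\<exists>n::int. u = k / 16 + of_int n \<or> u = - k / 16 + of_int n" by blast
  qed
  have "cos (2 * pi * u) = c1 \<longleftrightarrow> u \<in> {45/48, 51/48}"
    using cos_eq_iff_param[of u 1] par[of 1] u by (auto simp: c1_def)
  moreover have "cos (2 * pi * u) = c2 \<longleftrightarrow> u \<in> {42/48, 54/48}"
    using cos_eq_iff_param[of u 2] par[of 2] u by (auto simp: c2_def)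
  moreover have "cos (2 * pi * u) = c3 \<longleftrightarrow> u \<in> {9/48, 39/48}"
    using cos_eq_iff_param[of u 3] par[of 3] u by (auto simp: c3_def)
  ultimately show ?thesis unfolding is_root_def sin0 by blast
qed

lemma is_root_listed:
  assumes "u \<in> {9/48, 24/48, 39/48, 42/48, 45/48, 48/48, 51/48, 54/48}"
  shows "is_root u"
proof -
  have "1/6 \<le> u" "u < 7/6" using assms by auto
  then show ?thesis using roots assms by blast
qed

definition curve2 :: "real \<Rightarrow> real^3" where
  "curve2 = braid_curve 3 latitude"

text \<open>A root at \<open>s + 1/6\<close> makes \<open>s\<close> and \<open>s + 1/3\<close>
  coincide. For three of the roots both parameters are below 1. For the other five the later one
  passes the end of the period, and reduced modulo 1 it becomes the first of a pair that is 2/3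
  apart.\<close>

lemma in_chords2:
  "(s, t) \<in> pair_set 48 chords2 \<longleftrightarrow>
     (t = s + 1/3 \<and> s + 1/6 \<in> {9/48, 24/48, 39/48}) \<or>
     (t = s + 2/3 \<and> t + 1/6 \<in> {42/48, 45/48, 48/48, 51/48, 54/48})"
proof -
  have "s + 1/6 \<in> {9/48, 24/48, 39/48} \<longleftrightarrow> s \<in> {1/48, 16/48, 31/48}"
    "t + 1/6 \<in> {42/48, 45/48, 48/48, 51/48, 54/48} \<longleftrightarrow> t \<in> {34/48, 37/48, 40/48, 43/48, 46/48}"
    unfolding insert_iff empty_iff eq_diff_eq[symmetric] by simp_all
  moreover have "t = s + 2/3 \<longleftrightarrow> s = t - 2/3" by auto
  ultimately show ?thesis
    unfolding pair_set2 by (simp only: insert_iff empty_iff prod.inject) (rule iffI; elim disjE conjE; simp)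
qed

lemma curve2_generic:
  "generic_immersion S2 curve2" "chord_diagram curve2 = (\<lambda>(s, t). {s, t}) ` pair_set 48 chords2"
proof -
  have third: "latitude (s + 1/3) = latitude s \<longleftrightarrow> is_root (s + 1/6)"
    "is_root (s + 1/6) \<Longrightarrow> latitude' (s + 1/3) \<noteq> latitude' s" for s
    using latitude_eq_iff[of "s + 1/6"] root_transverse[of "s + 1/6"] by (simp_all add: add.assoc)
  have L: "latitude s = latitude t \<and> (\<exists>k::int. real 3 * (t - s) = of_int k) \<longleftrightarrow> (s, t) \<in> pair_set 48 chords2"
    if st: "0 \<le> s" "s < t" "t < 1" for s t
  proof
    assume "latitude s = latitude t \<and> (\<exists>k::int. real 3 * (t - s) = of_int k)"
    then obtain k :: int where k: "latitude s = latitude t" "real 3 * (t - s) = of_int k" by blast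
    then have "(0::real) < of_int k" "(of_int k::real) < 3" using st by auto
    then have "k = 1 \<or> k = 2" by linarith
    then show "(s, t) \<in> pair_set 48 chords2"
    proof
      assume "k = 1"
      then have t: "t = s + 1/3" using k(2) by simp
      then have "is_root (s + 1/6)" using third(1)[of s] k(1) by simp
      then have "s + 1/6 \<in> {9/48, 24/48, 39/48, 42/48, 45/48, 48/48, 51/48, 54/48}"
        using roots[of "s + 1/6"] st t by simp
      then show ?thesis unfolding in_chords2 using t st by auto
    next
      assume "k = 2"
      then have t: "t = s + 2/3" using k(2) by simp
      then have "t + 1/3 = s + 1" by simp
      then have "latitude (t + 1/3) = latitude t" using latitude_periodic(1)[of s] k(1) by simp
      then have "is_root (t + 1/6)" using third(1)[of t] by simp
      then have "t + 1/6 \<in> {9/48, 24/48, 39/48, 42/48, 45/48, 48/48, 51/48, 54/48}"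
        using roots[of "t + 1/6"] st t by simp
      then show ?thesis unfolding in_chords2 using t st by auto
    qed
  next
    assume "(s, t) \<in> pair_set 48 chords2"
    then consider "t = s + 1/3" "s + 1/6 \<in> {9/48, 24/48, 39/48}"
      | "t = s + 2/3" "t + 1/6 \<in> {42/48, 45/48, 48/48, 51/48, 54/48}" unfolding in_chords2 by blast
    then show "latitude s = latitude t \<and> (\<exists>k::int. real 3 * (t - s) = of_int k)"
    proof cases
      case 1
      then have "is_root (s + 1/6)" using is_root_listed[of "s + 1/6"] by blast
      then have "latitude s = latitude t" using third(1)[of s] 1(1) by simp
      moreover have "real 3 * (t - s) = of_int 1" using 1(1) by simp
      ultimately show ?thesis by blast
    next
      case 2
      then have "is_root (t + 1/6)" using is_root_listed[of "t + 1/6"] by blast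
      then have "latitude (t + 1/3) = latitude t" using third(1)[of t] by simp
      moreover have "t + 1/3 = s + 1" using 2(1) by simp
      ultimately have "latitude s = latitude t" using latitude_periodic(1)[of s] by simp
      moreover have "real 3 * (t - s) = of_int 2" using 2(1) by simp
      ultimately show ?thesis by blast
    qed
  qed
  have T: "0 \<le> s \<and> s < t \<and> t < 1 \<and> latitude' s \<noteq> latitude' t" if "(s, t) \<in> pair_set 48 chords2" for s t
  proof -
    from that consider "t = s + 1/3" "s + 1/6 \<in> {9/48, 24/48, 39/48}"
      | "t = s + 2/3" "t + 1/6 \<in> {42/48, 45/48, 48/48, 51/48, 54/48}" unfolding in_chords2 by blast
    then show ?thesis
    proof cases
      case 1
      then have "is_root (s + 1/6)" using is_root_listed[of "s + 1/6"] by blast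
      then have "latitude' s \<noteq> latitude' t" using third(2)[of s] 1(1) by simp
      moreover have "9/48 \<le> s + 1/6" "s + 1/6 \<le> 39/48" using 1(2) by auto
      then have "0 \<le> s" "s < t" "t < 1" using 1(1) by linarith+
      ultimately show ?thesis by blast
    next
      case 2
      then have "is_root (t + 1/6)" using is_root_listed[of "t + 1/6"] by blast
      then have "latitude' (t + 1/3) \<noteq> latitude' t" using third(2)[of t] by simp
      moreover have "t + 1/3 = s + 1" using 2(1) by simp
      ultimately have "latitude' s \<noteq> latitude' t" using latitude_periodic(2)[of s] by simp
      moreover have "42/48 \<le> t + 1/6" "t + 1/6 \<le> 54/48" using 2(2) by auto
      then have "0 \<le> s" "s < t" "t < 1" using 2(1) by linarith+
      ultimately show ?thesis by blast
    qed
  qed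
  have D: "s = u \<and> t = v" if h: "(s, t) \<in> pair_set 48 chords2" "(u, v) \<in> pair_set 48 chords2" "{s, t} \<inter> {u, v} \<noteq> {}" for s t u v
  proof -
    have disjoint: "\<forall>x\<in>set chords2. \<forall>y\<in>set chords2. {fst x, snd x} \<inter> {fst y, snd y} \<noteq> {} \<longrightarrow> x = y"
      by (simp add: chords2_def)
    obtain m n m' n' where mn: "(m, n) \<in> set chords2" "(m', n') \<in> set chords2"
      "s = of_int m / 48" "t = of_int n / 48" "u = of_int m' / 48" "v = of_int n' / 48"
      using h(1,2) unfolding pair_set_def by auto
    have "{m, n} \<inter> {m', n'} \<noteq> {}" using h(3) unfolding mn(3-6) by auto
    then have "(m, n) = (m', n')"
      using bspec[OF bspec[OF disjoint mn(1)] mn(2)] unfolding fst_conv snd_conv by (rule rev_mp)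
    then show ?thesis using mn by simp
  qed
  have fin: "finite (pair_set 48 chords2)" by (simp add: pair_set_def)
  show "generic_immersion S2 curve2" "chord_diagram curve2 = (\<lambda>(s, t). {s, t}) ` pair_set 48 chords2"
    unfolding curve2_def
    by (rule braid_curve_generic[OF _ elementary_latitude latitude_periodic(1) latitude_bound latitude_derivative fin L T D]; simp)+
qed

theorem mainTheorem2:
  shows "(invariant_under S2 (ambient_isotopic S2) lambda4 \<and>
          invariant_under S2 (RI S2) lambda4 \<and>
          invariant_under S2 (strong_RIII S2) lambda4) \<and>
         (invariant_under plane (ambient_isotopic plane) lambda4 \<and>
          invariant_under plane (RI plane) lambda4 \<and>
          invariant_under plane (strong_RIII plane) lambda4) \<and>
         (\<exists>P P'. generic_immersion S2 P \<and> generic_immersion S2 P' \<and>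
            lambda3 P = lambda3 P' \<and> lambda4 P \<noteq> lambda4 P')"
proof (intro conjI exI)
  show "invariant_under S2 (ambient_isotopic S2) lambda4" by (rule ambient_isotopic_invariant[OF surface_S2])
  show "invariant_under S2 (RI S2) lambda4" by (rule RI_invariant[OF surface_S2])
  show "invariant_under S2 (strong_RIII S2) lambda4" by (rule strong_RIII_invariant[OF surface_S2])
  show "invariant_under plane (ambient_isotopic plane) lambda4" by (rule ambient_isotopic_invariant[OF surface_plane])
  show "invariant_under plane (RI plane) lambda4" by (rule RI_invariant[OF surface_plane])
  show "invariant_under plane (strong_RIII plane) lambda4" by (rule strong_RIII_invariant[OF surface_plane])
  show "generic_immersion S2 curve1" by (rule curve1_generic)
  show "generic_immersion S2 curve2" by (rule curve2_generic)
  have less1: "\<And>m n. (m, n) \<in> set chords1 \<Longrightarrow> m < n" and less2: "\<And>m n. (m, n) \<in> set chords2 \<Longrightarrow> m < n"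
    by (auto simp: chords1_def chords2_def)
  have distinct: "distinct chords1" "distinct chords2" by (simp_all add: chords1_def chords2_def)
  have "lambda3 curve1 = -20" "lambda4 curve1 = -20"
    using lambda_list_sum[OF curve1_generic[unfolded pair_set_def] _ distinct(1) less1] list_sums
    by simp_all
  moreover have "lambda3 curve2 = -20" "lambda4 curve2 = -28"
    using lambda_list_sum[OF curve2_generic[unfolded pair_set_def] _ distinct(2) less2] list_sums3 list_sums4
    by simp_all
  ultimately show "lambda3 curve1 = lambda3 curve2" "lambda4 curve1 \<noteq> lambda4 curve2" by simp_all
qed

end
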